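(* Let $G$ be the group of automorphisms of the Boolean algebra $\mathcal{P}(\omega_1)/\mathrm{fin}$. If there is no isomorphism between the Boolean algebras $\mathcal{P}(\omega)/\mathrm{fin}$ and $\mathcal{P}(\omega_1)/\mathrm{fin}$, then the universal minimal flow of $G$ is the space $\mathrm{NO}(\mathcal{P}^{\omega_1}_{\omega})$ of normal orderings of $\mathcal{P}(\omega_1)/\mathrm{fin}$ (with respect to the ideal of classes of countable sets).
   Context: $\mathcal{P}(\kappa)/\mathrm{fin}$ is the quotient of the power set Boolean algebra of $\kappa$ by the ideal of finite sets; $[X]$ denotes the class of $X$. Let $P_\omega$ be the ideal on $\mathcal{P}(\omega_1)/\mathrm{fin}$ of classes $[X]$ of countable sets $X\subseteq\omega_1$, and let $\mathcal{P}^{\omega_1}_{\omega}$ be the Boolean algebra $\mathcal{P}(\omega_1)/\mathrm{fin}$ expanded by the predicate $P_\omega$ (and by $P_{\omega_1}$, the whole algebra, which imposes no condition). Automorphism groups carry the topology of pointwise convergence (underlying structure discrete). A linear ordering $<$ of the atoms of a finite subalgebra $A$ of $\mathcal{P}(\omega_1)/\mathrm{fin}$ is proper if $a<b$ whenever $a,b$ are atoms of $A$ with $a\in P_\omega$ and $b\notin P_\omega$. A linear ordering of $A$ is natural if it is the antilexicographical extension of a proper ordering $a_1<\dots<a_n$ of its atoms: for distinct $x,y\in A$, $x<y$ iff, for the largest $m$ such that exactly one of $a_m\le x$, $a_m\le y$ holds (with $\le$ the Boolean order), we have $a_m\le y$. $\mathrm{NO}(\mathcal{P}^{\omega_1}_{\omega})$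 is the set of all linear orderings of $\mathcal{P}(\omega_1)/\mathrm{fin}$ whose restriction to every finite subalgebra is natural, with the subspace topology from $2^{\mathcal{P}(\omega_1)/\mathrm{fin}\times\mathcal{P}(\omega_1)/\mathrm{fin}}$ and the action $a\,(g{<})\,b\iff g^{-1}a<g^{-1}b$. For a topological group $G$, a $G$-flow is a continuous action of $G$ on a compact Hausdorff space; the universal minimal flow is the (unique up to isomorphism of $G$-flows) minimal $G$-flow having every minimal $G$-flow as a factor. "Is" means isomorphic as $G$-flows. *)

theory Defs
  imports "HOL-Analysis.Analysis" "HOL-Algebra.Group_Action"
begin

section \<open>The Boolean algebra of subsets modulo finite sets\<close>

quotient_type 'a pfin = "'a set" / "\<lambda>X Y. finite (sym_diff X Y)"
proof (rule equivpI)
  show "reflp (\<lambda>X Y :: 'a set. finite (sym_diff X Y))"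
    by (simp add: reflp_def)
  show "symp (\<lambda>X Y :: 'a set. finite (sym_diff X Y))"
    by (auto simp: symp_def)
  show "transp (\<lambda>X Y :: 'a set. finite (sym_diff X Y))"
  proof (rule transpI)
    fix X Y Z :: "'a set"
    assume "finite (sym_diff X Y)" "finite (sym_diff Y Z)"
    then have "finite (sym_diff X Y \<union> sym_diff Y Z)" by blast
    then show "finite (sym_diff X Z)" by (rule rev_finite_subset) blast
  qed
qed

instantiation pfin :: (type) boolean_algebra
begin

lift_definition bot_pfin :: "'a pfin" is "{}" .
lift_definition top_pfin :: "'a pfin" is "UNIV" .
lift_definition uminus_pfin :: "'a pfin \<Rightarrow> 'a pfin" is "\<lambda>X. - X"
  by (erule rev_finite_subset) blast
lift_definition inf_pfin :: "'a pfin \<Rightarrow> 'a pfin \<Rightarrow> 'a pfin" is "\<lambda>X Y. X \<inter> Y"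
  by (drule (1) finite_UnI, erule rev_finite_subset) blast
lift_definition sup_pfin :: "'a pfin \<Rightarrow> 'a pfin \<Rightarrow> 'a pfin" is "\<lambda>X Y. X \<union> Y"
  by (drule (1) finite_UnI, erule rev_finite_subset) blast
lift_definition minus_pfin :: "'a pfin \<Rightarrow> 'a pfin \<Rightarrow> 'a pfin" is "\<lambda>X Y. X - Y"
  by (drule (1) finite_UnI, erule rev_finite_subset) blast
lift_definition less_eq_pfin :: "'a pfin \<Rightarrow> 'a pfin \<Rightarrow> bool" is "\<lambda>X Y. finite (X - Y)"
proof -
  fix X1 X2 Y1 Y2 :: "'a set"
  assume a: "finite (sym_diff X1 X2)" "finite (sym_diff Y1 Y2)"
  have "finite (X2 - Y2)" if "finite (X1 - Y1)"
    by (rule finite_subset[of _ "sym_diff X1 X2 \<union> sym_diff Y1 Y2 \<union> (X1 - Y1)"])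
      (use a that in auto)
  moreover have "finite (X1 - Y1)" if "finite (X2 - Y2)"
    by (rule finite_subset[of _ "sym_diff X1 X2 \<union> sym_diff Y1 Y2 \<union> (X2 - Y2)"])
      (use a that in auto)
  ultimately show "finite (X1 - Y1) = finite (X2 - Y2)" by blast
qed
definition less_pfin :: "'a pfin \<Rightarrow> 'a pfin \<Rightarrow> bool"
  where "less_pfin x y \<longleftrightarrow> x \<le> y \<and> \<not> y \<le> x"

instance
proof
  fix x y z :: "'a pfin"
  show "x < y \<longleftrightarrow> x \<le> y \<and> \<not> y \<le> x" by (rule less_pfin_def)
  show "x \<le> x" by transfer simp
  show "x \<le> z" if "x \<le> y" "y \<le> z" using that
    by transfer (drule (1) finite_UnI, erule rev_finite_subset, blast)
  show "x = y" if "x \<le> y" "y \<le> x" using that by transfer simp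
  show "inf x y \<le> x" "inf x y \<le> y" "x \<le> sup x y" "y \<le> sup x y"
    by (transfer, auto intro: rev_finite_subset[OF finite.emptyI])+
  show "x \<le> inf y z" if "x \<le> y" "x \<le> z" using that
    by transfer (simp add: Diff_Int)
  show "sup y z \<le> x" if "y \<le> x" "z \<le> x" using that
    by transfer (simp add: Un_Diff)
  show "bot \<le> x" "x \<le> Orderings.top" by (transfer, simp)+
  show "sup x (inf y z) = inf (sup x y) (sup x z)"
    by transfer (simp add: Un_Int_distrib)
  show "inf x (- x) = bot" by transfer simp
  show "sup x (- x) = Orderings.top" by transfer simp
  show "x - y = inf x (- y)" by transfer (simp add: Diff_eq)
qed

end

definition countable_classes :: "'a pfin set"
  where "countable_classes = abs_pfin ` {X. countable X}"

text \<open>The library type \<open>nat suc\<close> is the field of the successor cardinal of \<open>|UNIV :: nat set|\<close>,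
  that is, a set of cardinality \<open>\<aleph>\<^sub>1\<close>; only its cardinality matters.\<close>

type_synonym omega1 = "nat suc"


section \<open>Isomorphisms and automorphisms\<close>

definition boolean_iso :: "('a::boolean_algebra \<Rightarrow> 'b::boolean_algebra) \<Rightarrow> bool"
  where "boolean_iso f \<longleftrightarrow> bij f \<and>
    (\<forall>x y. f (inf x y) = inf (f x) (f y)) \<and>
    (\<forall>x y. f (sup x y) = sup (f x) (f y)) \<and>
    (\<forall>x. f (- x) = - f x) \<and> f bot = bot \<and> f Orderings.top = Orderings.top"

definition aut_group :: "('a::boolean_algebra \<Rightarrow> 'a) monoid"
  where "aut_group = \<lparr>carrier = {f. boolean_iso f}, mult = (\<circ>), one = id\<rparr>"

definition pointwise_topology :: "('a \<Rightarrow> 'b) set \<Rightarrow> ('a \<Rightarrow> 'b) topology"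
  where "pointwise_topology S =
    subtopology (product_topology (\<lambda>_. discrete_topology UNIV) UNIV) S"


section \<open>Natural orderings\<close>

definition finite_subalgebra :: "'a::boolean_algebra set \<Rightarrow> bool"
  where "finite_subalgebra A \<longleftrightarrow> finite A \<and> bot \<in> A \<and> Orderings.top \<in> A \<and>
    (\<forall>x\<in>A. - x \<in> A) \<and> (\<forall>x\<in>A. \<forall>y\<in>A. inf x y \<in> A \<and> sup x y \<in> A)"

definition atoms :: "'a::boolean_algebra set \<Rightarrow> 'a set"
  where "atoms A = {a \<in> A. a \<noteq> bot \<and> (\<forall>x\<in>A. x \<le> a \<longrightarrow> x = bot \<or> x = a)}"

text \<open>A linear ordering of the finitely many atoms is given by their increasing enumeration.
  The set \<open>P\<close> is the distinguished ideal.\<close>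

definition proper_enum :: "'a::boolean_algebra set \<Rightarrow> 'a set \<Rightarrow> 'a list \<Rightarrow> bool"
  where "proper_enum P A as \<longleftrightarrow> distinct as \<and> set as = atoms A \<and>
    (\<forall>i<length as. \<forall>j<length as. as ! i \<in> P \<and> as ! j \<notin> P \<longrightarrow> i < j)"

definition antilex :: "'a::boolean_algebra set \<Rightarrow> 'a list \<Rightarrow> 'a rel"
  where "antilex A as = {(x, y). x \<in> A \<and> y \<in> A \<and> x \<noteq> y \<and>
    as ! Max {m. m < length as \<and> (as ! m \<le> x) \<noteq> (as ! m \<le> y)} \<le> y}"

definition natural_ordering :: "'a::boolean_algebra set \<Rightarrow> 'a set \<Rightarrow> 'a rel \<Rightarrow> bool"
  where "natural_ordering P A r \<longleftrightarrow> (\<exists>as. proper_enum P A as \<and> r = antilex A as)"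

text \<open>Orderings are strict, and are represented by their characteristic functions.\<close>

definition NO :: "'a::boolean_algebra set \<Rightarrow> ('a \<times> 'a \<Rightarrow> bool) set"
  where "NO P = {R. strict_linear_order (Collect R) \<and>
    (\<forall>A. finite_subalgebra A \<longrightarrow> natural_ordering P A (Restr (Collect R) A))}"

text \<open>Library group actions on a set consist of functions that are \<open>undefined\<close> outside
  that set, hence the restriction.\<close>

definition NO_action ::
    "'a::boolean_algebra set \<Rightarrow> ('a \<Rightarrow> 'a) \<Rightarrow> ('a \<times> 'a \<Rightarrow> bool) \<Rightarrow> ('a \<times> 'a \<Rightarrow> bool)"
  where "NO_action P g =
    (\<lambda>R\<in>NO P. \<lambda>(a, b). R (inv_into UNIV g a, inv_into UNIV g b))"


section \<open>Flows\<close>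

definition topological_group :: "('g, 'm) monoid_scheme \<Rightarrow> 'g topology \<Rightarrow> bool"
  where "topological_group G T \<longleftrightarrow> group G \<and> topspace T = carrier G \<and>
    continuous_map (prod_topology T T) T (\<lambda>(g, h). g \<otimes>\<^bsub>G\<^esub> h) \<and>
    continuous_map T T (\<lambda>g. inv\<^bsub>G\<^esub> g)"

definition flow ::
    "('g, 'm) monoid_scheme \<Rightarrow> 'g topology \<Rightarrow> 'x topology \<Rightarrow> ('g \<Rightarrow> 'x \<Rightarrow> 'x) \<Rightarrow> bool"
  where "flow G T X \<phi> \<longleftrightarrow> topological_group G T \<and> compact_space X \<and> Hausdorff_space X \<and>
    group_action G (topspace X) \<phi> \<and>
    continuous_map (prod_topology T X) X (\<lambda>(g, x). \<phi> g x)"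

definition minimal_flow ::
    "('g, 'm) monoid_scheme \<Rightarrow> 'g topology \<Rightarrow> 'x topology \<Rightarrow> ('g \<Rightarrow> 'x \<Rightarrow> 'x) \<Rightarrow> bool"
  where "minimal_flow G T X \<phi> \<longleftrightarrow> flow G T X \<phi> \<and> topspace X \<noteq> {} \<and>
    (\<forall>C. closedin X C \<and> C \<noteq> {} \<and> (\<forall>g\<in>carrier G. \<phi> g ` C \<subseteq> C) \<longrightarrow> C = topspace X)"

definition factor_map ::
    "('g, 'm) monoid_scheme \<Rightarrow> 'x topology \<Rightarrow> ('g \<Rightarrow> 'x \<Rightarrow> 'x) \<Rightarrow>
      'y topology \<Rightarrow> ('g \<Rightarrow> 'y \<Rightarrow> 'y) \<Rightarrow> ('x \<Rightarrow> 'y) \<Rightarrow> bool"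
  where "factor_map G X \<phi> Y \<psi> f \<longleftrightarrow>
    continuous_map X Y f \<and> f ` topspace X = topspace Y \<and>
    (\<forall>g\<in>carrier G. \<forall>x\<in>topspace X. f (\<phi> g x) = \<psi> g (f x))"

text \<open>The points of the competing flows range over the type \<open>'y\<close>, which has to be left
  arbitrary: a statement about \<open>universal_minimal_flow TYPE('y)\<close> with \<open>'y\<close> a type variable
  is about all minimal flows.\<close>

definition universal_minimal_flow ::
    "'y itself \<Rightarrow> ('g, 'm) monoid_scheme \<Rightarrow> 'g topology \<Rightarrow>
      'x topology \<Rightarrow> ('g \<Rightarrow> 'x \<Rightarrow> 'x) \<Rightarrow> bool"
  where "universal_minimal_flow (_ :: 'y itself) G T X \<phi> \<longleftrightarrow> minimal_flow G T X \<phi> \<and>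
    (\<forall>(Y :: 'y topology) \<psi>. minimal_flow G T Y \<psi> \<longrightarrow> (\<exists>f. factor_map G X \<phi> Y \<psi> f))"

end

theory Submission
  imports Defs
begin

text \<open>
Let \<open>G\<close> be the automorphism group and let \<open>P\<close> be the ideal of the classes of countable sets. If an
automorphism mapped the class of a countable set to the class of an uncountable one, its restriction
to the elements below the former would be an isomorphism between the two quotient algebras in the
hypothesis; hence \<open>G\<close> preserves \<open>P\<close> (\<open>automorphism_preserves_countable\<close>) and acts on the natural
orderings. In the other direction permutations of \<open>\<omega>\<^sub>1\<close> provide many automorphisms: two finite
partitions whose pieces correspond in number and in countability are conjugate
(\<open>partition_homogeneous\<close>).

Being natural amounts to eight conditions that mention at most three elements each
(\<open>NO_iff_antilexicographic\<close>). So the natural orderings form a compact space, and by compactness it is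
not empty. By homogeneity the translates of one natural ordering realise every natural ordering of
every finite subalgebra; therefore each orbit is dense (\<open>orbit_dense\<close>), which is minimality.

For universality fix a natural ordering \<open>R\<close> and a minimal flow \<open>Y\<close>, and look for a point \<open>z\<close> of \<open>Y\<close>
such that the place of \<open>g z\<close>, up to a small error, depends only on the restriction of \<open>g R\<close> to some
finite subalgebra. Given such a point, the closure of the orbit of \<open>(R, z)\<close> in the product of the two
flows is the graph of the factor map (\<open>NO_universal\<close>). By compactness of \<open>Y\<close> it is enough to satisfy
finitely many requirements of this kind at a time, and there an arbitrary point \<open>y\<^sub>0\<close> can be corrected
by a translation. Indeed the place of \<open>g y\<^sub>0\<close>, up to a small error, is a colouring with finitely many
colours of the embeddings \<open>g\<^sup>-\<^sup>1\<close> of a finite subalgebra, and a Ramsey theorem yields a copy of a given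
finite subalgebra on which the colour of an embedding depends only on the ordering that the
embedding pulls back (\<open>ex_homogeneous_translate\<close>).

The Ramsey theorem is about words. An embedding of an algebra with \<open>k\<close> atoms into one with \<open>n\<close> atoms is
a map from the \<open>n\<close> atoms onto the \<open>k\<close> atoms. With both sets of atoms listed in decreasing order, the
pulled back ordering is the given one iff the letters of the corresponding word appear for the first time
in their natural order (\<open>embedding_word\<close>). Without the ideal this is the dual Ramsey theorem. With the
ideal, the uncountable atoms are listed before the countable ones; the letters of the first block are
those of the uncountable atoms, and all of them may occur again in the second block, as letters of an
alphabet next to the new parameters. That is the setting of the Graham--Rothschild theorem for
parameter words over an alphabet, which is derived here from the Hales--Jewett theorem and then
applied once to each block (\<open>typed_ramsey\<close>).
\<close>

section \<open>Parameter words\<close>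

text \<open>The lists \<open>w\<close> with \<open>param_word c w k\<close> are the parameter words over the alphabet \<open>{..<c}\<close> with
parameters \<open>c, \<dots>, k - 1\<close>, each used, in the order of their first occurrence. Letters and parameters
are taken from one initial segment of the natural numbers, so that a parameter becomes a letter
of a larger alphabet once it has been introduced.\<close>

fun param_word :: "nat \<Rightarrow> nat list \<Rightarrow> nat \<Rightarrow> bool" where
  "param_word c [] k \<longleftrightarrow> c = k"
| "param_word c (x # w) k \<longleftrightarrow> x < c \<and> param_word c w k \<or> x = c \<and> param_word (Suc c) w k"

text \<open>The word \<open>u\<close> lists the values of the parameters only; the letters of the alphabet stay fixed.\<close>

definition word_subst :: "nat \<Rightarrow> nat list \<Rightarrow> nat list \<Rightarrow> nat list"
  where "word_subst c u w = map (\<lambda>x. if x < c then x else u ! (x - c)) w"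

lemma length_word_subst [simp]: "length (word_subst c u w) = length w"
  by (simp add: word_subst_def)

lemma word_subst_append [simp]:
  "word_subst c u (v @ w) = word_subst c u v @ word_subst c u w"
  by (simp add: word_subst_def)

lemma param_word_le: "param_word c w k \<Longrightarrow> c \<le> k"
  by (induction w arbitrary: c) (auto, fastforce)

lemma param_word_set: "param_word c w k \<Longrightarrow> set w \<subseteq> {..<k}"
proof (induction w arbitrary: c)
  case (Cons x w)
  then show ?case using param_word_le by (fastforce simp: Suc_le_eq)
qed simp

lemma param_word_onto: "param_word c w k \<Longrightarrow> {c..<k} \<subseteq> set w"
proof (induction w arbitrary: c)
  case (Cons x w)
  then show ?case by (auto simp: subset_iff) (metis Suc_leI le_neq_implies_less)
qed simp

lemma param_word_append:
  "param_word c (v @ w) k \<longleftrightarrow> (\<exists>j. param_word c v j \<and> param_word j w k)"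
  by (induction v arbitrary: c) auto

lemma param_word_same: "param_word c w c \<longleftrightarrow> set w \<subseteq> {..<c}"
  by (induction w) (auto dest: param_word_le)

lemma param_word_upt: "c \<le> k \<Longrightarrow> param_word c [c..<k] k"
proof (induction "k - c" arbitrary: c)
  case (Suc n)
  then have "[c..<k] = c # [Suc c..<k]" by (simp add: upt_conv_Cons)
  then show ?case using Suc by simp
qed simp

text \<open>The common reason for all closure properties of parameter words: \<open>u\<close> lists the values of \<open>f\<close> at the
parameters of \<open>w\<close>, and parameters of \<open>w\<close> are met in increasing order, so new letters of \<open>u\<close> also show up
in increasing order.\<close>

lemma param_word_map:
  assumes "param_word a w m" "param_word c u k" "length u = m - a"
    "\<And>x. x < a \<Longrightarrow> f x < c" "\<And>i. i < length u \<Longrightarrow> f (a + i) = u ! i"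
  shows "param_word c (map f w) k"
  using assms
proof (induction w arbitrary: a c u)
  case (Cons x w)
  show ?case
  proof (cases "x < a")
    case True
    then show ?thesis using Cons by auto
  next
    case False
    then have x: "x = a" and w: "param_word (Suc a) w m" using Cons.prems by auto
    have "Suc a \<le> m" using w by (rule param_word_le)
    then obtain y u' where u: "u = y # u'" using Cons.prems(3) by (cases u) auto
    have y: "f a = y" using Cons.prems(5)[of 0] u by simp
    have len: "length u' = m - Suc a" using Cons.prems(3) u by simp
    have idx: "f (Suc a + i) = u' ! i" if "i < length u'" for i
      using Cons.prems(5)[of "Suc i"] that u by simp
    consider "y < c" "param_word c u' k" | "y = c" "param_word (Suc c) u' k"
      using Cons.prems(2) u by auto
    then show ?thesis
    proof cases
      case 1
      have "param_word c (map f w) k"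
        by (rule Cons.IH[OF w 1(2) len _ idx]) (use Cons.prems(4) y 1 in \<open>auto simp: less_Suc_eq\<close>)
      then show ?thesis using 1 x y by simp
    next
      case 2
      have "param_word (Suc c) (map f w) k"
        by (rule Cons.IH[OF w 2(2) len _ idx]) (use Cons.prems(4) y 2 in \<open>auto simp: less_Suc_eq\<close>)
      then show ?thesis using 2 x y by simp
    qed
  qed
qed simp

lemma param_word_subst:
  assumes "param_word c w m" "param_word c u k" "length u = m - c"
  shows "param_word c (word_subst c u w) k"
  unfolding word_subst_def by (rule param_word_map[OF assms]) auto

lemma word_subst_assoc:
  assumes "set w \<subseteq> {..<c + length v}"
  shows "word_subst c u (word_subst c v w) = word_subst c (word_subst c u v) w"
  using assms by (auto simp: word_subst_def)

lemma word_subst_cong: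
  assumes "set w \<subseteq> {..<c + length u}" 
  shows "word_subst c (u @ v) w = word_subst c u w"
  using assms by (auto simp: word_subst_def nth_append)

definition homogeneous :: "nat \<Rightarrow> nat \<Rightarrow> nat \<Rightarrow> (nat list \<Rightarrow> 'c) \<Rightarrow> nat list \<Rightarrow> bool"
  where "homogeneous c m k col W \<longleftrightarrow>
    (\<forall>u u'. length u = m - c \<longrightarrow> length u' = m - c \<longrightarrow> param_word c u k \<longrightarrow> param_word c u' k \<longrightarrow>
      col (word_subst c u W) = col (word_subst c u' W))"

text \<open>The shape of all finite Ramsey statements below: words of length \<open>n\<close> are long enough that every
colouring with \<open>r\<close> colours admits a parameter word on which it has the regularity \<open>\<Phi>\<close>.\<close>

definition unavoidable ::
    "nat \<Rightarrow> nat \<Rightarrow> nat \<Rightarrow> ((nat list \<Rightarrow> nat) \<Rightarrow> nat list \<Rightarrow> bool) \<Rightarrow> nat \<Rightarrow> bool"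
  where "unavoidable c m r \<Phi> n \<longleftrightarrow> (\<forall>col. (\<forall>w. col w < r) \<longrightarrow>
    (\<exists>W. length W = n \<and> param_word c W m \<and> \<Phi> col W))"

lemma unavoidableI:
  assumes "\<And>col. \<forall>w. col w < r \<Longrightarrow> \<exists>W. length W = n \<and> param_word c W m \<and> \<Phi> col W"
  shows "unavoidable c m r \<Phi> n"
  using assms unfolding unavoidable_def by blast

lemma unavoidableE:
  assumes "unavoidable c m r \<Phi> n" "\<forall>w. col w < r"
  obtains W where "length W = n" "param_word c W m" "\<Phi> col W"
  using assms unfolding unavoidable_def by blast

text \<open>The Graham--Rothschild property. Parameter words without parameters are the words over the
alphabet, so \<open>GR c m c r\<close> is the Hales--Jewett property in dimension \<open>m - c\<close>.\<close>

abbreviation GR :: "nat \<Rightarrow> nat \<Rightarrow> nat \<Rightarrow> nat \<Rightarrow> nat \<Rightarrow> bool"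
  where "GR c m k r \<equiv> unavoidable c m r (homogeneous c m k)"

lemma homogeneousD:
  assumes "homogeneous c m k col W" "param_word c u k" "param_word c u' k"
    "length u = m - c" "length u' = m - c"
  shows "col (word_subst c u W) = col (word_subst c u' W)"
  using assms unfolding homogeneous_def by blast

text \<open>Finitely many colourings are one colouring by vectors of colours.\<close>

lemma GR_simultaneous:
  fixes col :: "'p \<Rightarrow> nat list \<Rightarrow> nat"
  assumes "GR c m k (r ^ card P) n" "finite P" "\<And>p w. col p w < r"
  shows "\<exists>W. length W = n \<and> param_word c W m \<and> (\<forall>p\<in>P. homogeneous c m k (col p) W)"
proof -
  let ?S = "P \<rightarrow>\<^sub>E {..<r}"
  have fin: "finite ?S" using assms(2) by (simp add: finite_PiE)
  have card: "card ?S = r ^ card P" using assms(2) by (simp add: card_PiE)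
  obtain h where h: "bij_betw h ?S {0..<card ?S}" using ex_bij_betw_finite_nat[OF fin] by blast
  define col' where "col' w = (\<lambda>p\<in>P. col p w)" for w
  have S: "col' w \<in> ?S" for w using assms(3) by (auto simp: col'_def)
  have "\<forall>w. h (col' w) < r ^ card P" using bij_betwE[OF h] S card by fastforce
  from unavoidableE[OF assms(1) this]
  obtain W where W: "length W = n" "param_word c W m" "homogeneous c m k (\<lambda>w. h (col' w)) W" .
  have inj: "col' w = col' w'" if "h (col' w) = h (col' w')" for w w'
    using h S that by (meson bij_betw_imp_inj_on inj_onD)
  have "homogeneous c m k (col p) W" if "p \<in> P" for p
    unfolding homogeneous_def
  proof (intro allI impI)
    fix u u' assume "length u = m - c" "length u' = m - c" "param_word c u k" "param_word c u' k"
    then have "col' (word_subst c u W) = col' (word_subst c u' W)"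
      using homogeneousD[OF W(3)] inj by blast
    then show "col p (word_subst c u W) = col p (word_subst c u' W)"
      using that by (metis col'_def restrict_apply')
  qed
  then show ?thesis using W by blast
qed

lemma finite_param_words: "finite {w. length w = n \<and> param_word c w k}"
  by (rule finite_subset[OF _ finite_lists_length_eq[of "{..<k}" n]])
    (use param_word_set in auto)

section \<open>The Hales--Jewett theorem\<close>

lemma word_subst_in_letters:
  assumes "set W \<subseteq> {..<c + length u}" "set u \<subseteq> {..<t}" "\<And>x. x \<in> set W \<Longrightarrow> x < c \<Longrightarrow> x < t"
  shows "set (word_subst c u W) \<subseteq> {..<t}"
  using assms by (fastforce simp: word_subst_def subset_iff)

text \<open>A line \<open>Z\<close> is chosen on the last coordinates that is monochromatic for every choice of the first ones;
then the colour depends on the first coordinates only.\<close>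

lemma HJ_multi_step:
  assumes t: "t > 0"
    and 1: "\<And>r. \<exists>n. GR t (t + m) t r n" and 2: "\<And>r. \<exists>n. GR t (t + 1) t r n"
  shows "\<exists>n. GR t (t + Suc m) t r n"
proof -
  obtain n1 where n1: "GR t (t + m) t r n1" using 1 by blast
  define P where "P = {p. length p = n1 \<and> set p \<subseteq> {..<t}}"
  have finP: "finite P" unfolding P_def using finite_lists_length_eq[of "{..<t}" n1] by (simp add: conj_commute)
  obtain n2 where n2: "GR t (t + 1) t (r ^ card P) n2" using 2 by blast
  have "GR t (t + Suc m) t r (n1 + n2)"
  proof (rule unavoidableI)
    fix col :: "nat list \<Rightarrow> nat" assume col: "\<forall>w. col w < r"
    obtain Z where Z: "length Z = n2" "param_word t Z (t + 1)"
      "\<And>p. p \<in> P \<Longrightarrow> homogeneous t (t + 1) t (\<lambda>v. col (p @ v)) Z"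
      using GR_simultaneous[OF n2 finP, of "\<lambda>p v. col (p @ v)"] col by blast
    let ?Z0 = "word_subst t [0] Z"
    have "\<forall>p. col (p @ ?Z0) < r" using col by simp
    from unavoidableE[OF n1 this] obtain U where U: "length U = n1" "param_word t U (t + m)"
      "homogeneous t (t + m) t (\<lambda>p. col (p @ ?Z0)) U" .
    let ?r = "word_subst t [t + m] Z"
    have r: "param_word (t + m) ?r (Suc (t + m))"
      unfolding word_subst_def
      by (rule param_word_map[OF Z(2), of _ "[t + m]"]) auto
    let ?W = "U @ ?r"
    have W: "param_word t ?W (t + Suc m)"
      using U(2) r by (auto simp: param_word_append)
    have "col (word_subst t u ?W) = col (word_subst t (take m u) U @ ?Z0)"
      if u: "length u = Suc m" "param_word t u t" for u
    proof -
      have su: "set u \<subseteq> {..<t}" using u param_word_same by blast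
      have "word_subst t u ?r = word_subst t [u ! m] Z"
        using param_word_set[OF Z(2)] by (auto simp: word_subst_def less_Suc_eq)
      moreover have "word_subst t u U = word_subst t (take m u) U"
        using word_subst_cong[of U t "take m u" "drop m u"] param_word_set[OF U(2)] u by simp
      moreover have "word_subst t (take m u) U \<in> P"
      proof -
        have "set (word_subst t (take m u) U) \<subseteq> {..<t}"
          by (rule word_subst_in_letters)
            (use param_word_set[OF U(2)] su u(1) in \<open>auto dest: in_set_takeD\<close>)
        then show ?thesis unfolding P_def using U(1) by simp
      qed
      moreover have "u ! m < t" using su u(1) by (metis lessI nth_mem subsetD lessThan_iff)
      ultimately show ?thesis
        using homogeneousD[OF Z(3), of "word_subst t (take m u) U" "[u ! m]" "[0]"] t by auto
    qed
    moreover have "param_word t (take m u) t" "length (take m u) = m" if "param_word t u t" "length u = Suc m" for u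
      using that by (auto simp: param_word_same dest: in_set_takeD)
    ultimately have "homogeneous t (t + Suc m) t col ?W"
      using homogeneousD[OF U(3)] unfolding homogeneous_def by simp
    then show "\<exists>W. length W = n1 + n2 \<and> param_word t W (t + Suc m) \<and> homogeneous t (t + Suc m) t col W"
      using W U(1) Z(1) by (intro exI[of _ ?W]) simp
  qed
  then show ?thesis by blast
qed

lemma HJ_multi:
  assumes "t > 0" "\<And>r. \<exists>n. GR t (t + 1) t r n"
  shows "\<exists>n. GR t (t + m) t r n"
proof (induction m arbitrary: r)
  case 0
  have "GR t t t r 0" by (auto simp: unavoidable_def homogeneous_def)
  then show ?case by auto
next
  case (Suc m)
  show ?case by (rule HJ_multi_step[OF assms(1) Suc assms(2)])
qed

text \<open>For words of \<open>L\<close> letters that start with \<open>i\<close> copies of the new letter \<open>t\<close>, the rest, if it avoids \<open>t\<close>,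
does not matter.\<close>

definition HJ_fused :: "nat \<Rightarrow> nat \<Rightarrow> nat \<Rightarrow> (nat list \<Rightarrow> 'c) \<Rightarrow> nat list \<Rightarrow> bool"
  where "HJ_fused t j L col W \<longleftrightarrow> (\<forall>i<j. \<forall>u u'. length u = L - i \<longrightarrow> length u' = L - i \<longrightarrow>
      set u \<subseteq> {..<t} \<longrightarrow> set u' \<subseteq> {..<t} \<longrightarrow>
      col (word_subst (Suc t) (replicate i t @ u) W) = col (word_subst (Suc t) (replicate i t @ u') W))"

lemma HJ_fusedD:
  assumes "HJ_fused t j L col W" "i < j" "length u = L - i" "length u' = L - i"
    "set u \<subseteq> {..<t}" "set u' \<subseteq> {..<t}"
  shows "col (word_subst (Suc t) (replicate i t @ u) W) = col (word_subst (Suc t) (replicate i t @ u') W)"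
  using assms unfolding HJ_fused_def by blast

text \<open>The property is obtained for one \<open>i\<close> after the other. The first \<open>j\<close> parameters are kept, and the
remaining part is replaced by a word given by the smaller alphabet. Since that word contains no
letter \<open>t\<close>, the earlier instances survive.\<close>

lemma HJ_fusion:
  assumes HJ: "\<And>m r. \<exists>n. GR t (t + m) t r n"
  shows "\<exists>n. unavoidable (Suc t) (Suc t + j + M) r (HJ_fused t j (j + M)) n"
proof (induction j arbitrary: M)
  case 0
  show ?case
    by (intro exI[of _ M] unavoidableI exI[of _ "[Suc t..<Suc t + M]"])
      (simp add: HJ_fused_def param_word_upt del: upt_Suc)
next
  case (Suc j)
  let ?L = "j + Suc M"
  \<comment> \<open>\<open>Z\<close> needs one parameter more than \<open>M\<close>, namely the one that joins those already treated.\<close>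
  obtain N where N: "GR t (t + Suc M) t r N" using HJ by blast
  obtain n where n: "unavoidable (Suc t) (Suc t + j + N) r (HJ_fused t j (j + N)) n"
    using Suc by blast
  show ?case
  proof (intro exI[of _ n] unavoidableI)
    fix col :: "nat list \<Rightarrow> nat" assume col: "\<forall>w. col w < r"
    from unavoidableE[OF n col]
    obtain W where W: "length W = n" "param_word (Suc t) W (Suc t + j + N)" "HJ_fused t j (j + N) col W" .
    have "\<forall>v. col (word_subst (Suc t) (replicate j t @ v) W) < r" using col by simp
    from unavoidableE[OF N this] obtain Z where Z: "length Z = N" "param_word t Z (t + Suc M)"
      "homogeneous t (t + Suc M) t (\<lambda>v. col (word_subst (Suc t) (replicate j t @ v) W)) Z" .
    define \<rho> where "\<rho> x = (if x < t then x else x + 1 + j)" for x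
    have "param_word (Suc t + j) [Suc t + j..<Suc t + ?L] (Suc t + ?L)"
      by (rule param_word_upt) simp
    then have \<rho>Z: "param_word (Suc t + j) (map \<rho> Z) (Suc t + ?L)"
      by (rule param_word_map[OF Z(2)]) (auto simp: \<rho>_def simp del: upt_Suc)
    \<comment> \<open>The parameters of \<open>Z\<close> start at \<open>t\<close>; those of \<open>V\<close> start at \<open>Suc t\<close> and come after the \<open>j\<close> parameters kept.\<close>
    define V where "V = [Suc t..<Suc t + j] @ map \<rho> Z"
    have V: "param_word (Suc t) V (Suc t + ?L)"
      unfolding V_def param_word_append using \<rho>Z param_word_upt[of "Suc t" "Suc t + j"] by (meson le_add1)
    have lV: "length V = j + N" by (simp add: V_def Z(1) del: upt_Suc)
    let ?W = "word_subst (Suc t) V W"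
    have W': "param_word (Suc t) ?W (Suc t + ?L)"
      by (rule param_word_subst[OF W(2) V]) (use lV in simp)
    have assoc: "word_subst (Suc t) u ?W = word_subst (Suc t) (word_subst (Suc t) u V) W" for u
      using param_word_set[OF W(2)] lV by (intro word_subst_assoc) (simp add: add.assoc)
    define tail where "tail i u = take (j - i) u @ map (\<lambda>x. if x < t then x else u ! (x - t + (j - i))) Z" for i u
    have split: "word_subst (Suc t) (replicate i t @ u) V = replicate i t @ tail i u"
      if i: "i \<le> j" "length u = ?L - i" for i u
    proof -
      have "word_subst (Suc t) (replicate i t @ u) [Suc t..<Suc t + j] = replicate i t @ take (j - i) u"
        using i by (intro nth_equalityI) (auto simp: word_subst_def nth_append simp del: upt_Suc)
      moreover have "word_subst (Suc t) (replicate i t @ u) (map \<rho> Z) = map (\<lambda>x. if x < t then x else u ! (x - t + (j - i))) Z"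
        using i by (auto simp: word_subst_def \<rho>_def nth_append)
      ultimately show ?thesis by (simp add: V_def tail_def)
    qed
    have tail_set: "set (tail i v) \<subseteq> {..<t}" "length (tail i v) = j + N - i"
      if v: "i \<le> j" "length v = ?L - i" "set v \<subseteq> {..<t}" for i v
    proof -
      have "v ! (x - t + (j - i)) < t" if x: "x \<in> set Z" "\<not> x < t" for x
      proof -
        have "x < t + Suc M" using x param_word_set[OF Z(2)] by auto
        then have "x - t + (j - i) < length v" using x v(1,2) by linarith
        then show ?thesis using v(3) by (metis lessThan_iff nth_mem subsetD)
      qed
      then show "set (tail i v) \<subseteq> {..<t}" using v(3) by (auto simp: tail_def dest: in_set_takeD)
      show "length (tail i v) = j + N - i" using v Z(1) by (simp add: tail_def)
    qed
    have "HJ_fused t (Suc j) ?L col ?W"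
      unfolding HJ_fused_def
    proof (intro allI impI)
      fix i u u'
      assume i: "i < Suc j" "length u = ?L - i" "length u' = ?L - i" "set u \<subseteq> {..<t}" "set u' \<subseteq> {..<t}"
      have eq: "word_subst (Suc t) (replicate i t @ v) ?W = word_subst (Suc t) (replicate i t @ tail i v) W"
        if "length v = ?L - i" for v
        unfolding assoc using split[of i v] i(1) that by simp
      show "col (word_subst (Suc t) (replicate i t @ u) ?W) = col (word_subst (Suc t) (replicate i t @ u') ?W)"
      proof (cases "i = j")
        case True
        have "tail i v = word_subst t v Z" for v
          using True by (simp add: word_subst_def tail_def)
        then show ?thesis
          using homogeneousD[OF Z(3), of u u'] i True eq[OF i(2)] eq[OF i(3)] by (simp add: param_word_same)
      next
        case False
        then show ?thesis
          unfolding eq[OF i(2)] eq[OF i(3)] using i by (intro HJ_fusedD[OF W(3)] tail_set) auto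
      qed
    qed
    then show "\<exists>W. length W = n \<and> param_word (Suc t) W (Suc t + Suc j + M) \<and> HJ_fused t (Suc j) (Suc j + M) col W"
      using W' W(1) by (intro exI[of _ ?W]) (simp add: add.assoc)
  qed
qed

text \<open>Colour focusing. Among the words \<open>t\<^sup>i 0\<^sup>r\<^sup>-\<^sup>i\<close> with \<open>0 \<le> i \<le> r\<close> two have the same colour, say for \<open>i < j\<close>. On
the line \<open>t\<^sup>i x\<^sup>j\<^sup>-\<^sup>i 0\<^sup>r\<^sup>-\<^sup>j\<close> the values \<open>x < t\<close> all have the colour of the first word by fusion, and \<open>x = t\<close>
gives the second word.\<close>

lemma HJ_step:
  assumes t: "t > 0" and HJ: "\<And>m r. \<exists>n. GR t (t + m) t r n"
  shows "\<exists>n. GR (Suc t) (Suc t + 1) (Suc t) r n"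
proof -
  obtain n where n: "unavoidable (Suc t) (Suc t + r + 0) r (HJ_fused t r (r + 0)) n"
    using HJ_fusion[OF HJ, where j = r and M = 0 and r = r] by blast
  have "GR (Suc t) (Suc t + 1) (Suc t) r n"
  proof (rule unavoidableI)
    fix col :: "nat list \<Rightarrow> nat" assume col: "\<forall>w. col w < r"
    from unavoidableE[OF n col, unfolded add_0_right]
    obtain W where W: "length W = n" "param_word (Suc t) W (Suc t + r)" "HJ_fused t r r col W" .
    define val where "val i = col (word_subst (Suc t) (replicate i t @ replicate (r - i) 0) W)" for i
    have "card (val ` {..r}) \<le> r"
      using card_mono[of "{..<r}" "val ` {..r}"] col by (auto simp: val_def)
    then have "\<not> inj_on val {..r}" using card_image[of val "{..r}"] by auto
    then obtain i j where ij: "i < j" "j \<le> r" "val i = val j"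
      unfolding inj_on_def by (metis atMost_iff linorder_neqE_nat)
    define V where "V = replicate i t @ replicate (j - i) (Suc t) @ replicate (r - j) 0"
    have lV: "length V = r" using ij by (simp add: V_def)
    have pV: "param_word (Suc t) V (Suc t + 1)"
    proof -
      have "replicate (j - i) (Suc t) = Suc t # replicate (j - i - 1) (Suc t)"
        using ij by (metis Suc_diff_Suc diff_Suc_1 replicate_Suc zero_less_diff less_imp_Suc_add diff_Suc_eq_diff_pred)
      moreover have "param_word (Suc t) (replicate i t) (Suc t)" by (auto simp: param_word_same)
      moreover have "param_word (Suc (Suc t)) (replicate (j - i - 1) (Suc t) @ replicate (r - j) 0) (Suc (Suc t))"
        by (auto simp: param_word_same)
      ultimately show ?thesis unfolding V_def param_word_append
        by (intro exI[of _ "Suc t"]) (auto simp: param_word_append)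
    qed
    let ?W = "word_subst (Suc t) V W"
    have W': "param_word (Suc t) ?W (Suc t + 1)"
      by (rule param_word_subst[OF W(2) pV]) (use lV in simp)
    have assoc: "word_subst (Suc t) u ?W = word_subst (Suc t) (word_subst (Suc t) u V) W" for u
      using param_word_set[OF W(2)] lV by (intro word_subst_assoc) simp
    have "col (word_subst (Suc t) u ?W) = val i"
      if u: "length u = 1" "param_word (Suc t) u (Suc t)" for u
    proof -
      obtain a where a: "u = [a]" "a < Suc t" using u by (cases u) auto
      have V': "word_subst (Suc t) u V = replicate i t @ replicate (j - i) a @ replicate (r - j) 0"
        using a by (simp add: V_def word_subst_def)
      show ?thesis
      proof (cases "a = t")
        case True
        then have "word_subst (Suc t) u V = replicate j t @ replicate (r - j) 0"
          using ij V' by (metis append_assoc le_add_diff_inverse less_imp_le replicate_add)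
        then show ?thesis unfolding assoc using ij(3) by (simp add: val_def)
      next
        case False
        then show ?thesis unfolding assoc V' val_def using a ij t
          by (intro HJ_fusedD[OF W(3)]) auto
      qed
    qed
    then have "homogeneous (Suc t) (Suc t + 1) (Suc t) col ?W"
      unfolding homogeneous_def by simp
    then show "\<exists>W. length W = n \<and> param_word (Suc t) W (Suc t + 1) \<and> homogeneous (Suc t) (Suc t + 1) (Suc t) col W"
      using W' W(1) by (intro exI[of _ ?W]) simp
  qed
  then show ?thesis by blast
qed

theorem hales_jewett:
  assumes "t > 0"
  shows "\<exists>n. GR t (t + m) t r n"
  using assms
proof (induction t arbitrary: m r rule: nat_induct_non_zero)
  case 1
  have "GR 1 (1 + m) 1 r m"
  proof (intro unavoidableI exI[of _ "[1..<1+m]"] conjI)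
    have "u = u'" if "length u = m" "length u' = m" "set u \<subseteq> {..<1}" "set u' \<subseteq> {..<1}" for u u' :: "nat list"
      using that by (intro nth_equalityI) (auto simp: subset_iff, metis nth_mem)
    then show "homogeneous 1 (1 + m) 1 col [1..<1 + m]" for col :: "nat list \<Rightarrow> nat"
      unfolding homogeneous_def param_word_same by (metis add_diff_cancel_left')
  qed (simp_all add: param_word_upt del: upt_Suc)
  then show ?case by blast
next
  case (Suc t)
  show ?case by (rule HJ_multi[OF _ HJ_step[OF Suc]]) simp
qed

section \<open>The Graham--Rothschild theorem\<close>

lemma param_word_first_occurrence:
  assumes "param_word c V m" "c \<le> a" "a < m"
  obtains V1 V2 where "V = V1 @ a # V2" "param_word c V1 a" "param_word (Suc a) V2 m"
    "takeWhile (\<lambda>x. x < a) V = V1"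
proof -
  have "\<exists>V1 V2. V = V1 @ a # V2 \<and> param_word c V1 a \<and> param_word (Suc a) V2 m"
    using assms
  proof (induction V arbitrary: c)
    case (Cons x V)
    show ?case
    proof (cases "x = a \<and> a = c")
      case True
      then show ?thesis using Cons.prems by (intro exI[of _ "[]"] exI[of _ V]) auto
    next
      case False
      then consider "x < c" "param_word c V m" | "x = c" "param_word (Suc c) V m" "Suc c \<le> a"
        using Cons.prems by force
      then show ?thesis
      proof cases
        case 1
        then obtain V1 V2 where "V = V1 @ a # V2" "param_word c V1 a" "param_word (Suc a) V2 m"
          using Cons.IH Cons.prems(2,3) by blast
        then show ?thesis using 1 by (intro exI[of _ "x # V1"] exI[of _ V2]) auto
      next
        case 2
        then obtain V1 V2 where "V = V1 @ a # V2" "param_word (Suc c) V1 a" "param_word (Suc a) V2 m"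
          using Cons.IH Cons.prems(3) by blast
        then show ?thesis using 2 by (intro exI[of _ "x # V1"] exI[of _ V2]) auto
      qed
    qed
  qed auto
  then obtain V1 V2 where V: "V = V1 @ a # V2" "param_word c V1 a" "param_word (Suc a) V2 m" by blast
  have "takeWhile (\<lambda>x. x < a) V = V1"
    unfolding V(1) using param_word_set[OF V(2)] by (subst takeWhile_append2) auto
  then show ?thesis using V that by blast
qed

lemma takeWhile_word_subst:
  assumes V: "param_word c V m" and u: "length u = m - c" "i < length u" "param_word c (take i u) a" "u ! i = a"
  shows "takeWhile (\<lambda>x. x < a) (word_subst c u V) = word_subst c (take i u) (takeWhile (\<lambda>x. x < c + i) V)"
proof -
  obtain V1 V2 where *: "V = V1 @ (c + i) # V2" "param_word c V1 (c + i)"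
      "takeWhile (\<lambda>x. x < c + i) V = V1"
    using param_word_first_occurrence[OF V le_add1, of i] u(1,2) by (metis less_diff_conv add.commute)
  have V1: "word_subst c u V1 = word_subst c (take i u) V1"
    using word_subst_cong[of V1 c "take i u" "drop i u"] param_word_set[OF *(2)] u(2) by simp
  have "param_word c (word_subst c (take i u) V1) a"
    by (rule param_word_subst[OF *(2) u(3)]) (use u(2) in simp)
  then have "\<forall>x\<in>set (word_subst c (take i u) V1). x < a" using param_word_set by blast
  moreover have "word_subst c u V = word_subst c (take i u) V1 @ a # word_subst c u V2"
    using *(1) V1 u(4) by (simp add: word_subst_def)
  ultimately show ?thesis using *(3) by (simp add: takeWhile_append2)
qed

text \<open>Only the part of \<open>V\<close> before its parameter \<open>c + j\<close> counts. These prefixes, with letters in place of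
their \<open>j\<close> parameters, are what can precede the first occurrence of the first parameter in a word obtained from \<open>V\<close> by
substitution.\<close>

definition level_const :: "nat \<Rightarrow> nat \<Rightarrow> (nat list \<Rightarrow> 'c) \<Rightarrow> nat list \<Rightarrow> 'c \<Rightarrow> bool"
  where "level_const c j col V a \<longleftrightarrow> (\<forall>p. length p = j \<longrightarrow> set p \<subseteq> {..<c} \<longrightarrow>
    col (word_subst c p (takeWhile (\<lambda>x. x < c + j) V)) = a)"

lemma level_const_subst:
  assumes V: "param_word c V m"
    and u: "length u = m - c" "i < length u" "param_word c (take i u) (c + j)" "u ! i = c + j"
    and lev: "level_const c i col V a"
  shows "level_const c j col (word_subst c u V) a"
  unfolding level_const_def
proof (intro allI impI)
  fix p assume p: "length p = j" "set p \<subseteq> {..<c}"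
  let ?V = "takeWhile (\<lambda>x. x < c + i) V"
  have "set ?V \<subseteq> {..<c + length (take i u)}" using u(2) by (auto dest: set_takeWhileD)
  then have "word_subst c p (word_subst c (take i u) ?V) = word_subst c (word_subst c p (take i u)) ?V"
    by (rule word_subst_assoc)
  moreover have "set (word_subst c p (take i u)) \<subseteq> {..<c}"
    by (rule word_subst_in_letters) (use p param_word_set[OF u(3)] in auto)
  ultimately show "col (word_subst c p (takeWhile (\<lambda>x. x < c + j) (word_subst c u V))) = a"
    using lev u(2) unfolding level_const_def takeWhile_word_subst[OF V u] by simp
qed

text \<open>Levels are treated from the last one down. The Hales--Jewett theorem makes the colour constant on a
level; it replaces the parameters before that level and so does not spoil the levels above.\<close>

lemma levels_const:
  assumes "c > 0"
  shows "\<exists>n. unavoidable c (c + M + J) r (\<lambda>col V. \<exists>g. \<forall>j\<in>{M..<M + J}. level_const c j col V (g j)) n"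
proof (induction J arbitrary: M)
  case 0
  show ?case
    by (intro exI[of _ M] unavoidableI exI[of _ "[c..<c + M]"]) (simp add: param_word_upt)
next
  case (Suc J)
  obtain N where N: "GR c (c + M) c r N" using hales_jewett[OF assms] by blast
  obtain n where n: "unavoidable c (c + Suc N + J) r
      (\<lambda>col V. \<exists>g. \<forall>j\<in>{Suc N..<Suc N + J}. level_const c j col V (g j)) n"
    using Suc by blast
  show ?case
  proof (intro exI[of _ n] unavoidableI)
    fix col :: "nat list \<Rightarrow> nat" assume col: "\<forall>w. col w < r"
    obtain V g where V: "length V = n" "param_word c V (c + Suc N + J)"
      "\<And>j. j \<in> {Suc N..<Suc N + J} \<Longrightarrow> level_const c j col V (g j)"
      by (rule unavoidableE[OF n col]) blast
    let ?VN = "takeWhile (\<lambda>x. x < c + N) V"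
    have "\<forall>p. col (word_subst c p ?VN) < r" using col by simp
    from unavoidableE[OF N this] obtain U where U: "length U = N" "param_word c U (c + M)"
      "homogeneous c (c + M) c (\<lambda>p. col (word_subst c p ?VN)) U" .
    define u where "u = U @ [c + M..<c + M + Suc J]"
    have lu: "length u = c + Suc N + J - c" using U(1) by (simp add: u_def del: upt_Suc)
    have take: "param_word c (take (N + i) u) (c + (M + i))" "u ! (N + i) = c + (M + i)" if "i \<le> J" for i
    proof -
      have "take (N + i) u = U @ [c + M..<c + M + i]" using that U(1) by (simp add: u_def del: upt_Suc)
      then show "param_word c (take (N + i) u) (c + (M + i))"
        using U(2) param_word_upt[of "c + M" "c + M + i"] by (auto simp: param_word_append add.assoc)
      show "u ! (N + i) = c + (M + i)"
        using U(1) that by (simp add: u_def nth_append del: upt_Suc)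
    qed
    let ?V = "word_subst c u V"
    have pu: "param_word c u (c + M + Suc J)"
      using U(2) param_word_upt[of "c + M" "c + M + Suc J"] unfolding u_def param_word_append by (meson le_add1)
    have V': "param_word c ?V (c + M + Suc J)" by (rule param_word_subst[OF V(2) pu lu])
    define a where "a = col (word_subst c (word_subst c (replicate M 0) U) ?VN)"
    have lev0: "level_const c M col ?V a"
      unfolding level_const_def
    proof (intro allI impI)
      fix p assume p: "length p = M" "set p \<subseteq> {..<c}"
      have "takeWhile (\<lambda>x. x < c + M) ?V = word_subst c U ?VN"
        using takeWhile_word_subst[OF V(2) lu, of N "c + M"] take[of 0] lu U(1) by (simp add: u_def del: upt_Suc)
      moreover have "set ?VN \<subseteq> {..<c + length U}" using U(1) by (auto dest: set_takeWhileD)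
      ultimately have "word_subst c p (takeWhile (\<lambda>x. x < c + M) ?V) = word_subst c (word_subst c p U) ?VN"
        using word_subst_assoc by simp
      then show "col (word_subst c p (takeWhile (\<lambda>x. x < c + M) ?V)) = a"
        using homogeneousD[OF U(3), of p "replicate M 0"] p assms
        by (simp add: a_def param_word_same set_replicate_conv_if)
    qed
    have lev: "level_const c (M + Suc i) col ?V (g (N + Suc i))" if "i < J" for i
      using that lu take[of "Suc i"] by (intro level_const_subst[OF V(2) lu _ _ _ V(3)]) auto
    have "level_const c j col ?V (if j = M then a else g (N + (j - M)))" if "j \<in> {M..<M + Suc J}" for j
    proof (cases "j = M")
      case False
      then have "j = M + Suc (j - M - 1)" "j - M - 1 < J" using \<open>j \<in> _\<close> by auto
      then show ?thesis using lev[of "j - M - 1"] False by (metis add_diff_cancel_left')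
    qed (use lev0 in simp)
    then have "\<exists>g. \<forall>j\<in>{M..<M + Suc J}. level_const c j col ?V (g j)"
      by (intro exI[of _ "\<lambda>j. if j = M then a else g (N + (j - M))"] ballI)
    then show "\<exists>V. length V = n \<and> param_word c V (c + M + Suc J) \<and>
        (\<exists>g. \<forall>j\<in>{M..<M + Suc J}. level_const c j col V (g j))"
      using V' V(1) by (intro exI[of _ ?V] conjI) simp_all
  qed
qed

text \<open>Substituting \<open>u\<close> keeps the parameters with index in \<open>I\<close> and puts the letter \<open>0\<close> for the others.\<close>

lemma select_word:
  assumes "c > 0"
  shows "\<exists>u. length u = J \<and> param_word c u (c + card (I \<inter> {..<J})) \<and>
    (\<forall>i < card (I \<inter> {..<J}). \<exists>j\<in>I. j < J \<and> u ! j = c + i \<and> param_word c (take j u) (c + i))"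
proof (induction J)
  case (Suc J)
  let ?k = "card (I \<inter> {..<J})"
  obtain u where u: "length u = J" "param_word c u (c + ?k)"
    "\<And>i. i < ?k \<Longrightarrow> \<exists>j\<in>I. j < J \<and> u ! j = c + i \<and> param_word c (take j u) (c + i)"
    using Suc by blast
  have old: "\<exists>j\<in>I. j < Suc J \<and> (u @ [x]) ! j = c + i \<and> param_word c (take j (u @ [x])) (c + i)" if "i < ?k" for i x
  proof -
    obtain j where "j \<in> I" "j < J" "u ! j = c + i" "param_word c (take j u) (c + i)"
      using u(3)[OF \<open>i < ?k\<close>] by blast
    then show ?thesis using u(1) by (intro bexI[of _ j]) (auto simp: nth_append)
  qed
  show ?case
  proof (cases "J \<in> I")
    case True
    then have k: "card (I \<inter> {..<Suc J}) = Suc ?k" by (simp add: lessThan_Suc)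
    have "param_word c (u @ [c + ?k]) (c + Suc ?k)" using u(2) by (auto simp: param_word_append)
    moreover have "\<exists>j\<in>I. j < Suc J \<and> (u @ [c + ?k]) ! j = c + i \<and> param_word c (take j (u @ [c + ?k])) (c + i)" if "i < Suc ?k" for i
    proof (cases "i = ?k")
      case True
      then show ?thesis using \<open>J \<in> I\<close> u(1,2) by (intro bexI[of _ J]) auto
    qed (use that old in simp)
    ultimately show ?thesis unfolding k using u(1) by (intro exI[of _ "u @ [c + ?k]"]) simp
  next
    case False
    then have k: "I \<inter> {..<Suc J} = I \<inter> {..<J}" by (auto simp: less_Suc_eq)
    have "param_word c (u @ [0]) (c + ?k)" using u(2) assms by (auto simp: param_word_append)
    then show ?thesis unfolding k using old u(1) by (intro exI[of _ "u @ [0]"]) simp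
  qed
qed simp

text \<open>By the pigeonhole principle \<open>m\<close> among \<open>r m\<close> levels have the same colour; the other parameters are
filled with a letter.\<close>

lemma levels_const_equal:
  assumes c: "c > 0" and r: "r > 0"
  shows "\<exists>n. unavoidable c (c + m) r (\<lambda>col V. \<exists>a. \<forall>j<m. level_const c j col V a) n"
proof -
  obtain n where n: "unavoidable c (c + 0 + r * m) r
      (\<lambda>col V. \<exists>g. \<forall>j\<in>{0..<0 + r * m}. level_const c j col V (g j)) n"
    using levels_const[OF c, where r = r and M = 0 and J = "r * m"] by blast
  show ?thesis
  proof (intro exI[of _ n] unavoidableI)
    fix col :: "nat list \<Rightarrow> nat" assume col: "\<forall>w. col w < r"
    from unavoidableE[OF n col, unfolded add_0 add_0_right atLeast0LessThan]
    obtain V where V0: "length V = n" "param_word c V (c + r * m)"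
      "\<exists>g. \<forall>j\<in>{..<r * m}. level_const c j col V (g j)" .
    then obtain g where V: "length V = n" "param_word c V (c + r * m)"
      "\<And>j. j < r * m \<Longrightarrow> level_const c j col V (g j)" by auto
    have g: "g j < r" if "j < r * m" for j
    proof -
      have "g j = col (word_subst c (replicate j 0) (takeWhile (\<lambda>x. x < c + j) V))"
        using V(3)[OF that] c unfolding level_const_def by (simp add: set_replicate_conv_if)
      then show ?thesis using col by simp
    qed
    have "\<exists>a. m \<le> card {j. j < r * m \<and> g j = a}"
    proof (rule ccontr)
      assume "\<nexists>a. m \<le> card {j. j < r * m \<and> g j = a}"
      then have lt: "card {j. j < r * m \<and> g j = a} < m" for a by (simp add: not_le)
      have "{..<r * m} = (\<Union>a<r. {j. j < r * m \<and> g j = a})" using g by auto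
      then have "r * m \<le> (\<Sum>a<r. card {j. j < r * m \<and> g j = a})"
        using card_UN_le[of "{..<r}" "\<lambda>a. {j. j < r * m \<and> g j = a}"] by (metis card_lessThan finite_lessThan)
      also have "\<dots> < (\<Sum>a<r. m)"
        by (rule sum_strict_mono) (use r lt in auto)
      finally show False by simp
    qed
    then obtain a I where I: "I \<subseteq> {j. j < r * m \<and> g j = a}" "card I = m"
      by (meson obtain_subset_with_card_n)
    then have "I \<inter> {..<r * m} = I" by auto
    then obtain u where u: "length u = r * m" "param_word c u (c + m)"
      "\<And>i. i < m \<Longrightarrow> \<exists>j\<in>I. j < r * m \<and> u ! j = c + i \<and> param_word c (take j u) (c + i)"
      using select_word[OF c, of "r * m" I] I(2) by metis
    let ?V = "word_subst c u V"
    have "param_word c ?V (c + m)" by (rule param_word_subst[OF V(2) u(2)]) (use u in simp)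
    moreover have "level_const c i col ?V a" if i: "i < m" for i
    proof -
      obtain j where j: "j \<in> I" "j < r * m" "u ! j = c + i" "param_word c (take j u) (c + i)"
        using u(3)[OF i] by blast
      then have "g j = a" using I(1) by blast
      then show ?thesis using level_const_subst[OF V(2) _ _ j(4,3) V(3)] u(1) j(2) by auto
    qed
    ultimately show "\<exists>V. length V = n \<and> param_word c V (c + m) \<and> (\<exists>a. \<forall>j<m. level_const c j col V a)"
      using V(1) by (intro exI[of _ ?V] conjI exI[of _ a]) simp_all
  qed
qed

text \<open>A word in which some parameter occurs is \<open>p @ c # z\<close>, where \<open>p\<close> contains letters only and \<open>z\<close> is a
parameter word over the alphabet enlarged by \<open>c\<close>. The colour is to depend on \<open>p\<close> alone.\<close>

definition prefix_const :: "nat \<Rightarrow> nat \<Rightarrow> nat \<Rightarrow> nat \<Rightarrow> (nat list \<Rightarrow> 'c) \<Rightarrow> nat list \<Rightarrow> bool"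
  where "prefix_const c k j L col W \<longleftrightarrow> (\<forall>p z z'. length p < j \<longrightarrow> set p \<subseteq> {..<c} \<longrightarrow>
      length p + Suc (length z) = L \<longrightarrow> length p + Suc (length z') = L \<longrightarrow>
      param_word (Suc c) z k \<longrightarrow> param_word (Suc c) z' k \<longrightarrow>
      col (word_subst c (p @ c # z) W) = col (word_subst c (p @ c # z') W))"

lemma prefix_constD:
  assumes "prefix_const c k j L col W" "length p < j" "set p \<subseteq> {..<c}"
    "length p + Suc (length z) = L" "length p + Suc (length z') = L"
    "param_word (Suc c) z k" "param_word (Suc c) z' k"
  shows "col (word_subst c (p @ c # z) W) = col (word_subst c (p @ c # z') W)"
  using assms unfolding prefix_const_def by blast

text \<open>As in \<open>HJ_fusion\<close>, with induction hypothesis the theorem for the larger alphabet, applied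
simultaneously to all prefixes \<open>p\<close> of length \<open>j\<close>.\<close>

lemma GR_fusion:
  assumes GR: "\<And>m r. m > c \<Longrightarrow> \<exists>n. GR (Suc c) m k r n"
  shows "\<exists>n. unavoidable c (c + j + M) r (prefix_const c k j (j + M)) n"
proof (induction j arbitrary: M)
  case 0
  show ?case
    by (intro exI[of _ M] unavoidableI exI[of _ "[c..<c + M]"]) (simp add: prefix_const_def param_word_upt)
next
  case (Suc j)
  let ?L = "j + Suc M"
  define P where "P = {p. length p = j \<and> set p \<subseteq> {..<c}}"
  have finP: "finite P" unfolding P_def using finite_lists_length_eq[of "{..<c}" j] by (simp add: conj_commute)
  obtain N where N: "GR (Suc c) (Suc c + M) k (r ^ card P) N" using GR[of "Suc c + M"] by auto
  obtain n where n: "unavoidable c (c + j + Suc N) r (prefix_const c k j (j + Suc N)) n"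
    using Suc by blast
  show ?case
  proof (intro exI[of _ n] unavoidableI)
    fix col :: "nat list \<Rightarrow> nat" assume col: "\<forall>w. col w < r"
    from unavoidableE[OF n col]
    obtain W where W: "length W = n" "param_word c W (c + j + Suc N)" "prefix_const c k j (j + Suc N) col W" .
    obtain Z where Z: "length Z = N" "param_word (Suc c) Z (Suc c + M)"
      "\<And>p. p \<in> P \<Longrightarrow> homogeneous (Suc c) (Suc c + M) k (\<lambda>z. col (word_subst c (p @ c # z) W)) Z"
      using GR_simultaneous[OF N finP, of "\<lambda>p z. col (word_subst c (p @ c # z) W)"] col by blast
    define \<rho> where "\<rho> x = (if x < c then x else x + j)" for x
    have "param_word (Suc (c + j)) [Suc (c + j)..<c + ?L] (c + ?L)"
      by (rule param_word_upt) simp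
    then have \<rho>Z: "param_word (Suc (c + j)) (map \<rho> Z) (c + ?L)"
      by (rule param_word_map[OF Z(2)]) (auto simp: \<rho>_def simp del: upt_Suc)
    \<comment> \<open>In \<open>V\<close> the letter \<open>c\<close> of \<open>Z\<close> is turned back into the parameter \<open>c + j\<close>, which stands for the first
      parameter of \<open>p @ c # z\<close> when \<open>p\<close> has length \<open>j\<close>.\<close>
    define V where "V = [c..<c + j] @ (c + j) # map \<rho> Z"
    have V: "param_word c V (c + ?L)"
      unfolding V_def param_word_append using \<rho>Z param_word_upt[of c "c + j"]
      by (intro exI[of _ "c + j"]) simp
    have lV: "length V = j + Suc N" by (simp add: V_def Z(1))
    let ?W = "word_subst c V W"
    have W': "param_word c ?W (c + ?L)"
      by (rule param_word_subst[OF W(2) V]) (use lV in simp)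
    have assoc: "word_subst c u ?W = word_subst c (word_subst c u V) W" for u
      using param_word_set[OF W(2)] lV by (intro word_subst_assoc) (simp add: add.assoc)
    have last: "word_subst c (p @ c # z) V = p @ c # word_subst (Suc c) z Z"
      if p: "length p = j" for p z
    proof -
      have "word_subst c (p @ c # z) [c..<c + j] = p"
        using p by (intro nth_equalityI) (auto simp: word_subst_def nth_append)
      moreover have "word_subst c (p @ c # z) (map \<rho> Z) = word_subst (Suc c) z Z"
        using p by (auto simp: word_subst_def \<rho>_def nth_append nth_Cons' not_less less_Suc_eq)
      ultimately show ?thesis using p by (simp add: V_def) (simp add: word_subst_def nth_append)
    qed
    have early: "\<exists>y. word_subst c (p @ c # z) V = p @ c # y \<and> param_word (Suc c) y k \<and> length p + Suc (length y) = j + Suc N"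
      if p: "length p < j" "set p \<subseteq> {..<c}" "length p + Suc (length z) = ?L" "param_word (Suc c) z k" for p z
    proof -
      let ?i = "length p"
      have "[c..<c + j] = [c..<c + ?i] @ (c + ?i) # [Suc (c + ?i)..<c + j]"
        using p(1) upt_add_eq_append[of c "c + ?i" "j - ?i"] by (simp add: upt_conv_Cons)
      moreover have "word_subst c (p @ c # z) [c..<c + ?i] = p"
        by (intro nth_equalityI) (auto simp: word_subst_def nth_append)
      ultimately obtain y where y: "word_subst c (p @ c # z) V = p @ c # y"
        unfolding V_def by (auto simp: word_subst_def nth_append)
      have pw: "param_word c (p @ c # z) k"
        using p(2,4) unfolding param_word_append
        by (intro exI[of _ c]) (simp add: param_word_same)
      have "param_word c (p @ c # y) k"
        unfolding y[symmetric] by (rule param_word_subst[OF V pw]) (use p(3) in simp)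
      then obtain j' where j': "param_word c p j'" "param_word j' (c # y) k"
        by (auto simp: param_word_append)
      have "j' = c"
      proof (rule ccontr)
        assume "j' \<noteq> c"
        then have "c \<in> {c..<j'}" using param_word_le[OF j'(1)] by simp
        then show False using param_word_onto[OF j'(1)] p(2) by auto
      qed
      then have "param_word (Suc c) y k" using j'(2) by simp
      moreover have "length p + Suc (length y) = j + Suc N"
        using arg_cong[OF y, of length] lV by simp
      ultimately show ?thesis using y by blast
    qed
    have "prefix_const c k (Suc j) ?L col ?W"
      unfolding prefix_const_def
    proof (intro allI impI)
      fix p z z'
      assume p: "length p < Suc j" "set p \<subseteq> {..<c}" and z: "length p + Suc (length z) = ?L" "param_word (Suc c) z k"
        and z': "length p + Suc (length z') = ?L" "param_word (Suc c) z' k"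
      show "col (word_subst c (p @ c # z) ?W) = col (word_subst c (p @ c # z') ?W)"
      proof (cases "length p = j")
        case True
        then have "p \<in> P" using p by (simp add: P_def)
        then show ?thesis
          unfolding assoc last[OF True] using homogeneousD[OF Z(3), of p z z'] z z' True by simp
      next
        case False
        then have "length p < j" using p by simp
        with early[OF this p(2) z] early[OF this p(2) z'] show ?thesis
          unfolding assoc using prefix_constD[OF W(3) _ p(2)] by metis
      qed
    qed
    then show "\<exists>W. length W = n \<and> param_word c W (c + Suc j + M) \<and> prefix_const c k (Suc j) (Suc j + M) col W"
      using W' W(1) by (intro exI[of _ ?W]) (simp add: add.assoc)
  qed
qed

text \<open>After fusion the colour of \<open>p @ c # z\<close> is a colour of the prefix \<open>p\<close>, and \<open>levels_const_equal\<close> makes this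
colour constant.\<close>

lemma GR_step:
  assumes c: "c > 0" and k: "c < k" and m: "c \<le> m"
    and GR: "\<And>m r. m > c \<Longrightarrow> \<exists>n. GR (Suc c) m k r n"
  shows "\<exists>n. GR c m k r n"
proof (cases "r = 0")
  case True
  then have "GR c m k r 0" by (simp add: unavoidable_def)
  then show ?thesis by blast
next
  case False
  obtain M where M: "unavoidable c (c + (m - c)) r (\<lambda>col V. \<exists>a. \<forall>j<m - c. level_const c j col V a) M"
    using levels_const_equal[OF c, of r "m - c"] False by blast
  obtain n where n: "unavoidable c (c + M + 0) r (prefix_const c k M (M + 0)) n"
    using GR_fusion[OF GR, where j = M and M = 0 and r = r] by blast
  have "GR c m k r n"
  proof (rule unavoidableI)
    fix col :: "nat list \<Rightarrow> nat" assume col: "\<forall>w. col w < r"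
    from unavoidableE[OF n col, unfolded add_0_right]
    obtain W where W: "length W = n" "param_word c W (c + M)" "prefix_const c k M M col W" .
    define tail where "tail p z \<longleftrightarrow> length p + Suc (length z) = M \<and> param_word (Suc c) z k" for p z :: "nat list"
    define col' where "col' p = col (word_subst c (p @ c # (SOME z. tail p z)) W)" for p
    have indep: "col (word_subst c (p @ c # z) W) = col (word_subst c (p @ c # z') W)"
      if "tail p z" "tail p z'" "set p \<subseteq> {..<c}" for p z z'
      using that by (intro prefix_constD[OF W(3)]) (auto simp: tail_def)
    have col': "col (word_subst c (p @ c # z) W) = col' p" if "tail p z" "set p \<subseteq> {..<c}" for p z
      unfolding col'_def using indep[OF that(1) someI[of "tail p", OF that(1)] that(2)] .
    obtain V a where V: "length V = M" "param_word c V m" "\<And>j. j < m - c \<Longrightarrow> level_const c j col' V a"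
    proof (rule unavoidableE[OF M])
      show "\<forall>w. col' w < r" using col by (simp add: col'_def)
    qed (use m that in auto)
    let ?W = "word_subst c V W"
    have W': "param_word c ?W m" by (rule param_word_subst[OF W(2) V(2)]) (use V(1) in simp)
    have "col (word_subst c u ?W) = a" if u: "length u = m - c" "param_word c u k" for u
    proof -
      obtain p z where pz: "u = p @ c # z" "param_word c p c" "param_word (Suc c) z k"
        using param_word_first_occurrence[OF u(2) order_refl k] by metis
      have lp: "length p < length u" by (simp add: pz(1))
      have sp: "set p \<subseteq> {..<c}" using pz(2) param_word_same by blast
      let ?i = "length p"
      obtain V1 V2 where V12: "V = V1 @ (c + ?i) # V2" "param_word c V1 (c + ?i)" "param_word (Suc (c + ?i)) V2 m"
        "takeWhile (\<lambda>x. x < c + ?i) V = V1"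
        using param_word_first_occurrence[OF V(2) le_add1, of ?i] lp u(1) by (metis less_diff_conv add.commute)
      have V1: "word_subst c u V1 = word_subst c p V1"
        unfolding pz(1) using param_word_set[OF V12(2)] by (rule word_subst_cong)
      have set: "set (word_subst c p V1) \<subseteq> {..<c}"
        by (rule word_subst_in_letters) (use sp param_word_set[OF V12(2)] in auto)
      have uV: "word_subst c u V = word_subst c p V1 @ c # word_subst c u V2"
        unfolding V12(1) word_subst_append V1 by (simp add: word_subst_def pz(1))
      have "param_word (Suc c) (word_subst c u V2) k"
        unfolding word_subst_def
        by (rule param_word_map[OF V12(3) pz(3)])
          (use pz(1) u sp in \<open>auto simp: nth_append nth_Cons' less_Suc_eq dest: nth_mem\<close>)
      then have "tail (word_subst c p V1) (word_subst c u V2)"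
        using arg_cong[OF V12(1), of length] V(1) by (simp add: tail_def)
      then have "col (word_subst c (word_subst c u V) W) = col' (word_subst c p V1)"
        unfolding uV by (rule col'[OF _ set])
      also have "\<dots> = a"
        using V(3)[of ?i] lp u(1) sp V12(4) by (simp add: level_const_def)
      finally show ?thesis
        using word_subst_assoc[of W c V u] param_word_set[OF W(2)] V(1) by simp
    qed
    then have "homogeneous c m k col ?W" unfolding homogeneous_def by simp
    then show "\<exists>W. length W = n \<and> param_word c W m \<and> homogeneous c m k col W"
      using W' W(1) by (intro exI[of _ ?W]) simp
  qed
  then show ?thesis by blast
qed

text \<open>Downward induction on the size of the alphabet, starting from \<open>c = k\<close>.\<close>

theorem graham_rothschild:
  assumes "c > 0" "c \<le> m"
  shows "\<exists>n. GR c m k r n"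
proof (cases "c \<le> k")
  case True
  then show ?thesis using assms
  proof (induction arbitrary: m r rule: inc_induct)
    case base
    then show ?case using hales_jewett[of k "m - k" r] by simp
  next
    case (step c)
    show ?case by (rule GR_step) (use step in auto)
  qed
next
  case False
  then have "homogeneous c m k col W" for col :: "nat list \<Rightarrow> nat" and W
    unfolding homogeneous_def using param_word_le by blast
  then have "GR c m k r (m - c)"
    using param_word_upt[OF assms(2)] by (intro unavoidableI exI[of _ "[c..<m]"]) simp
  then show ?thesis by blast
qed

text \<open>Over the empty alphabet every word starts with \<open>0\<close>; dropping this letter leaves a parameter word over
the alphabet \<open>{0}\<close>.\<close>

theorem dual_ramsey:
  assumes "0 < m"
  shows "\<exists>n>0. GR 0 m k r n"
proof -
  obtain n where n: "GR 1 m k r n" using graham_rothschild[where c = 1 and m = m and k = k and r = r] assms by force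
  have "GR 0 m k r (Suc n)"
  proof (rule unavoidableI)
    fix col :: "nat list \<Rightarrow> nat" assume col: "\<forall>w. col w < r"
    have "\<forall>w. col (0 # w) < r" using col by simp
    from unavoidableE[OF n this]
    obtain W where W: "length W = n" "param_word 1 W m" "homogeneous 1 m k (\<lambda>w. col (0 # w)) W" .
    have eq: "\<exists>u'. u = 0 # u' \<and> length u' = m - 1 \<and> param_word 1 u' k \<and> word_subst 0 u (0 # W) = 0 # word_subst 1 u' W"
      if u: "length u = m - 0" "param_word 0 u k" for u
    proof -
      obtain u' where u': "u = 0 # u'" "param_word 1 u' k" using u assms by (cases u) auto
      moreover have "word_subst 0 u (0 # W) = 0 # word_subst 1 u' W"
        by (simp add: word_subst_def u' nth_Cons')
      ultimately show ?thesis using u(1) by auto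
    qed
    have "homogeneous 0 m k col (0 # W)"
      unfolding homogeneous_def
    proof (intro allI impI)
      fix u u' assume "length u = m - 0" "length u' = m - 0" "param_word 0 u k" "param_word 0 u' k"
      with eq[of u] eq[of u'] show "col (word_subst 0 u (0 # W)) = col (word_subst 0 u' (0 # W))"
        using homogeneousD[OF W(3)] by metis
    qed
    then show "\<exists>W. length W = Suc n \<and> param_word 0 W m \<and> homogeneous 0 m k col W"
      using W(1,2) by (intro exI[of _ "0 # W"]) simp
  qed
  then show ?thesis by blast
qed

section \<open>Words with two blocks\<close>

text \<open>These words encode embeddings between finite algebras that respect the ideal: \<open>n1\<close> of \<open>n\<close> atoms, and \<open>k1\<close>
of \<open>k\<close> atoms, lie outside the ideal and come first.\<close>

definition typed_word :: "nat \<Rightarrow> nat \<Rightarrow> nat \<Rightarrow> nat \<Rightarrow> nat list \<Rightarrow> bool"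
  where "typed_word n1 n k1 k w \<longleftrightarrow> length w = n \<and> param_word 0 (take n1 w) k1 \<and> param_word k1 (drop n1 w) k"

lemma typed_word_append:
  "length w1 = n1 \<Longrightarrow> typed_word n1 n k1 k (w1 @ w2) \<longleftrightarrow>
    n = n1 + length w2 \<and> param_word 0 w1 k1 \<and> param_word k1 w2 k"
  by (auto simp: typed_word_def)

lemma typed_word_split:
  assumes "typed_word n1 n k1 k w" "n1 \<le> n"
  obtains w1 w2 where "w = w1 @ w2" "length w1 = n1" "length w2 = n - n1" "param_word 0 w1 k1" "param_word k1 w2 k"
  using assms that[of "take n1 w" "drop n1 w"] by (auto simp: typed_word_def min_def)

lemma typed_word_compose:
  assumes W: "typed_word N1 N n1 n W" and u: "typed_word n1 n k1 k u" and le: "n1 \<le> n" "N1 \<le> N"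
  shows "typed_word N1 N k1 k (map ((!) u) W)"
proof -
  obtain W1 W2 where W: "W = W1 @ W2" "length W1 = N1" "length W2 = N - N1" "param_word 0 W1 n1" "param_word n1 W2 n"
    using typed_word_split[OF W le(2)] .
  obtain u1 u2 where u: "u = u1 @ u2" "length u1 = n1" "length u2 = n - n1" "param_word 0 u1 k1" "param_word k1 u2 k"
    using typed_word_split[OF u le(1)] .
  have "param_word 0 (map ((!) u) W1) k1"
    by (rule param_word_map[OF W(4) u(4)]) (use u in \<open>auto simp: nth_append\<close>)
  moreover have "param_word k1 (map ((!) u) W2) k"
    by (rule param_word_map[OF W(5) u(5)])
      (use u param_word_set[OF u(4)] in \<open>auto simp: nth_append subset_iff\<close>)
  ultimately show ?thesis using W le by (simp add: typed_word_append)
qed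

lemma typed_word_set:
  assumes W: "typed_word N1 N n1 n W" and le: "n1 \<le> n" "N1 \<le> N"
  shows "set W \<subseteq> {..<n}"
proof -
  obtain W1 W2 where W: "W = W1 @ W2" "length W1 = N1" "length W2 = N - N1" "param_word 0 W1 n1" "param_word n1 W2 n"
    using typed_word_split[OF W le(2)] .
  show ?thesis using param_word_set[OF W(4)] param_word_set[OF W(5)] le(1) W(1) by auto
qed

text \<open>The length \<open>N1\<close> of the first block is fixed by the dual Ramsey theorem. The second block is
then handled over the alphabet \<open>{..<N1}\<close> of positions in the first block: for every first block \<open>w\<close> the
Graham--Rothschild theorem removes the dependence on the second block, since every second
block over the letters of \<open>w\<close> comes from one over positions. What is left is a colouring of the first
blocks.\<close>

theorem typed_ramsey:
  fixes n1 n k1 k r :: nat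
  assumes n: "0 < n1" "n1 \<le> n" and k: "0 < k1"
  shows "\<exists>N1 N. 0 < N1 \<and> N1 \<le> N \<and> (\<forall>col :: nat list \<Rightarrow> nat. (\<forall>w. col w < r) \<longrightarrow>
    (\<exists>W. typed_word N1 N n1 n W \<and> (\<forall>u u'. typed_word n1 n k1 k u \<longrightarrow> typed_word n1 n k1 k u' \<longrightarrow>
      col (map ((!) u) W) = col (map ((!) u') W))))"
proof -
  obtain N1 where N1: "0 < N1" "GR 0 n1 k1 r N1" using dual_ramsey[OF n(1)] by blast
  define P where "P = {w. length w = N1 \<and> param_word 0 w k1}"
  have finP: "finite P" unfolding P_def by (rule finite_param_words)
  obtain N2 where N2: "GR N1 (N1 + (n - n1)) (N1 + (k - k1)) (r ^ card P) N2"
    using graham_rothschild[of N1 "N1 + (n - n1)"] N1 by auto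
  have main: "\<exists>W. typed_word N1 (N1 + N2) n1 n W \<and> (\<forall>u u'. typed_word n1 n k1 k u \<longrightarrow> typed_word n1 n k1 k u' \<longrightarrow>
      col (map ((!) u) W) = col (map ((!) u') W))" if col: "\<forall>w. col w < r" for col :: "nat list \<Rightarrow> nat"
  proof -
    define ext where "ext w v = w @ map ((!) (w @ [k1..<k])) v" for w v :: "nat list"
    obtain U where U: "length U = N2" "param_word N1 U (N1 + (n - n1))"
      "\<And>w. w \<in> P \<Longrightarrow> homogeneous N1 (N1 + (n - n1)) (N1 + (k - k1)) (\<lambda>v. col (ext w v)) U"
      using GR_simultaneous[OF N2 finP, of "\<lambda>w v. col (ext w v)"] col by blast
    define good where "good v \<longleftrightarrow> length v = n - n1 \<and> param_word N1 v (N1 + (k - k1))" for v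
    define col' where "col' w = col (ext w (word_subst N1 (SOME v. good v) U))" for w
    have indep: "col (ext w (word_subst N1 v U)) = col (ext w (word_subst N1 v' U))"
      if "w \<in> P" "good v" "good v'" for w v v'
      using homogeneousD[OF U(3)[OF that(1)], of v v'] that(2,3) unfolding good_def by simp
    have col': "col (ext w (word_subst N1 v U)) = col' w" if "w \<in> P" "good v" for w v
      unfolding col'_def using indep[OF that someI[of good, OF that(2)]] .
    have "\<forall>w. col' w < r" using col by (simp add: col'_def)
    from unavoidableE[OF N1(2) this] obtain W1 where W1: "length W1 = N1" "param_word 0 W1 n1" "homogeneous 0 n1 k1 col' W1" .
    define W2 where "W2 = map ((!) (W1 @ [n1..<n])) U"
    have W2: "param_word n1 W2 n" unfolding W2_def
      by (rule param_word_map[OF U(2) param_word_upt[OF n(2)]])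
        (use W1(1) param_word_set[OF W1(2)] in \<open>auto simp: nth_append subset_iff\<close>)
    have lW2: "length W2 = N2" by (simp add: W2_def U(1))
    have color: "col (map ((!) u) (W1 @ W2)) = col' (word_subst 0 (take n1 u) W1)" "length (take n1 u) = n1" "param_word 0 (take n1 u) k1"
      if u: "typed_word n1 n k1 k u" for u
    proof -
      obtain u1 u2 where u: "u = u1 @ u2" "length u1 = n1" "length u2 = n - n1" "param_word 0 u1 k1" "param_word k1 u2 k"
        using typed_word_split[OF u n(2)] .
      then show "length (take n1 u) = n1" "param_word 0 (take n1 u) k1" by auto
      let ?w = "word_subst 0 u1 W1"
      have lw: "length ?w = N1" using W1(1) by simp
      have pw: "param_word 0 ?w k1" by (rule param_word_subst[OF W1(2) u(4)]) (use u in simp)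
      have wP: "?w \<in> P" unfolding P_def using lw pw by simp
      have "\<exists>x. x < N1 \<and> ?w ! x = a" if "a < k1" for a
      proof -
        have "a \<in> set ?w" using param_word_onto[OF pw] that by auto
        then show ?thesis using lw by (auto simp: in_set_conv_nth)
      qed
      then obtain pre where pick: "pre a < N1" "?w ! pre a = a" if "a < k1" for a by metis
      \<comment> \<open>Letters are replaced by positions of the first block where they occur.\<close>
      define v where "v = map (\<lambda>a. if a < k1 then pre a else N1 + (a - k1)) u2"
      have kk: "k1 \<le> k" by (rule param_word_le[OF u(5)])
      have "param_word N1 v (N1 + (k - k1))" unfolding v_def
        by (rule param_word_map[OF u(5) param_word_upt[of N1 "N1 + (k - k1)"]]) (use pick in auto)
      then have good: "good v" by (simp add: good_def v_def u(3))
      have v: "(?w @ [k1..<k]) ! (v ! i) = u2 ! i" if "i < length u2" for i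
      proof -
        have "u2 ! i < k" using param_word_set[OF u(5)] that(1) nth_mem by fastforce
        then show ?thesis using that kk pick[of "u2 ! i"] lw by (auto simp: v_def nth_append)
      qed
      have 1: "map ((!) u) W1 = ?w"
        using param_word_set[OF W1(2)] u(1,2) by (intro nth_equalityI) (auto simp: word_subst_def nth_append subset_iff)
      have "u ! ((W1 @ [n1..<n]) ! x) = (?w @ [k1..<k]) ! (if x < N1 then x else v ! (x - N1))" if x: "x \<in> set U" for x
      proof (cases "x < N1")
        case True
        then have "W1 ! x \<in> set W1" using W1(1) by simp
        then have "W1 ! x < n1" using param_word_set[OF W1(2)] by auto
        then show ?thesis using True W1(1) lw u(1,2) by (simp add: nth_append word_subst_def)
      next
        case False
        then have "x - N1 < n - n1" using param_word_set[OF U(2)] x by auto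
        then have "(W1 @ [n1..<n]) ! x = n1 + (x - N1)" "u ! (n1 + (x - N1)) = u2 ! (x - N1)"
          using False W1(1) u(1,2) by (auto simp: nth_append)
        then show ?thesis using False v[of "x - N1"] u(3) \<open>x - N1 < n - n1\<close> by simp
      qed
      then have 2: "map ((!) u) W2 = map ((!) (?w @ [k1..<k])) (word_subst N1 v U)"
        by (simp add: W2_def word_subst_def)
      have "col (map ((!) u) (W1 @ W2)) = col (ext ?w (word_subst N1 v U))"
        unfolding ext_def map_append 1 2 ..
      also have "\<dots> = col' ?w" by (rule col'[OF wP good])
      finally show "col (map ((!) u) (W1 @ W2)) = col' (word_subst 0 (take n1 u) W1)" using u(1,2) by simp
    qed
    have "typed_word N1 (N1 + N2) n1 n (W1 @ W2)"
      using W1 W2 lW2 by (simp add: typed_word_append)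
    moreover have "col (map ((!) u) (W1 @ W2)) = col (map ((!) u') (W1 @ W2))"
      if "typed_word n1 n k1 k u" "typed_word n1 n k1 k u'" for u u'
      unfolding color(1)[OF that(1)] color(1)[OF that(2)]
      using color(2,3)[OF that(1)] color(2,3)[OF that(2)] by (intro homogeneousD[OF W1(3)]) simp_all
    ultimately show ?thesis by (intro exI[of _ "W1 @ W2"] conjI allI impI)
  qed
  show ?thesis
    by (intro exI[of _ N1] exI[of _ "N1 + N2"] conjI N1(1) le_add1, intro allI impI, rule main, assumption)
qed

definition typed_homogeneous :: "nat \<Rightarrow> nat \<Rightarrow> nat \<Rightarrow> nat \<Rightarrow> (nat list \<Rightarrow> 'c) \<Rightarrow> nat list \<Rightarrow> bool"
  where "typed_homogeneous n1 n k1 k col W \<longleftrightarrow> (\<forall>u u'. typed_word n1 n k1 k u \<longrightarrow> typed_word n1 n k1 k u' \<longrightarrow>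
      col (map ((!) u) W) = col (map ((!) u') W))"

text \<open>The index \<open>i\<close> ranges over colourings of embeddings of different algebras, which is why the
theorem is iterated rather than applied to a colouring by vectors.\<close>

theorem typed_ramsey_simultaneous:
  fixes k1 k :: "'i \<Rightarrow> nat" and r :: nat
  assumes "finite I" "0 < n1" "n1 \<le> n" "\<And>i. i \<in> I \<Longrightarrow> 0 < k1 i"
  shows "\<exists>N1 N. 0 < N1 \<and> N1 \<le> N \<and> (\<forall>col :: 'i \<Rightarrow> nat list \<Rightarrow> nat. (\<forall>i w. col i w < r) \<longrightarrow>
    (\<exists>W. typed_word N1 N n1 n W \<and> (\<forall>i\<in>I. typed_homogeneous n1 n (k1 i) (k i) (col i) W)))"
  using assms
proof (induction I arbitrary: n1 n rule: finite_induct)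
  case empty
  have "typed_word n1 n n1 n [0..<n]"
    using empty param_word_upt[of 0 n1] param_word_upt[of n1 n] by (simp add: typed_word_def take_upt drop_upt)
  then show ?case using empty by (intro exI[of _ n1] exI[of _ n] conjI allI impI exI[of _ "[0..<n]"]) auto
next
  case (insert i I)
  obtain M1 M where M: "0 < M1" "M1 \<le> M" "\<forall>col :: nat list \<Rightarrow> nat. (\<forall>w. col w < r) \<longrightarrow>
    (\<exists>W. typed_word M1 M n1 n W \<and> typed_homogeneous n1 n (k1 i) (k i) col W)"
    using typed_ramsey[OF insert.prems(1,2) insert.prems(3)[OF insertI1], of r "k i", folded typed_homogeneous_def]
    by (elim exE conjE) (rule that)
  have k1: "0 < k1 j" if "j \<in> I" for j using insert.prems(3) that by simp
  have "\<exists>N1 N. 0 < N1 \<and> N1 \<le> N \<and> (\<forall>col :: 'i \<Rightarrow> nat list \<Rightarrow> nat. (\<forall>i w. col i w < r) \<longrightarrow>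
    (\<exists>W. typed_word N1 N M1 M W \<and> (\<forall>i\<in>I. typed_homogeneous M1 M (k1 i) (k i) (col i) W)))"
    by (rule insert.IH[OF M(1,2)]) (rule k1)
  then obtain N1 N where N: "0 < N1" "N1 \<le> N" "\<forall>col :: 'i \<Rightarrow> nat list \<Rightarrow> nat. (\<forall>i w. col i w < r) \<longrightarrow>
    (\<exists>W. typed_word N1 N M1 M W \<and> (\<forall>i\<in>I. typed_homogeneous M1 M (k1 i) (k i) (col i) W))"
    by (elim exE conjE) (rule that)
  have main: "\<exists>W. typed_word N1 N n1 n W \<and> (\<forall>i\<in>insert i I. typed_homogeneous n1 n (k1 i) (k i) (col i) W)"
    if col: "\<forall>i w. col i w < r" for col :: "'i \<Rightarrow> nat list \<Rightarrow> nat"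
  proof -
    obtain W where W: "typed_word N1 N M1 M W" "\<And>i. i \<in> I \<Longrightarrow> typed_homogeneous M1 M (k1 i) (k i) (col i) W"
      using mp[OF spec[OF N(3)] col] by blast
    obtain V where V: "typed_word M1 M n1 n V" "typed_homogeneous n1 n (k1 i) (k i) (\<lambda>w. col i (map ((!) w) W)) V"
      using M(3)[rule_format, of "\<lambda>w. col i (map ((!) w) W)"] col by blast
    have lt: "x < M" if "x \<in> set W" for x
      using typed_word_set[OF W(1) M(2) N(2)] that by auto
    have lV: "length V = M" using V(1) by (simp add: typed_word_def)
    have assoc: "map ((!) u) (map ((!) V) W) = map ((!) (map ((!) u) V)) W" for u :: "nat list"
      using lt lV by simp
    have "typed_word N1 N n1 n (map ((!) V) W)"
      by (rule typed_word_compose[OF W(1) V(1) M(2) N(2)])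
    moreover have "typed_homogeneous n1 n (k1 j) (k j) (col j) (map ((!) V) W)" if "j \<in> insert i I" for j
    proof (cases "j = i")
      case True
      then show ?thesis using V(2) unfolding typed_homogeneous_def assoc by (simp only:)
    next
      case False
      then have hom: "typed_homogeneous M1 M (k1 j) (k j) (col j) W" using W(2) that by blast
      have c: "typed_word M1 M (k1 j) (k j) (map ((!) u) V)" if "typed_word n1 n (k1 j) (k j) u" for u
        by (rule typed_word_compose[OF V(1) that insert.prems(2) M(2)])
      show ?thesis
        unfolding typed_homogeneous_def[of n1] assoc
      proof (intro allI impI)
        fix u u' assume "typed_word n1 n (k1 j) (k j) u" "typed_word n1 n (k1 j) (k j) u'"
        then show "col j (map ((!) (map ((!) u) V)) W) = col j (map ((!) (map ((!) u') V)) W)"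
          using hom c unfolding typed_homogeneous_def by blast
      qed
    qed
    ultimately show ?thesis by blast
  qed
  show ?case
    by (intro exI[of _ N1] exI[of _ N] conjI N(1,2), intro allI impI, rule main, assumption)
qed

section \<open>Classes modulo finite sets\<close>

lemma abs_pfin_eq_iff: "abs_pfin X = abs_pfin Y \<longleftrightarrow> finite (sym_diff X Y)"
  by (simp add: pfin.abs_eq_iff)

lemma abs_pfin_le_iff: "abs_pfin X \<le> abs_pfin Y \<longleftrightarrow> finite (X - Y)"
  by (simp add: less_eq_pfin.abs_eq)

lemmas pfin_simps = inf_pfin.abs_eq sup_pfin.abs_eq uminus_pfin.abs_eq minus_pfin.abs_eq

lemma abs_pfin_eq_bot_iff: "abs_pfin X = bot \<longleftrightarrow> finite X"
  by (simp add: bot_pfin_def abs_pfin_eq_iff)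

lemma ex_abs_pfin: "\<exists>X. x = abs_pfin X"
  by (induct x rule: pfin.abs_induct) blast

lemma abs_pfin_countable_iff: "abs_pfin X \<in> countable_classes \<longleftrightarrow> countable X"
proof
  assume "abs_pfin X \<in> countable_classes"
  then obtain Y where Y: "countable Y" "finite (sym_diff X Y)"
    by (auto simp: countable_classes_def abs_pfin_eq_iff)
  then have "countable (Y \<union> sym_diff X Y)" by (simp add: countable_finite)
  then show "countable X" by (rule countable_subset[rotated]) blast
qed (auto simp: countable_classes_def)

text \<open>The map induced on classes by a map of points.\<close>

lift_definition push :: "('a \<Rightarrow> 'b) \<Rightarrow> 'a pfin \<Rightarrow> 'b pfin" is "\<lambda>e X. e ` X"
proof -
  fix e :: "'a \<Rightarrow> 'b" and X Y :: "'a set"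
  assume "finite (sym_diff X Y)"
  then have "finite (e ` sym_diff X Y)" by simp
  then show "finite (sym_diff (e ` X) (e ` Y))" by (rule rev_finite_subset) blast
qed

lemma push_abs: "push e (abs_pfin X) = abs_pfin (e ` X)"
  by (rule push.abs_eq)

lemma push_hom:
  assumes "inj d"
  shows "push d (inf x y) = inf (push d x) (push d y)" "push d (sup x y) = sup (push d x) (push d y)"
    "push d bot = bot" "push d Orderings.top = abs_pfin (range d)"
    "push d (- x) = inf (abs_pfin (range d)) (- push d x)"
proof -
  obtain X Y where x: "x = abs_pfin X" and y: "y = abs_pfin Y" using ex_abs_pfin by metis
  show "push d (inf x y) = inf (push d x) (push d y)"
    using image_Int[OF assms, of X Y] by (simp add: x y pfin_simps push_abs)
  show "push d (sup x y) = sup (push d x) (push d y)"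
    by (simp add: x y pfin_simps push_abs image_Un)
  show "push d bot = bot" "push d Orderings.top = abs_pfin (range d)"
    by (simp_all add: bot_pfin_def top_pfin_def push_abs)
  have "d ` (- X) = range d \<inter> - d ` X" using assms by (auto dest: injD)
  then show "push d (- x) = inf (abs_pfin (range d)) (- push d x)"
    by (simp add: x pfin_simps push_abs)
qed

lemma inj_push:
  assumes "inj d"
  shows "inj (push d)"
proof (rule injI)
  fix x y assume eq: "push d x = push d y"
  obtain X Y where x: "x = abs_pfin X" and y: "y = abs_pfin Y" using ex_abs_pfin by metis
  have "sym_diff (d ` X) (d ` Y) = d ` sym_diff X Y" using assms by (auto dest: injD)
  then have "finite (sym_diff X Y)"
    using eq finite_image_iff[OF inj_on_subset[OF assms subset_UNIV]] by (simp add: x y push_abs abs_pfin_eq_iff)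
  then show "x = y" by (simp add: x y abs_pfin_eq_iff)
qed

lemma range_push:
  assumes "z \<le> abs_pfin (range d)"
  shows "\<exists>w. z = push d w"
proof -
  obtain Z where z: "z = abs_pfin Z" using ex_abs_pfin by metis
  have "finite (Z - range d)" using assms by (simp add: z abs_pfin_le_iff)
  moreover have "sym_diff Z (d ` (d -` Z)) = Z - range d" by auto
  ultimately have "z = push d (abs_pfin (d -` Z))" by (simp add: z push_abs abs_pfin_eq_iff)
  then show ?thesis by blast
qed

lemma boolean_iso_push:
  assumes "bij \<pi>"
  shows "boolean_iso (push \<pi>)"
proof -
  have inj: "inj \<pi>" and surj: "range \<pi> = UNIV" using assms by (auto simp: bij_def)
  have top: "abs_pfin (range \<pi>) = Orderings.top" by (simp add: surj top_pfin_def)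
  have "surj (push \<pi>)" using range_push[of _ \<pi>] top by (metis surj_def top_greatest)
  then show ?thesis
    using push_hom[OF inj] inj_push[OF inj] top by (simp add: boolean_iso_def bij_def)
qed

lemma boolean_isoD:
  assumes "boolean_iso f"
  shows "bij f" "f (inf x y) = inf (f x) (f y)" "f (sup x y) = sup (f x) (f y)" "f (- x) = - f x"
    "f bot = bot" "f Orderings.top = Orderings.top"
  using assms by (auto simp: boolean_iso_def)

lemma boolean_iso_inj: "boolean_iso f \<Longrightarrow> f x = f y \<longleftrightarrow> x = y"
  by (meson bij_is_inj boolean_isoD(1) injD)

lemma boolean_iso_le: "boolean_iso f \<Longrightarrow> f x \<le> f y \<longleftrightarrow> x \<le> y"
  by (metis boolean_isoD(2) boolean_iso_inj le_iff_inf)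

lemma boolean_iso_diff: "boolean_iso f \<Longrightarrow> f (x - y) = f x - f y"
  by (simp add: diff_eq boolean_isoD)

lemma boolean_iso_inv:
  assumes "boolean_iso f"
  shows "boolean_iso (inv_into UNIV f)"
proof -
  note f = boolean_isoD[OF assms]
  have [simp]: "f (inv_into UNIV f x) = x" for x using f(1) by (simp add: bij_is_surj surj_f_inv_f)
  have eq: "inv_into UNIV f x = y \<longleftrightarrow> x = f y" for x y using f(1) by (metis bij_inv_eq_iff)
  show ?thesis
    unfolding boolean_iso_def by (auto simp: eq f bij_imp_bij_inv)
qed

lemma boolean_iso_comp: "boolean_iso f \<Longrightarrow> boolean_iso g \<Longrightarrow> boolean_iso (f \<circ> g)"
  by (auto simp: boolean_iso_def bij_comp)

section \<open>Sets of size aleph one\<close>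

context
  includes cardinal_syntax
begin

lemma uncountable_omega1: "uncountable (UNIV :: omega1 set)"
proof
  assume "countable (UNIV :: omega1 set)"
  then obtain f :: "omega1 \<Rightarrow> nat" where "inj f" by (auto simp: countable_def)
  then have "|UNIV :: omega1 set| \<le>o |UNIV :: nat set|" using card_of_ordLeq[of UNIV UNIV] by blast
  moreover have "|UNIV :: nat set| <o card_suc |UNIV :: nat set|"
    using card_suc_greater card_of_card_order_on by blast
  moreover have "card_suc |UNIV :: nat set| =o |UNIV :: omega1 set|"
    using Card_order_card_suc[of "|UNIV :: nat set|"] card_of_card_order_on Field_card_suc
      card_of_Field_ordIso ordIso_symmetric by metis
  ultimately show False
    using not_ordLess_ordLeq ordLess_ordIso_trans by blast
qed

text \<open>An uncountable set has at least the successor cardinal of \<open>\<aleph>\<^sub>0\<close> many elements, which is the size of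
\<open>\<omega>\<^sub>1\<close>.\<close>

lemma bij_betw_uncountable:
  fixes X Y :: "omega1 set"
  assumes "uncountable X" "uncountable Y"
  shows "\<exists>f. bij_betw f X Y"
proof -
  have suc: "card_suc |UNIV :: nat set| =o |UNIV :: omega1 set|"
    using Card_order_card_suc[of "|UNIV :: nat set|"] card_of_card_order_on Field_card_suc
      card_of_Field_ordIso ordIso_symmetric by metis
  have iso: "|X| =o |UNIV :: omega1 set|" if "uncountable X" for X :: "omega1 set"
  proof -
    have "\<not> (\<exists>f. inj_on f X \<and> f ` X \<subseteq> (UNIV :: nat set))"
      using that by (auto simp: countable_def)
    then have "|UNIV :: nat set| <o |X|" by (rule card_of_ordLess[THEN iffD1])
    then have "cardSuc |UNIV :: nat set| \<le>o |X|"
      by (rule cardSuc_least[OF card_of_Card_order card_of_Card_order])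
    moreover have "cardSuc |UNIV :: nat set| =o card_suc |UNIV :: nat set|"
      using cardSuc_ordIso_card_suc card_of_card_order_on by blast
    ultimately have "|UNIV :: omega1 set| \<le>o |X|"
      using suc ordIso_ordLeq_trans ordIso_symmetric ordIso_transitive by metis
    moreover have "|X| \<le>o |UNIV :: omega1 set|" by (simp add: card_of_mono1)
    ultimately show ?thesis by (simp add: ordIso_iff_ordLeq)
  qed
  have "|X| =o |Y|"
    by (rule ordIso_transitive[OF iso[OF assms(1)] ordIso_symmetric[OF iso[OF assms(2)]]])
  then show ?thesis using card_of_ordIso by blast
qed

end

lemma bij_betw_same_type:
  fixes X Y :: "omega1 set"
  assumes "infinite X" "infinite Y" "countable X \<longleftrightarrow> countable Y"
  shows "\<exists>f. bij_betw f X Y"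
proof (cases "countable X")
  case True
  then have "bij_betw (to_nat_on X) X UNIV" "bij_betw (from_nat_into Y) UNIV Y"
    using assms by (auto intro: to_nat_on_infinite bij_betw_from_nat_into)
  then show ?thesis using bij_betw_trans by blast
qed (use bij_betw_uncountable assms in blast)

section \<open>Automorphisms preserve the ideal\<close>

text \<open>The maps \<open>e\<close> and \<open>d\<close> identify the algebras over \<open>'a\<close> and \<open>'b\<close> with the elements below the classes of
their ranges, and \<open>f\<close> carries the first of these intervals to the second.\<close>

lemma boolean_iso_between_intervals:
  fixes f :: "'c pfin \<Rightarrow> 'c pfin" and e :: "'a \<Rightarrow> 'c" and d :: "'b \<Rightarrow> 'c"
  assumes f: "boolean_iso f" and e: "inj e" and d: "inj d"
    and fed: "f (abs_pfin (range e)) = abs_pfin (range d)"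
  shows "\<exists>F :: 'a pfin \<Rightarrow> 'b pfin. boolean_iso F"
proof -
  note fD = boolean_isoD[OF f]
  have "push e u \<le> abs_pfin (range e)" for u
    using push_hom(1)[OF e, of u Orderings.top] push_hom(4)[OF e] by (metis inf.absorb_iff1 inf_top_right)
  then have "\<exists>w. f (push e u) = push d w" for u
    using range_push[of "f (push e u)" d] boolean_iso_le[OF f] fed by metis
  then obtain F where F: "push d (F u) = f (push e u)" for u by metis
  have inj: "push d x = push d y \<longleftrightarrow> x = y" for x y using inj_push[OF d] by (meson injD)
  have inj': "push e x = push e y \<longleftrightarrow> x = y" for x y using inj_push[OF e] by (meson injD)
  note dh = push_hom[OF d] and eh = push_hom[OF e]
  have "inj F" using F inj' boolean_iso_inj[OF f] by (metis injI)
  moreover have "surj F"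
    unfolding surj_def
  proof
    fix w
    have "push d w \<le> abs_pfin (range d)"
      using dh(1)[of w Orderings.top] dh(4) by (metis inf.absorb_iff1 inf_top_right)
    moreover obtain v where v: "push d w = f v" using fD(1) by (metis bij_pointE)
    ultimately obtain u where "v = push e u" using range_push boolean_iso_le[OF f] fed by metis
    then show "\<exists>u. w = F u" using v F inj by metis
  qed
  moreover have "F (inf x y) = inf (F x) (F y)" "F (sup x y) = sup (F x) (F y)" "F (- x) = - F x"
    "F bot = bot" "F Orderings.top = Orderings.top" for x y
    by (simp_all add: inj[symmetric] F dh eh fD fed)
  ultimately show ?thesis unfolding boolean_iso_def bij_def by blast
qed

lemma automorphism_preserves_countable:
  fixes f :: "omega1 pfin \<Rightarrow> omega1 pfin"
  assumes no_iso: "\<nexists>f :: nat pfin \<Rightarrow> omega1 pfin. boolean_iso f" and f: "boolean_iso f"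
  shows "f a \<in> countable_classes \<longleftrightarrow> a \<in> countable_classes"
proof -
  have imp: "h a \<in> countable_classes"
    if h: "boolean_iso h" and a: "a \<in> countable_classes" for h :: "omega1 pfin \<Rightarrow> omega1 pfin" and a
  proof (rule ccontr)
    assume not: "h a \<notin> countable_classes"
    obtain X Z where X: "a = abs_pfin X" and Z: "h a = abs_pfin Z" using ex_abs_pfin by metis
    have uZ: "uncountable Z" and cX: "countable X" using not a by (simp_all add: X Z[unfolded X] abs_pfin_countable_iff)
    have "infinite X"
    proof
      assume "finite X"
      then have "h a = bot" using boolean_isoD(5)[OF h] X by (metis abs_pfin_eq_bot_iff)
      then show False using Z uZ by (metis abs_pfin_eq_bot_iff countable_finite)
    qed
    then have e: "bij_betw (from_nat_into X) UNIV X" using cX by (simp add: bij_betw_from_nat_into)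
    obtain d where d: "bij_betw d (UNIV :: omega1 set) Z"
      using bij_betw_uncountable[OF uncountable_omega1 uZ] by blast
    have "\<exists>F :: nat pfin \<Rightarrow> omega1 pfin. boolean_iso F"
      by (rule boolean_iso_between_intervals[OF h, of "from_nat_into X" d])
        (use e d X Z in \<open>auto simp: bij_betw_def\<close>)
    then show False using no_iso by blast
  qed
  have "a = inv_into UNIV f (f a)" using boolean_isoD(1)[OF f] by (simp add: bij_is_inj)
  then show ?thesis using imp[OF f] imp[OF boolean_iso_inv[OF f], of "f a"] by metis
qed

section \<open>Finite partitions\<close>

text \<open>A partition of the unit into \<open>n\<close> numbered nonzero classes is given by a function on points, whose
fibres represent the pieces. In this way the pieces are literally disjoint and cover every point.\<close>

definition partition_fun :: "nat \<Rightarrow> ('a \<Rightarrow> nat) \<Rightarrow> bool"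
  where "partition_fun n p \<longleftrightarrow> (\<forall>x. p x < n) \<and> (\<forall>i<n. infinite (p -` {i}))"

text \<open>The join of the pieces with index in \<open>S\<close>.\<close>

definition cls :: "('a \<Rightarrow> 'i) \<Rightarrow> 'i set \<Rightarrow> 'a pfin"
  where "cls p S = abs_pfin (p -` S)"

lemma cls_simps: "inf (cls p S) (cls p T) = cls p (S \<inter> T)" "sup (cls p S) (cls p T) = cls p (S \<union> T)"
  "- cls p S = cls p (- S)" "cls p S - cls p T = cls p (S - T)"
  by (simp_all add: cls_def pfin_simps vimage_Int vimage_Un vimage_Compl vimage_Diff)

lemma cls_empty [simp]: "cls p {} = bot"
  by (simp add: cls_def bot_pfin_def)

lemma cls_UNIV [simp]: "cls p UNIV = Orderings.top"
  by (simp add: cls_def top_pfin_def)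

lemma cls_cong: "(\<And>x. p x \<in> S \<longleftrightarrow> p x \<in> T) \<Longrightarrow> cls p S = cls p T"
  by (simp add: cls_def vimage_def)

lemma cls_restrict: "partition_fun n p \<Longrightarrow> cls p (S \<inter> {..<n}) = cls p S"
  by (rule cls_cong) (simp add: partition_fun_def)

lemma cls_eq_bot_iff:
  assumes "partition_fun n p" "S \<subseteq> {..<n}"
  shows "cls p S = bot \<longleftrightarrow> S = {}"
proof
  assume "cls p S = bot"
  then have fin: "finite (p -` S)" by (simp add: cls_def abs_pfin_eq_bot_iff)
  show "S = {}"
  proof (rule ccontr)
    assume "S \<noteq> {}"
    then obtain i where "i \<in> S" by blast
    then have "finite (p -` {i})" using fin by (rule_tac finite_subset[OF _ fin]) auto
    then show False using \<open>i \<in> S\<close> assms by (auto simp: partition_fun_def)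
  qed
qed simp

lemma cls_le_iff:
  assumes "partition_fun n p" "S \<subseteq> {..<n}"
  shows "cls p S \<le> cls p T \<longleftrightarrow> S \<subseteq> T"
proof -
  have "cls p S \<le> cls p T \<longleftrightarrow> cls p (S - T) = bot"
    by (simp add: cls_def abs_pfin_le_iff abs_pfin_eq_bot_iff vimage_Diff)
  then show ?thesis using cls_eq_bot_iff[OF assms(1), of "S - T"] assms(2) by blast
qed

lemma cls_inject:
  assumes "partition_fun n p" "S \<subseteq> {..<n}" "T \<subseteq> {..<n}"
  shows "cls p S = cls p T \<longleftrightarrow> S = T"
  using cls_le_iff[OF assms(1,2)] cls_le_iff[OF assms(1,3)] by (auto simp: order_eq_iff)

lemma cls_countable_iff:
  assumes "finite S"
  shows "cls p S \<in> countable_classes \<longleftrightarrow> (\<forall>i\<in>S. cls p {i} \<in> countable_classes)"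
proof -
  have "p -` S = (\<Union>i\<in>S. p -` {i})" by auto
  then show ?thesis
    using assms unfolding cls_def abs_pfin_countable_iff
    by (metis (no_types, lifting) countable_UN countable_finite UN_upper countable_subset)
qed

definition partition_algebra :: "nat \<Rightarrow> ('a \<Rightarrow> nat) \<Rightarrow> 'a pfin set"
  where "partition_algebra n p = cls p ` Pow {..<n}"

lemma partition_algebra_mem: "partition_fun n p \<Longrightarrow> cls p S \<in> partition_algebra n p"
  unfolding partition_algebra_def by (metis cls_restrict Int_lower2 PowI imageI)

text \<open>Representatives of the finitely many elements cut the points into finitely many cells.\<close>

lemma finite_subset_of_subalgebra:
  fixes F :: "'a pfin set"
  assumes "finite F"
  shows "\<exists>A. finite_subalgebra A \<and> F \<subseteq> A"
proof -
  define c where "c w = {a \<in> F. w \<in> rep_pfin a}" for w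
  let ?A = "cls c ` Pow (Pow F)"
  have m: "cls c S \<in> ?A" for S
  proof -
    have "cls c S = cls c (S \<inter> Pow F)" by (rule cls_cong) (auto simp: c_def)
    then show ?thesis by blast
  qed
  have "finite_subalgebra ?A"
    unfolding finite_subalgebra_def
  proof (intro conjI ballI)
    show "finite ?A" using assms by simp
    show "bot \<in> ?A" "Orderings.top \<in> ?A" using m[of "{}"] m[of UNIV] by auto
    fix x y assume "x \<in> ?A" "y \<in> ?A"
    then obtain S T where "x = cls c S" "y = cls c T" by blast
    then show "- x \<in> ?A" "inf x y \<in> ?A" "sup x y \<in> ?A" using m by (simp_all add: cls_simps)
  qed
  moreover have "F \<subseteq> ?A"
  proof
    fix a assume "a \<in> F"
    then have "c -` {s. a \<in> s} = rep_pfin a" by (auto simp: c_def)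
    then have "cls c {s. a \<in> s} = a" by (simp only: cls_def Quotient_abs_rep[OF Quotient_pfin])
    then show "a \<in> ?A" using m[of "{s. a \<in> s}"] by (simp only:)
  qed
  ultimately show ?thesis by blast
qed

lemma atom_eqI: "a \<in> atoms A \<Longrightarrow> x \<in> A \<Longrightarrow> x \<le> a \<Longrightarrow> x \<noteq> bot \<Longrightarrow> x = a"
  unfolding atoms_def by blast

lemma finite_atom_below:
  assumes A: "finite_subalgebra A" and x: "x \<in> A" "x \<noteq> bot"
  shows "\<exists>a\<in>atoms A. a \<le> x"
proof -
  let ?B = "{y \<in> A. y \<noteq> bot \<and> y \<le> x}"
  have "finite ?B" "?B \<noteq> {}" using A x by (auto simp: finite_subalgebra_def)
  then obtain a where a: "a \<in> ?B" "\<And>y. y \<in> ?B \<Longrightarrow> y \<le> a \<Longrightarrow> a = y"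
    using finite_has_minimal[of ?B] by blast
  then have "a \<in> atoms A" by (auto simp: atoms_def) (metis order_trans)
  then show ?thesis using a by blast
qed

text \<open>Representatives of the atoms overlap, or miss points, only finitely often. Sending a point to the
first representative that contains it, and the missed points to \<open>0\<close>, changes each of them
by finitely many points.\<close>

lemma subalgebra_is_partition:
  fixes A :: "'a pfin set"
  assumes inf: "infinite (UNIV :: 'a set)" and A: "finite_subalgebra A" and xs: "distinct xs" "set xs = atoms A"
  shows "\<exists>p. partition_fun (length xs) p \<and> (\<forall>i<length xs. xs ! i = cls p {i}) \<and> A = partition_algebra (length xs) p"
proof -
  let ?n = "length xs"
  note AD = A[unfolded finite_subalgebra_def]
  have at: "xs ! i \<in> atoms A" if "i < ?n" for i using that xs by (metis nth_mem)
  have "\<forall>i. \<exists>Y. xs ! i = abs_pfin Y" using ex_abs_pfin by blast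
  then obtain X where X: "xs ! i = abs_pfin (X i)" for i by metis
  have atA: "xs ! i \<in> A" "xs ! i \<noteq> bot" if "i < ?n" for i using at[OF that] by (auto simp: atoms_def)
  have disj: "finite (X i \<inter> X j)" if ij: "i < ?n" "j < ?n" "i \<noteq> j" for i j
  proof -
    have "inf (xs ! i) (xs ! j) = bot"
    proof (rule ccontr)
      assume ne: "inf (xs ! i) (xs ! j) \<noteq> bot"
      have "inf (xs ! i) (xs ! j) \<in> A" using AD atA ij by blast
      from atom_eqI[OF at[OF ij(1)] this inf_le1 ne] atom_eqI[OF at[OF ij(2)] this inf_le2 ne]
      have "xs ! i = xs ! j" by simp
      then show False using xs(1) ij by (metis nth_eq_iff_index_eq)
    qed
    then show ?thesis by (simp add: X pfin_simps abs_pfin_eq_bot_iff)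
  qed
  have union: "abs_pfin (\<Union>i<m. X i) \<in> A" if "m \<le> ?n" for m
    using that
  proof (induction m)
    case 0
    then show ?case using AD by (simp add: bot_pfin_def)
  next
    case (Suc m)
    then have "sup (abs_pfin (\<Union>i<m. X i)) (xs ! m) \<in> A" using AD atA by simp
    then show ?case by (simp add: X pfin_simps lessThan_Suc Un_commute)
  qed
  have cover: "finite (- (\<Union>i<?n. X i))"
  proof (rule ccontr)
    assume "infinite (- (\<Union>i<?n. X i))"
    then have "- abs_pfin (\<Union>i<?n. X i) \<noteq> bot" by (simp add: pfin_simps abs_pfin_eq_bot_iff)
    moreover have "- abs_pfin (\<Union>i<?n. X i) \<in> A" using union AD by blast
    ultimately obtain i where i: "i < ?n" "xs ! i \<le> - abs_pfin (\<Union>i<?n. X i)"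
      using finite_atom_below[OF A] xs(2) by (metis in_set_conv_nth)
    moreover have "xs ! i \<le> abs_pfin (\<Union>i<?n. X i)" using i(1) by (auto simp: X abs_pfin_le_iff Diff_eq_empty_iff[THEN iffD2] UN_upper)
    ultimately have "xs ! i \<le> bot" by (metis inf_compl_bot le_inf_iff inf.commute)
    then show False using atA(2)[OF i(1)] by (simp add: bot_unique)
  qed
  have n0: "0 < ?n"
  proof (rule ccontr)
    assume "\<not> 0 < ?n"
    then show False using cover inf by simp
  qed
  define p where "p x = (if x \<in> (\<Union>i<?n. X i) then LEAST i. i < ?n \<and> x \<in> X i else 0)" for x
  have pLeast: "p x < ?n \<and> x \<in> X (p x)" if "x \<in> (\<Union>i<?n. X i)" for x
  proof -
    have "\<exists>i. i < ?n \<and> x \<in> X i" using that by blast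
    then show ?thesis unfolding p_def using that LeastI_ex[of "\<lambda>i. i < ?n \<and> x \<in> X i"] by simp
  qed
  have pn: "p x < ?n" for x using pLeast[of x] n0 by (cases "x \<in> (\<Union>i<?n. X i)") (auto simp: p_def)
  have xs_cls: "xs ! i = cls p {i}" if i: "i < ?n" for i
  proof -
    have "X i - p -` {i} \<subseteq> (\<Union>j\<in>{..<?n} - {i}. X i \<inter> X j)"
      using pLeast i by fastforce
    moreover have "finite (\<Union>j\<in>{..<?n} - {i}. X i \<inter> X j)"
      by (rule finite_UN_I) (use disj i in auto)
    ultimately have "finite (X i - p -` {i})" by (rule finite_subset)
    moreover have "p -` {i} - X i \<subseteq> - (\<Union>i<?n. X i)" using pLeast by fastforce
    then have "finite (p -` {i} - X i)" using cover by (rule finite_subset)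
    ultimately show ?thesis by (simp add: X cls_def abs_pfin_eq_iff)
  qed
  have pf: "partition_fun ?n p"
    unfolding partition_fun_def using pn xs_cls atA(2) by (metis cls_def abs_pfin_eq_bot_iff)
  have "A \<subseteq> partition_algebra ?n p"
  proof
    fix a assume a: "a \<in> A"
    obtain Y where Y: "a = abs_pfin Y" using ex_abs_pfin by metis
    let ?S = "{i. i < ?n \<and> xs ! i \<le> a}"
    have "finite (Y \<inter> p -` {i})" if i: "i < ?n" "\<not> xs ! i \<le> a" for i
    proof -
      have "inf a (xs ! i) \<in> A" using AD a atA i by blast
      then have "inf a (xs ! i) = bot"
        using atom_eqI[OF at[OF i(1)] _ inf_le2, of a] i(2) by (metis inf_le1)
      then show ?thesis using xs_cls[OF i(1)] by (simp add: Y cls_def pfin_simps abs_pfin_eq_bot_iff)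
    qed
    moreover have "Y - p -` ?S \<subseteq> (\<Union>i\<in>{i. i < ?n \<and> \<not> xs ! i \<le> a}. Y \<inter> p -` {i})"
      using pn by auto
    moreover have "finite (\<Union>i\<in>{i. i < ?n \<and> \<not> xs ! i \<le> a}. Y \<inter> p -` {i})"
      by (rule finite_UN_I) (use calculation(1) in auto)
    ultimately have 1: "finite (Y - p -` ?S)" using finite_subset by blast
    have "finite (p -` {i} - Y)" if "i \<in> ?S" for i
      using that xs_cls[of i] by (simp add: Y cls_def abs_pfin_le_iff)
    moreover have "p -` ?S - Y = (\<Union>i\<in>?S. p -` {i} - Y)" by auto
    moreover have "finite (\<Union>i\<in>?S. p -` {i} - Y)"
      by (rule finite_UN_I) (use calculation(1) in auto)
    ultimately have 2: "finite (p -` ?S - Y)" by (simp only:)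
    have eq: "a = cls p ?S" using 1 2 by (simp add: Y cls_def abs_pfin_eq_iff)
    show "a \<in> partition_algebra ?n p" by (subst eq) (rule partition_algebra_mem[OF pf])
  qed
  moreover have "cls p S \<in> A" if "S \<subseteq> {..<?n}" for S
  proof -
    have "finite S" using that finite_subset by blast
    then show ?thesis using that
    proof (induction S rule: finite_induct)
      case (insert i S)
      have "sup (xs ! i) (cls p S) \<in> A" using AD atA(1)[of i] insert by auto
      then show ?case using xs_cls[of i] insert.prems by (simp add: cls_simps)
    qed (use AD in simp)
  qed
  ultimately show ?thesis using pf xs_cls by (auto simp: partition_algebra_def)
qed

section \<open>Homogeneity\<close>

text \<open>Corresponding pieces are equinumerous, so a permutation of the points carries one partition to the
other.\<close>

lemma partition_homogeneous:
  fixes p q :: "omega1 \<Rightarrow> nat"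
  assumes p: "partition_fun n p" and q: "partition_fun n q"
    and type: "\<And>i. i < n \<Longrightarrow> cls p {i} \<in> countable_classes \<longleftrightarrow> cls q {i} \<in> countable_classes"
  shows "\<exists>g. boolean_iso g \<and> (\<forall>S. g (cls p S) = cls q S)"
proof -
  have "\<exists>h. bij_betw h (p -` {i}) (q -` {i})" if "i < n" for i
    using bij_betw_same_type type[OF that] that p q
    by (simp add: cls_def abs_pfin_countable_iff partition_fun_def)
  then obtain h where h: "bij_betw (h i) (p -` {i}) (q -` {i})" if "i < n" for i by metis
  define \<pi> where "\<pi> x = h (p x) x" for x
  have q\<pi>: "q (\<pi> x) = p x" for x
    using h[of "p x"] p bij_betwE by (fastforce simp: partition_fun_def \<pi>_def)
  have "inj \<pi>"
  proof (rule injI)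
    fix x y assume eq: "\<pi> x = \<pi> y"
    then have "p x = p y" using q\<pi> by metis
    then show "x = y" using eq h[of "p x"] p unfolding \<pi>_def bij_betw_def partition_fun_def inj_on_def
      by (metis (no_types, lifting) vimage_singleton_eq)
  qed
  moreover have "surj \<pi>"
    unfolding surj_def
  proof
    fix y
    have "h (q y) ` (p -` {q y}) = q -` {q y}" using h[of "q y"] q by (simp add: partition_fun_def bij_betw_def)
    then have "y \<in> h (q y) ` (p -` {q y})" by simp
    then obtain x where "p x = q y" "y = h (q y) x" by auto
    then show "\<exists>x. y = \<pi> x" unfolding \<pi>_def by metis
  qed
  ultimately have bij: "bij \<pi>" by (simp add: bij_def)
  have "\<pi> ` (p -` S) = q -` S" for S
  proof
    show "q -` S \<subseteq> \<pi> ` (p -` S)"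
    proof
      fix y assume y: "y \<in> q -` S"
      obtain x where "y = \<pi> x" using \<open>surj \<pi>\<close> by (rule surjE)
      then show "y \<in> \<pi> ` (p -` S)" using y q\<pi> by simp
    qed
  qed (use q\<pi> in auto)
  then have "push \<pi> (cls p S) = cls q S" for S by (simp add: cls_def push_abs)
  then show ?thesis using boolean_iso_push[OF bij] by blast
qed

section \<open>Natural orderings\<close>

text \<open>The antilexicographical ordering on the sets of indices of atoms: the largest index in the symmetric
difference belongs to \<open>T\<close>.\<close>

definition antilex_less :: "nat set \<Rightarrow> nat set \<Rightarrow> bool"
  where "antilex_less S T \<longleftrightarrow> (\<exists>m\<in>T - S. \<forall>i\<in>S - T. i < m)"

lemma antilex_less_total:
  assumes "finite S" "finite T" "S \<noteq> T"
  shows "antilex_less S T \<or> antilex_less T S"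
proof -
  let ?D = "sym_diff S T"
  have D: "finite ?D" "?D \<noteq> {}" using assms by auto
  let ?m = "Max ?D"
  have m: "?m \<in> ?D" using D by (rule Max_in)
  have "i < ?m" if "i \<in> ?D" "i \<noteq> ?m" for i using Max_ge[OF D(1) that(1)] that(2) by simp
  then show ?thesis using m unfolding antilex_less_def by (metis DiffD1 DiffD2 DiffI UnCI UnE)
qed

lemma antilex_less_iff_Max:
  assumes "finite S" "finite T" "S \<noteq> T"
  shows "antilex_less S T \<longleftrightarrow> Max (sym_diff S T) \<in> T"
proof -
  let ?D = "sym_diff S T"
  have D: "finite ?D" "?D \<noteq> {}" using assms by auto
  have m: "Max ?D \<in> ?D" using D by (rule Max_in)
  show ?thesis
  proof
    assume "antilex_less S T"
    then obtain k where k: "k \<in> T - S" "\<forall>i\<in>S - T. i < k" unfolding antilex_less_def by blast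
    then have "k \<le> Max ?D" using D by (intro Max_ge) auto
    show "Max ?D \<in> T"
    proof (rule ccontr)
      assume "Max ?D \<notin> T"
      then have "Max ?D \<in> S - T" using m by blast
      then show False using k(2) \<open>k \<le> Max ?D\<close> by (meson not_less)
    qed
  next
    assume "Max ?D \<in> T"
    then have "Max ?D \<in> T - S" using m by blast
    moreover have "i < Max ?D" if "i \<in> S - T" for i
    proof -
      have "i \<le> Max ?D" using that D by (intro Max_ge) auto
      moreover have "i \<noteq> Max ?D" using that \<open>Max ?D \<in> T\<close> by blast
      ultimately show ?thesis by simp
    qed
    ultimately show "antilex_less S T" unfolding antilex_less_def by blast
  qed
qed

lemma antilex_partition:
  assumes pf: "partition_fun (length xs) p" and xs: "\<And>i. i < length xs \<Longrightarrow> xs ! i = cls p {i}"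
    and S: "S \<subseteq> {..<length xs}" "T \<subseteq> {..<length xs}"
  shows "(cls p S, cls p T) \<in> antilex (partition_algebra (length xs) p) xs \<longleftrightarrow> antilex_less S T"
proof (cases "S = T")
  case True
  then show ?thesis by (simp add: antilex_def antilex_less_def)
next
  case False
  have fin: "finite S" "finite T" using S finite_subset by blast+
  have le: "xs ! m \<le> cls p U \<longleftrightarrow> m \<in> U" if "m < length xs" for m U
    using cls_le_iff[OF pf, of "{m}" U] that xs by simp
  have eq: "{m. m < length xs \<and> (xs ! m \<le> cls p S) \<noteq> (xs ! m \<le> cls p T)} = sym_diff S T"
    using S by (auto simp: le)
  have "Max (sym_diff S T) \<in> sym_diff S T" using fin False by (intro Max_in) auto
  then have "Max (sym_diff S T) < length xs" using S by auto
  then have "(cls p S, cls p T) \<in> antilex (partition_algebra (length xs) p) xs \<longleftrightarrow> Max (sym_diff S T) \<in> T"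
    unfolding antilex_def mem_Collect_eq prod.case eq
    using False cls_inject[OF pf S] partition_algebra_mem[OF pf] by (simp add: le)
  then show ?thesis using antilex_less_iff_Max[OF fin False] by simp
qed

text \<open>Naturality in terms of elements. Besides linearity: only the two differences matter; being below
\<open>z\<close> is closed under joins disjoint from \<open>z\<close>; being above \<open>x\<close> is closed upwards as long as disjointness
remains; the ideal comes first and \<open>bot\<close> at the very beginning. Each condition concerns few
elements, hence it defines a closed set of orderings, and it passes to subsets and along
automorphisms.\<close>

definition antilexicographic_on :: "'a::boolean_algebra set \<Rightarrow> 'a set \<Rightarrow> ('a \<times> 'a \<Rightarrow> bool) \<Rightarrow> bool"
  where "antilexicographic_on A P R \<longleftrightarrow>
    (\<forall>x\<in>A. \<not> R (x, x)) \<and>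
    (\<forall>x\<in>A. \<forall>y\<in>A. \<forall>z\<in>A. R (x, y) \<and> R (y, z) \<longrightarrow> R (x, z)) \<and>
    (\<forall>x\<in>A. \<forall>y\<in>A. x \<noteq> y \<longrightarrow> R (x, y) \<or> R (y, x)) \<and>
    (\<forall>x\<in>A. \<forall>y\<in>A. R (x, y) \<longleftrightarrow> R (x - y, y - x)) \<and>
    (\<forall>x\<in>A. \<forall>y\<in>A. \<forall>z\<in>A. R (x, z) \<and> R (y, z) \<and> inf x z = bot \<and> inf y z = bot \<longrightarrow> R (sup x y, z)) \<and>
    (\<forall>x\<in>A. \<forall>y\<in>A. \<forall>z\<in>A. R (x, y) \<and> y \<le> z \<and> inf x z = bot \<longrightarrow> R (x, z)) \<and>
    (\<forall>x\<in>A. \<forall>y\<in>A. x \<in> P \<and> y \<notin> P \<longrightarrow> R (x, y)) \<and>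
    (\<forall>x\<in>A. x \<noteq> bot \<longrightarrow> R (bot, x))"

abbreviation antilexicographic :: "'a::boolean_algebra set \<Rightarrow> ('a \<times> 'a \<Rightarrow> bool) \<Rightarrow> bool"
  where "antilexicographic \<equiv> antilexicographic_on UNIV"

lemma antilexicographic_onD:
  assumes "antilexicographic_on A P R" "x \<in> A"
  shows "\<not> R (x, x)" "y \<in> A \<Longrightarrow> z \<in> A \<Longrightarrow> R (x, y) \<Longrightarrow> R (y, z) \<Longrightarrow> R (x, z)"
    "y \<in> A \<Longrightarrow> x \<noteq> y \<Longrightarrow> R (x, y) \<or> R (y, x)" "y \<in> A \<Longrightarrow> R (x, y) \<longleftrightarrow> R (x - y, y - x)"
    "y \<in> A \<Longrightarrow> z \<in> A \<Longrightarrow> R (x, z) \<Longrightarrow> R (y, z) \<Longrightarrow> inf x z = bot \<Longrightarrow> inf y z = bot \<Longrightarrow> R (sup x y, z)"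
    "y \<in> A \<Longrightarrow> z \<in> A \<Longrightarrow> R (x, y) \<Longrightarrow> y \<le> z \<Longrightarrow> inf x z = bot \<Longrightarrow> R (x, z)"
    "y \<in> A \<Longrightarrow> x \<in> P \<Longrightarrow> y \<notin> P \<Longrightarrow> R (x, y)" "x \<noteq> bot \<Longrightarrow> R (bot, x)"
proof -
  note a = assms(1)[unfolded antilexicographic_on_def]
  note c = a[THEN conjunct1]
    a[THEN conjunct2, THEN conjunct1]
    a[THEN conjunct2, THEN conjunct2, THEN conjunct1]
    a[THEN conjunct2, THEN conjunct2, THEN conjunct2, THEN conjunct1]
    a[THEN conjunct2, THEN conjunct2, THEN conjunct2, THEN conjunct2, THEN conjunct1]
    a[THEN conjunct2, THEN conjunct2, THEN conjunct2, THEN conjunct2, THEN conjunct2, THEN conjunct1]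
    a[THEN conjunct2, THEN conjunct2, THEN conjunct2, THEN conjunct2, THEN conjunct2, THEN conjunct2, THEN conjunct1]
    a[THEN conjunct2, THEN conjunct2, THEN conjunct2, THEN conjunct2, THEN conjunct2, THEN conjunct2, THEN conjunct2]
  show "\<not> R (x, x)" using c(1) assms(2) by blast
  show "R (x, z)" if "y \<in> A" "z \<in> A" "R (x, y)" "R (y, z)" using c(2) assms(2) that by blast
  show "R (x, y) \<or> R (y, x)" if "y \<in> A" "x \<noteq> y" using c(3) assms(2) that by blast
  show "R (x, y) \<longleftrightarrow> R (x - y, y - x)" if "y \<in> A" using c(4) assms(2) that by blast
  show "R (sup x y, z)" if "y \<in> A" "z \<in> A" "R (x, z)" "R (y, z)" "inf x z = bot" "inf y z = bot"
    using c(5) assms(2) that by blast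
  show "R (x, z)" if "y \<in> A" "z \<in> A" "R (x, y)" "y \<le> z" "inf x z = bot"
    using c(6) assms(2) that by blast
  show "R (x, y)" if "y \<in> A" "x \<in> P" "y \<notin> P" using c(7) assms(2) that by blast
  show "R (bot, x)" if "x \<noteq> bot" using c(8) assms(2) that by blast
qed

lemma antilexicographic_onI:
  assumes "\<And>x. x \<in> A \<Longrightarrow> \<not> R (x, x)"
    "\<And>x y z. x \<in> A \<Longrightarrow> y \<in> A \<Longrightarrow> z \<in> A \<Longrightarrow> R (x, y) \<Longrightarrow> R (y, z) \<Longrightarrow> R (x, z)"
    "\<And>x y. x \<in> A \<Longrightarrow> y \<in> A \<Longrightarrow> x \<noteq> y \<Longrightarrow> R (x, y) \<or> R (y, x)"
    "\<And>x y. x \<in> A \<Longrightarrow> y \<in> A \<Longrightarrow> R (x, y) \<longleftrightarrow> R (x - y, y - x)"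
    "\<And>x y z. x \<in> A \<Longrightarrow> y \<in> A \<Longrightarrow> z \<in> A \<Longrightarrow> R (x, z) \<Longrightarrow> R (y, z) \<Longrightarrow> inf x z = bot \<Longrightarrow> inf y z = bot \<Longrightarrow> R (sup x y, z)"
    "\<And>x y z. x \<in> A \<Longrightarrow> y \<in> A \<Longrightarrow> z \<in> A \<Longrightarrow> R (x, y) \<Longrightarrow> y \<le> z \<Longrightarrow> inf x z = bot \<Longrightarrow> R (x, z)"
    "\<And>x y. x \<in> A \<Longrightarrow> y \<in> A \<Longrightarrow> x \<in> P \<Longrightarrow> y \<notin> P \<Longrightarrow> R (x, y)"
    "\<And>x. x \<in> A \<Longrightarrow> x \<noteq> bot \<Longrightarrow> R (bot, x)"
  shows "antilexicographic_on A P R"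
  unfolding antilexicographic_on_def by (intro conjI ballI impI; (elim conjE)?; rule assms; assumption)

text \<open>Any three elements lie in a finite subalgebra.\<close>

lemma antilexicographic_local:
  fixes R :: "'a pfin \<times> 'a pfin \<Rightarrow> bool"
  assumes "\<And>A. finite_subalgebra A \<Longrightarrow> antilexicographic_on A P R"
  shows "antilexicographic P R"
proof -
  have ex: "\<exists>A. antilexicographic_on A P R \<and> x \<in> A \<and> y \<in> A \<and> z \<in> A" for x y z
    using finite_subset_of_subalgebra[of "{x, y, z}"] assms by auto
  show ?thesis
  proof (rule antilexicographic_onI)
    fix x y z
    obtain A where A: "antilexicographic_on A P R" "x \<in> A" "y \<in> A" "z \<in> A" using ex by blast
    note D = antilexicographic_onD[OF A(1)]
    show "\<not> R (x, x)" by (rule D(1)[OF A(2)])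
    show "R (x, z)" if "R (x, y)" "R (y, z)" by (rule D(2)[OF A(2-4) that])
    show "R (x, y) \<or> R (y, x)" if "x \<noteq> y" by (rule D(3)[OF A(2,3) that])
    show "R (x, y) \<longleftrightarrow> R (x - y, y - x)" by (rule D(4)[OF A(2,3)])
    show "R (sup x y, z)" if "R (x, z)" "R (y, z)" "inf x z = bot" "inf y z = bot" by (rule D(5)[OF A(2-4) that])
    show "R (x, z)" if "R (x, y)" "y \<le> z" "inf x z = bot" by (rule D(6)[OF A(2-4) that])
    show "R (x, y)" if "x \<in> P" "y \<notin> P" by (rule D(7)[OF A(2,3) that])
    show "R (bot, x)" if "x \<noteq> bot" by (rule D(8)[OF A(2) that])
  qed
qed

lemma strict_linear_orderD:
  assumes "strict_linear_order (Collect R)"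
  shows "\<not> R (x, x)" "R (x, y) \<Longrightarrow> \<not> R (y, x)" "R (x, y) \<Longrightarrow> R (y, z) \<Longrightarrow> R (x, z)"
    "x \<noteq> y \<Longrightarrow> R (x, y) \<or> R (y, x)"
  using assms unfolding strict_linear_order_on_def irrefl_def trans_def total_on_def by blast+

lemma antilexicographic_linear:
  assumes "antilexicographic P R"
  shows "strict_linear_order (Collect R)"
proof -
  note D = antilexicographic_onD(1-3)[OF assms UNIV_I]
  show ?thesis
    unfolding strict_linear_order_on_def irrefl_def trans_def total_on_def
    using D(1) D(2)[OF UNIV_I UNIV_I] D(3)[OF UNIV_I] by (intro conjI allI impI ballI) auto
qed

lemma antilexicographic_on_partition:
  fixes R :: "'a pfin \<times> 'a pfin \<Rightarrow> bool"
  assumes p: "partition_fun n p"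
    and proper: "\<And>i j. i < n \<Longrightarrow> j < n \<Longrightarrow> cls p {i} \<in> countable_classes \<Longrightarrow> cls p {j} \<notin> countable_classes \<Longrightarrow> i < j"
    and R: "\<And>S T. S \<subseteq> {..<n} \<Longrightarrow> T \<subseteq> {..<n} \<Longrightarrow> R (cls p S, cls p T) = antilex_less S T"
  shows "antilexicographic_on (partition_algebra n p) countable_classes R"
proof (rule antilexicographic_onI)
  let ?A = "partition_algebra n p" and ?P = "countable_classes :: 'a pfin set"
  fix x y z assume x: "x \<in> ?A" 
  then obtain S where S: "x = cls p S" "S \<subseteq> {..<n}" by (auto simp: partition_algebra_def)
  have fin: "finite S" using S finite_subset by blast
  show "\<not> R (x, x)" using S R by (simp add: antilex_less_def)
  show "R (bot, x)" if "x \<noteq> bot"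
  proof -
    have "S \<noteq> {}" using that S by auto
    then have "antilex_less {} S" by (auto simp: antilex_less_def)
    then show ?thesis using S R[of "{}" S] by simp
  qed
  assume y: "y \<in> ?A"
  then obtain T where T: "y = cls p T" "T \<subseteq> {..<n}" by (auto simp: partition_algebra_def)
  have finT: "finite T" using T finite_subset by blast
  show "R (x, y) \<or> R (y, x)" if "x \<noteq> y"
    using that S T R antilex_less_total[OF fin finT] by auto
  show "R (x, y) \<longleftrightarrow> R (x - y, y - x)"
  proof -
    have "S - T \<subseteq> {..<n}" "T - S \<subseteq> {..<n}" using S T by auto
    then have "R (x, y) = antilex_less S T" "R (x - y, y - x) = antilex_less (S - T) (T - S)"
      using S T R by (simp_all add: cls_simps)
    then show ?thesis by (simp add: antilex_less_def) blast
  qed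
  show "R (x, y)" if h: "x \<in> ?P" "y \<notin> ?P"
  proof -
    obtain j where j: "j \<in> T" "cls p {j} \<notin> ?P" using h(2) cls_countable_iff[OF finT] T(1) by blast
    have "i < j" if "i \<in> S" for i
    proof -
      have "cls p {i} \<in> ?P" using h(1) cls_countable_iff[OF fin] S(1) that by blast
      then show ?thesis using proper[of i j] S(2) T(2) j that by blast
    qed
    moreover from this have "j \<notin> S" by blast
    ultimately have "antilex_less S T" using j(1) unfolding antilex_less_def by blast
    then show ?thesis using S T R by simp
  qed
  assume z: "z \<in> ?A"
  then obtain U where U: "z = cls p U" "U \<subseteq> {..<n}" by (auto simp: partition_algebra_def)
  show "R (x, z)" if "R (x, y)" "R (y, z)"
  proof -
    have "antilex_less S T" "antilex_less T U" using that S T U R by auto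
    then obtain k l where k: "k \<in> T - S" "\<forall>i\<in>S - T. i < k" and l: "l \<in> U - T" "\<forall>i\<in>T - U. i < l"
      unfolding antilex_less_def by blast
    \<comment> \<open>The larger of the two witnesses decides between \<open>S\<close> and \<open>U\<close>.\<close>
    have "antilex_less S U"
    proof (cases "k < l")
      case True
      then have "l \<in> U - S" using k l by (metis DiffD1 DiffD2 DiffI less_asym)
      moreover have "i < l" if "i \<in> S - U" for i
        using that k l True by (metis DiffD1 DiffD2 DiffI less_trans)
      ultimately show ?thesis unfolding antilex_less_def by blast
    next
      case False
      have "k \<in> U - S" using k l False by blast
      moreover have "i < k" if "i \<in> S - U" for i
      proof (cases "i \<in> T")
        case True
        then have "i < l" using l that by blast
        then show ?thesis using False by simp
      qed (use that k in blast)
      ultimately show ?thesis unfolding antilex_less_def by blast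
    qed
    then show ?thesis using S U R by simp
  qed
  show "R (sup x y, z)" if h: "R (x, z)" "R (y, z)" "inf x z = bot" "inf y z = bot"
  proof -
    have "S \<inter> U \<subseteq> {..<n}" "T \<inter> U \<subseteq> {..<n}" using U by auto
    then have disj: "S \<inter> U = {}" "T \<inter> U = {}"
      using h(3,4) cls_eq_bot_iff[OF p, of "S \<inter> U"] cls_eq_bot_iff[OF p, of "T \<inter> U"] S(1) T(1) U(1) by (auto simp: cls_simps)
    have "antilex_less S U" "antilex_less T U" using h R S T U by auto
    then obtain k l where k: "k \<in> U" "\<forall>i\<in>S. i < k" "l \<in> U" "\<forall>i\<in>T. i < l"
      using disj unfolding antilex_less_def by (metis Diff_triv DiffE)
    have "max k l \<in> U - (S \<union> T)" using k(1,3) disj by (auto simp: max_def)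
    moreover have "\<forall>i\<in>S \<union> T. i < max k l" using k(2,4) by (auto simp: less_max_iff_disj)
    ultimately have "antilex_less (S \<union> T) U" unfolding antilex_less_def by blast
    moreover have "S \<union> T \<subseteq> {..<n}" using S T by auto
    ultimately show ?thesis using S T U R by (simp add: cls_simps)
  qed
  show "R (x, z)" if h: "R (x, y)" "y \<le> z" "inf x z = bot"
  proof -
    have "S \<inter> U \<subseteq> {..<n}" using U by auto
    then have disj: "S \<inter> U = {}" "T \<subseteq> U"
      using h(2,3) cls_eq_bot_iff[OF p, of "S \<inter> U"] cls_le_iff[OF p, of T U] S(1) T U(1) by (auto simp: cls_simps)
    have "antilex_less S T" using h R S T by auto
    then have "antilex_less S U" using disj unfolding antilex_less_def by blast
    then show ?thesis using S U R by simp
  qed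
qed

lemma NO_on_subalgebra:
  fixes R :: "'a pfin \<times> 'a pfin \<Rightarrow> bool"
  assumes inf: "infinite (UNIV :: 'a set)" and R: "R \<in> NO P" and A: "finite_subalgebra A"
  shows "\<exists>n p. partition_fun n p \<and> A = partition_algebra n p \<and>
    (\<forall>i<n. \<forall>j<n. cls p {i} \<in> P \<longrightarrow> cls p {j} \<notin> P \<longrightarrow> i < j) \<and>
    (\<forall>S T. S \<subseteq> {..<n} \<longrightarrow> T \<subseteq> {..<n} \<longrightarrow> R (cls p S, cls p T) = antilex_less S T)"
proof -
  obtain xs where xs: "proper_enum P A xs" "Restr (Collect R) A = antilex A xs"
    using R A unfolding NO_def natural_ordering_def by blast
  obtain p where p: "partition_fun (length xs) p" "\<And>i. i < length xs \<Longrightarrow> xs ! i = cls p {i}" "A = partition_algebra (length xs) p"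
    using subalgebra_is_partition[OF inf A] xs(1) unfolding proper_enum_def by blast
  have "R (cls p S, cls p T) = antilex_less S T" if S: "S \<subseteq> {..<length xs}" "T \<subseteq> {..<length xs}" for S T
  proof -
    have "cls p S \<in> A" "cls p T \<in> A" using partition_algebra_mem[OF p(1)] p(3) by auto
    then have "R (cls p S, cls p T) \<longleftrightarrow> (cls p S, cls p T) \<in> Restr (Collect R) A" by blast
    also have "\<dots> \<longleftrightarrow> (cls p S, cls p T) \<in> antilex (partition_algebra (length xs) p) xs"
      using xs(2) unfolding p(3) by (simp only:)
    also have "\<dots> \<longleftrightarrow> antilex_less S T" by (rule antilex_partition[OF p(1,2) S])
    finally show ?thesis .
  qed
  moreover have "i < j" if "i < length xs" "j < length xs" "cls p {i} \<in> P" "cls p {j} \<notin> P" for i j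
    using xs(1) that p(2) unfolding proper_enum_def by metis
  ultimately show ?thesis using p by blast
qed

lemma NO_imp_antilexicographic:
  fixes R :: "'a pfin \<times> 'a pfin \<Rightarrow> bool"
  assumes inf: "infinite (UNIV :: 'a set)" and R: "R \<in> NO countable_classes"
  shows "antilexicographic countable_classes R"
proof (rule antilexicographic_local)
  fix A :: "'a pfin set" assume "finite_subalgebra A"
  then obtain n p where p: "partition_fun n p" "A = partition_algebra n p"
    "\<forall>i<n. \<forall>j<n. cls p {i} \<in> countable_classes \<longrightarrow> cls p {j} \<notin> countable_classes \<longrightarrow> i < j"
    "\<forall>S T. S \<subseteq> {..<n} \<longrightarrow> T \<subseteq> {..<n} \<longrightarrow> R (cls p S, cls p T) = antilex_less S T"
    using NO_on_subalgebra[OF inf R] by blast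
  show "antilexicographic_on A countable_classes R"
    unfolding p(2) by (rule antilexicographic_on_partition[OF p(1)]) (use p(3,4) in blast)+
qed

text \<open>Disjointness is part of the conclusion because the induction uses it.\<close>

lemma antilexicographic_join:
  assumes R: "antilexicographic P R" and U: "finite U"
    and less: "\<And>i. i \<in> U \<Longrightarrow> R (cls p {i}, z)" and disj: "\<And>i. i \<in> U \<Longrightarrow> inf (cls p {i}) z = bot" and z: "z \<noteq> bot"
  shows "R (cls p U, z) \<and> inf (cls p U) z = bot"
  using U less disj
proof (induction U rule: finite_induct)
  case empty
  then show ?case using antilexicographic_onD(8)[OF R UNIV_I z] by simp
next
  case (insert i U)
  have 1: "R (cls p {i}, z)" "R (cls p U, z)" "inf (cls p {i}) z = bot" "inf (cls p U) z = bot"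
    using insert by simp_all
  have eq: "cls p (insert i U) = sup (cls p {i}) (cls p U)" by (simp add: cls_simps)
  have "inf (sup (cls p {i}) (cls p U)) z = bot" using 1(3,4) by (simp add: inf_sup_distrib2)
  then show ?case unfolding eq using antilexicographic_onD(5)[OF R UNIV_I UNIV_I UNIV_I 1] by simp
qed

lemma increasing_partition_proper:
  fixes p :: "'a \<Rightarrow> nat"
  assumes R: "antilexicographic P R" and inc: "\<And>i j. i < j \<Longrightarrow> j < n \<Longrightarrow> R (cls p {i}, cls p {j})"
    and ij: "i < n" "j < n" "cls p {i} \<in> P" "cls p {j} \<notin> P"
  shows "i < j"
proof (rule ccontr)
  assume "\<not> i < j"
  moreover have "i \<noteq> j" using ij by metis
  ultimately have "j < i" by simp
  then have "R (cls p {j}, cls p {i})" using ij(1) by (rule inc)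
  moreover have "R (cls p {i}, cls p {j})" by (rule antilexicographic_onD(7)[OF R UNIV_I UNIV_I ij(3,4)])
  ultimately show False using strict_linear_orderD(2)[OF antilexicographic_linear[OF R]] by blast
qed

text \<open>On a partition numbered increasingly, such an ordering is determined: if \<open>m\<close> is the largest index in
which \<open>S\<close> and \<open>T\<close> differ and \<open>m \<in> T\<close>, then the join of the smaller pieces in \<open>S - T\<close> is below the piece \<open>m\<close>,
which is contained in \<open>T - S\<close>.\<close>

lemma antilexicographic_partition:
  assumes R: "antilexicographic P R" and pf: "partition_fun n p"
    and inc: "\<And>i j. i < j \<Longrightarrow> j < n \<Longrightarrow> R (cls p {i}, cls p {j})"
    and S: "S \<subseteq> {..<n}" "T \<subseteq> {..<n}"
  shows "R (cls p S, cls p T) \<longleftrightarrow> antilex_less S T"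
proof -
  note RD = antilexicographic_onD[OF R UNIV_I]
  have lin: "strict_linear_order (Collect R)" by (rule antilexicographic_linear[OF R])
  have less: "R (cls p S, cls p T)" if less: "antilex_less S T" and ST: "S \<subseteq> {..<n}" "T \<subseteq> {..<n}" for S T
  proof -
    obtain m where m: "m \<in> T" "m \<notin> S" "\<forall>i\<in>S - T. i < m" using less unfolding antilex_less_def by blast
    have mn: "m < n" using m ST by auto
    have "cls p {m} \<noteq> bot" using cls_eq_bot_iff[OF pf, of "{m}"] mn by simp
    moreover have "finite (S - T)" using ST(1) finite_subset by blast
    moreover have "R (cls p {i}, cls p {m})" if "i \<in> S - T" for i using inc[of i m] m(3) mn that by blast
    moreover have "inf (cls p {i}) (cls p {m}) = bot" if "i \<in> S - T" for i
    proof -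
      have "i \<noteq> m" using m(1) that by blast
      then show ?thesis by (simp add: cls_simps)
    qed
    ultimately have "R (cls p (S - T), cls p {m})" using antilexicographic_join[OF R] by blast
    moreover have "cls p {m} \<le> cls p (T - S)" using cls_le_iff[OF pf, of "{m}"] m mn by simp
    moreover have "inf (cls p (S - T)) (cls p (T - S)) = bot"
    proof -
      have "(S - T) \<inter> (T - S) = {}" by blast
      then show ?thesis by (simp add: cls_simps)
    qed
    ultimately have "R (cls p (S - T), cls p (T - S))" by (rule RD(6)[OF UNIV_I UNIV_I])
    then have "R (cls p S - cls p T, cls p T - cls p S)" by (simp add: cls_simps)
    then show ?thesis using RD(4)[OF UNIV_I] by blast
  qed
  have fin: "finite S" "finite T" using S finite_subset by blast+
  have asym: "\<not> antilex_less T S" if "antilex_less S T" for S T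
    using that unfolding antilex_less_def by (meson DiffD1 DiffD2 DiffI less_asym)
  show ?thesis
  proof
    assume RST: "R (cls p S, cls p T)"
    show "antilex_less S T"
    proof (rule ccontr)
      assume "\<not> antilex_less S T"
      then have "S = T \<or> antilex_less T S" using antilex_less_total[OF fin] by blast
      then show False using strict_linear_orderD(1,2)[OF lin] RST less[OF _ S(2,1)] by blast
    qed
  qed (use less S in blast)
qed

lemma sorted_enumeration:
  assumes "strict_linear_order r" "finite A"
  shows "\<exists>xs. distinct xs \<and> set xs = A \<and> sorted_wrt (\<lambda>x y. (x, y) \<in> r) xs"
  using assms(2)
proof (induction A rule: finite_induct)
  case (insert a A)
  then obtain xs where xs: "distinct xs" "set xs = A" "sorted_wrt (\<lambda>x y. (x, y) \<in> r) xs" by blast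
  have tr: "(x, z) \<in> r" if "(x, y) \<in> r" "(y, z) \<in> r" for x y z
    using assms(1) that unfolding strict_linear_order_on_def trans_def by blast
  have tot: "(x, a) \<in> r \<or> (a, x) \<in> r" if "x \<in> A" for x
  proof -
    have "x \<noteq> a" using that insert.hyps(2) by blast
    then show ?thesis using assms(1) by (simp add: strict_linear_order_on_def total_on_def)
  qed
  have irr: "\<not> ((x, a) \<in> r \<and> (a, x) \<in> r)" for x
    using assms(1) tr unfolding strict_linear_order_on_def irrefl_def by blast
  let ?xs = "filter (\<lambda>x. (x, a) \<in> r) xs @ a # filter (\<lambda>x. (a, x) \<in> r) xs"
  have "distinct ?xs" using xs insert.hyps irr by auto
  moreover have "set ?xs = insert a A" using xs tot by auto
  moreover have "sorted_wrt (\<lambda>x y. (x, y) \<in> r) ?xs"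
    using xs tr by (auto simp: sorted_wrt_append intro: sorted_wrt_filter)
  ultimately show ?case by blast
qed simp

lemma partition_refining:
  fixes A :: "'a pfin set" and R :: "'a pfin \<times> 'a pfin \<Rightarrow> bool"
  assumes inf: "infinite (UNIV :: 'a set)" and A: "finite_subalgebra A" and lin: "strict_linear_order (Collect R)"
  shows "\<exists>n p xs. partition_fun n p \<and> A = partition_algebra n p \<and> distinct xs \<and> set xs = atoms A \<and> length xs = n \<and>
    (\<forall>i<n. xs ! i = cls p {i}) \<and> (\<forall>i j. i < j \<longrightarrow> j < n \<longrightarrow> R (cls p {i}, cls p {j}))"
proof -
  have "finite (atoms A)" using A by (auto simp: finite_subalgebra_def atoms_def)
  then obtain xs where xs: "distinct xs" "set xs = atoms A" "sorted_wrt (\<lambda>x y. (x, y) \<in> Collect R) xs"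
    using sorted_enumeration[OF lin] by blast
  obtain p where p: "partition_fun (length xs) p" "\<forall>i<length xs. xs ! i = cls p {i}" "A = partition_algebra (length xs) p"
    using subalgebra_is_partition[OF inf A xs(1,2)] by blast
  have "R (cls p {i}, cls p {j})" if "i < j" "j < length xs" for i j
    using sorted_wrt_nth_less[OF xs(3) that] p(2) that by auto
  then show ?thesis using p xs by blast
qed

lemma antilexicographic_imp_NO:
  fixes R :: "'a pfin \<times> 'a pfin \<Rightarrow> bool"
  assumes inf: "infinite (UNIV :: 'a set)" and R: "antilexicographic P R"
  shows "R \<in> NO P"
proof -
  note RD = antilexicographic_onD[OF R UNIV_I]
  have lin: "strict_linear_order (Collect R)" by (rule antilexicographic_linear[OF R])
  have "natural_ordering P A (Restr (Collect R) A)" if A: "finite_subalgebra A" for A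
  proof -
    obtain n p xs where p: "partition_fun n p" "A = partition_algebra n p" "distinct xs" "set xs = atoms A" "length xs = n"
      "\<And>i. i < n \<Longrightarrow> xs ! i = cls p {i}" "\<And>i j. i < j \<Longrightarrow> j < n \<Longrightarrow> R (cls p {i}, cls p {j})"
      using partition_refining[OF inf A lin] by blast
    have "i < j" if "i < n" "j < n" "xs ! i \<in> P" "xs ! j \<notin> P" for i j
      by (rule increasing_partition_proper[OF R p(7)]) (use that p(6) in auto)
    then have "proper_enum P A xs" unfolding proper_enum_def using p by blast
    moreover have "Restr (Collect R) A = antilex A xs"
    proof (rule Set.set_eqI)
      fix z :: "'a pfin \<times> 'a pfin"
      obtain x y where z: "z = (x, y)" by (cases z)
      show "z \<in> Restr (Collect R) A \<longleftrightarrow> z \<in> antilex A xs"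
      proof (cases "x \<in> A \<and> y \<in> A")
        case True
        then obtain S T where S: "x = cls p S" "y = cls p T" "S \<subseteq> {..<n}" "T \<subseteq> {..<n}"
          unfolding p(2) partition_algebra_def by blast
        have "z \<in> Restr (Collect R) A \<longleftrightarrow> R (cls p S, cls p T)" using z S True by auto
        also have "\<dots> \<longleftrightarrow> antilex_less S T" by (rule antilexicographic_partition[OF R p(1) p(7) S(3,4)])
        also have "\<dots> \<longleftrightarrow> z \<in> antilex A xs"
          using antilex_partition[of xs p S T] p S z by simp
        finally show ?thesis .
      qed (auto simp: z antilex_def)
    qed
    ultimately show ?thesis unfolding natural_ordering_def by blast
  qed
  then show ?thesis using lin unfolding NO_def by blast
qed

section \<open>The topology of pointwise convergence\<close>

lemma topspace_pointwise [simp]: "topspace (pointwise_topology S) = S"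
  by (simp add: pointwise_topology_def)

lemma openin_pointwise_eval: "openin (pointwise_topology S) {f \<in> S. f i \<in> U}"
proof -
  have "continuous_map (pointwise_topology S) (discrete_topology UNIV) (\<lambda>f. f i)"
    unfolding pointwise_topology_def
    by (intro continuous_map_from_subtopology continuous_map_product_projection) simp
  then have "openin (pointwise_topology S) {f \<in> topspace (pointwise_topology S). f i \<in> U}"
    by (rule openin_continuous_map_preimage) simp
  then show ?thesis by simp
qed

lemma continuous_map_discrete_iff:
  "continuous_map X (discrete_topology UNIV) f \<longleftrightarrow>
    (\<forall>x\<in>topspace X. \<exists>U. openin X U \<and> x \<in> U \<and> (\<forall>y\<in>U. f y = f x))"
proof
  assume f: "continuous_map X (discrete_topology UNIV) f"
  show "\<forall>x\<in>topspace X. \<exists>U. openin X U \<and> x \<in> U \<and> (\<forall>y\<in>U. f y = f x)"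
  proof
    fix x assume "x \<in> topspace X"
    then show "\<exists>U. openin X U \<and> x \<in> U \<and> (\<forall>y\<in>U. f y = f x)"
      using openin_continuous_map_preimage[OF f, of "{f x}"] by (intro exI[of _ "{y \<in> topspace X. f y \<in> {f x}}"]) simp
  qed
next
  assume *: "\<forall>x\<in>topspace X. \<exists>U. openin X U \<and> x \<in> U \<and> (\<forall>y\<in>U. f y = f x)"
  have "openin X {x \<in> topspace X. f x \<in> V}" for V
  proof (subst openin_subopen, rule ballI)
    fix x assume x: "x \<in> {x \<in> topspace X. f x \<in> V}"
    then obtain U where U: "openin X U" "x \<in> U" "\<forall>y\<in>U. f y = f x" using * by blast
    have "U \<subseteq> {x \<in> topspace X. f x \<in> V}"
    proof
      fix y assume y: "y \<in> U"
      then have "f y = f x" using U(3) by blast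
      then show "y \<in> {x \<in> topspace X. f x \<in> V}" using x y openin_subset[OF U(1)] by auto
    qed
    then show "\<exists>T. openin X T \<and> x \<in> T \<and> T \<subseteq> {x \<in> topspace X. f x \<in> V}" using U by blast
  qed
  then show "continuous_map X (discrete_topology UNIV) f"
    unfolding continuous_map_def by (simp only: topspace_discrete_topology) simp
qed

lemma continuous_map_pointwise_iff:
  "continuous_map X (pointwise_topology S) f \<longleftrightarrow> f \<in> topspace X \<rightarrow> S \<and>
    (\<forall>i. \<forall>x\<in>topspace X. \<exists>U. openin X U \<and> x \<in> U \<and> (\<forall>y\<in>U. f y i = f x i))"
  unfolding pointwise_topology_def continuous_map_in_subtopology continuous_map_componentwise_UNIV
    continuous_map_discrete_iff by (rule conj_commute)

lemma openin_finite_agreement: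
  assumes "finite I"
  shows "openin (pointwise_topology S) {f \<in> S. \<forall>i\<in>I. f i = g i}"
  using assms
proof (induction I rule: finite_induct)
  case empty
  then show ?case using openin_topspace[of "pointwise_topology S"] by simp
next
  case (insert i I)
  have "{f \<in> S. \<forall>j\<in>insert i I. f j = g j} = {f \<in> S. f i \<in> {g i}} \<inter> {f \<in> S. \<forall>j\<in>I. f j = g j}" by auto
  then show ?case using openin_Int[OF openin_pointwise_eval insert.IH] by (simp only:)
qed

text \<open>Basic neighbourhoods prescribe finitely many values.\<close>

lemma pointwise_nbhd:
  assumes "openin (pointwise_topology S) U" "g \<in> U"
  shows "\<exists>I. finite I \<and> {f \<in> S. \<forall>i\<in>I. f i = g i} \<subseteq> U"
proof -
  obtain V where V: "openin (product_topology (\<lambda>_. discrete_topology UNIV) UNIV) V" "U = V \<inter> S"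
    using assms(1) unfolding pointwise_topology_def openin_subtopology by blast
  then have "g \<in> V" using assms(2) by blast
  then obtain W where W: "finite {i. W i \<noteq> UNIV}" "g \<in> PiE UNIV W" "PiE UNIV W \<subseteq> V"
    using V(1) unfolding openin_product_topology_alt by auto
  have "{f \<in> S. \<forall>i\<in>{i. W i \<noteq> UNIV}. f i = g i} \<subseteq> U"
  proof
    fix f assume f: "f \<in> {f \<in> S. \<forall>i\<in>{i. W i \<noteq> UNIV}. f i = g i}"
    have "f i \<in> W i" for i
      using f W(2) by (cases "W i = UNIV") (auto simp: PiE_def Pi_def)
    then have "f \<in> PiE UNIV W" by (simp add: PiE_def)
    then show "f \<in> U" using W(3) V(2) f by blast
  qed
  then show ?thesis using W(1) by blast
qed

lemma closedin_finitely_determined: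
  assumes I: "finite I" and Q: "\<And>f g. (\<And>i. i \<in> I \<Longrightarrow> f i = g i) \<Longrightarrow> Q f \<Longrightarrow> Q g"
  shows "closedin (pointwise_topology UNIV) {f. Q f}"
proof -
  have "openin (pointwise_topology UNIV) {f. \<not> Q f}"
  proof (subst openin_subopen, rule ballI)
    fix f assume f: "f \<in> {f. \<not> Q f}"
    let ?T = "{g \<in> UNIV. \<forall>i\<in>I. g i = f i}"
    have "?T \<subseteq> {f. \<not> Q f}"
    proof (rule subsetI, rule CollectI, rule notI)
      fix g assume g: "g \<in> ?T" "Q g"
      have "Q f" by (rule Q[OF _ g(2)]) (use g(1) in simp)
      then show False using f by simp
    qed
    then show "\<exists>T. openin (pointwise_topology UNIV) T \<and> f \<in> T \<and> T \<subseteq> {f. \<not> Q f}"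
      using openin_finite_agreement[OF I, of UNIV f] by (intro exI[of _ ?T]) simp
  qed
  moreover have "{f. Q f} = UNIV - {f. \<not> Q f}" by blast
  ultimately show ?thesis by (metis closedin_def topspace_pointwise double_diff subset_UNIV Diff_Diff_Int inf_top_left)
qed

lemma compact_pointwise: "compact_space (pointwise_topology (UNIV :: ('i \<Rightarrow> bool) set))"
  by (simp add: pointwise_topology_def compact_space_product_topology compact_space_discrete_topology)

lemma Hausdorff_pointwise: "Hausdorff_space (pointwise_topology S)"
  unfolding pointwise_topology_def
  by (intro Hausdorff_space_subtopology) (simp add: Hausdorff_space_product_topology)

lemma pointwise_subtopology: "pointwise_topology S = subtopology (pointwise_topology UNIV) S"
  by (simp add: pointwise_topology_def)

section \<open>The group of automorphisms\<close>

lemma aut_group_simps [simp]: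
  "carrier aut_group = {f. boolean_iso f}" "mult aut_group = (\<circ>)" "one aut_group = id"
  by (simp_all add: aut_group_def)

lemma boolean_iso_id: "boolean_iso id"
  by (simp add: boolean_iso_def)

lemma inv_comp:
  fixes f :: "'a::boolean_algebra \<Rightarrow> 'a"
  assumes "boolean_iso f"
  shows "inv_into UNIV f \<circ> f = id" "f \<circ> inv_into UNIV f = id" "f (inv_into UNIV f x) = x" "inv_into UNIV f (f x) = x"
    "inv_into UNIV f x = y \<longleftrightarrow> x = f y"
  using boolean_isoD(1)[OF assms]
  by (auto simp: bij_is_inj bij_is_surj fun_eq_iff surj_f_inv_f)

lemma group_aut: "group (aut_group :: ('a::boolean_algebra \<Rightarrow> 'a) monoid)"
proof (rule groupI)
  fix f :: "'a \<Rightarrow> 'a" assume "f \<in> carrier aut_group"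
  then show "\<exists>g\<in>carrier aut_group. g \<otimes>\<^bsub>aut_group\<^esub> f = \<one>\<^bsub>aut_group\<^esub>"
    using boolean_iso_inv inv_comp(1) by (intro bexI[of _ "inv_into UNIV f"]) auto
qed (auto simp: boolean_iso_comp boolean_iso_id comp_assoc)

lemma inv_aut:
  assumes "boolean_iso f"
  shows "inv\<^bsub>aut_group\<^esub> f = inv_into UNIV f"
  using group.inv_equality[OF group_aut, of "inv_into UNIV f" f] assms boolean_iso_inv inv_comp(1) by auto

lemma topological_group_aut:
  "topological_group (aut_group :: ('a::boolean_algebra \<Rightarrow> 'a) monoid) (pointwise_topology (carrier aut_group))"
proof -
  let ?C = "carrier (aut_group :: ('a \<Rightarrow> 'a) monoid)"
  let ?T = "pointwise_topology ?C"
  have "continuous_map (prod_topology ?T ?T) ?T (\<lambda>(g, h). g \<circ> h)"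
    unfolding continuous_map_pointwise_iff
  proof (intro conjI allI ballI)
    show "(\<lambda>(g, h). g \<circ> h) \<in> topspace (prod_topology ?T ?T) \<rightarrow> ?C"
      by (auto simp: boolean_iso_comp)
    fix i :: 'a and gh assume "gh \<in> topspace (prod_topology ?T ?T)"
    then obtain g h where gh: "gh = (g, h)" "g \<in> ?C" "h \<in> ?C" by auto
    let ?U = "{g' \<in> ?C. g' (h i) \<in> {g (h i)}} \<times> {h' \<in> ?C. h' i \<in> {h i}}"
    have "openin (prod_topology ?T ?T) ?U"
      unfolding openin_prod_Times_iff by (intro disjI2 conjI openin_pointwise_eval)
    then show "\<exists>U. openin (prod_topology ?T ?T) U \<and> gh \<in> U \<and>
        (\<forall>y\<in>U. (case y of (g, h) \<Rightarrow> g \<circ> h) i = (case gh of (g, h) \<Rightarrow> g \<circ> h) i)"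
      using gh by (intro exI[of _ ?U]) auto
  qed
  moreover have "continuous_map ?T ?T (\<lambda>g. inv\<^bsub>aut_group\<^esub> g)"
    unfolding continuous_map_pointwise_iff
  proof (intro conjI allI ballI)
    show "(\<lambda>g. inv\<^bsub>aut_group\<^esub> g) \<in> topspace ?T \<rightarrow> ?C"
      by (auto simp: inv_aut boolean_iso_inv)
    fix i :: 'a and g assume "g \<in> topspace ?T"
    then have g: "boolean_iso g" by simp
    let ?j = "inv_into UNIV g i"
    have "(inv\<^bsub>aut_group\<^esub> h) i = (inv\<^bsub>aut_group\<^esub> g) i" if "h \<in> {h \<in> ?C. h ?j \<in> {i}}" for h
    proof -
      have h: "boolean_iso h" "h ?j = i" using that by auto
      then have "inv_into UNIV h i = ?j" by (simp add: inv_comp(5)[OF h(1)])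
      then show ?thesis by (simp add: inv_aut[OF h(1)] inv_aut[OF g])
    qed
    then have "\<forall>h\<in>{h \<in> ?C. h ?j \<in> {i}}. (inv\<^bsub>aut_group\<^esub> h) i = (inv\<^bsub>aut_group\<^esub> g) i"
      by (rule ballI)
    moreover have "g \<in> {h \<in> ?C. h ?j \<in> {i}}" using g inv_comp(3)[OF g] by simp
    ultimately show "\<exists>U. openin ?T U \<and> g \<in> U \<and> (\<forall>h\<in>U. (inv\<^bsub>aut_group\<^esub> h) i = (inv\<^bsub>aut_group\<^esub> g) i)"
      by (intro exI[of _ "{h \<in> ?C. h ?j \<in> {i}}"] conjI openin_pointwise_eval)
  qed
  ultimately show ?thesis
    unfolding topological_group_def using group_aut by (simp only: topspace_pointwise aut_group_simps(2) simp_thms)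
qed

section \<open>The space of natural orderings\<close>

lemma infinite_omega1: "infinite (UNIV :: omega1 set)"
  using uncountable_omega1 countable_finite by blast

lemma NO_iff_antilexicographic:
  "R \<in> NO (countable_classes :: omega1 pfin set) \<longleftrightarrow> antilexicographic countable_classes R"
  using NO_imp_antilexicographic antilexicographic_imp_NO infinite_omega1 by blast

lemma antilexicographic_on_mono:
  assumes R: "antilexicographic_on A P R" and BA: "B \<subseteq> A"
  shows "antilexicographic_on B P R"
proof (rule antilexicographic_onI)
  note D = antilexicographic_onD[OF R]
  fix x assume "x \<in> B"
  then have x: "x \<in> A" using BA by blast
  show "\<not> R (x, x)" by (rule D(1)[OF x])
  show "R (bot, x)" if "x \<noteq> bot" by (rule D(8)[OF x that])
  fix y assume "y \<in> B"
  then have y: "y \<in> A" using BA by blast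
  show "R (x, y) \<or> R (y, x)" if "x \<noteq> y" by (rule D(3)[OF x y that])
  show "R (x, y) \<longleftrightarrow> R (x - y, y - x)" by (rule D(4)[OF x y])
  show "R (x, y)" if "x \<in> P" "y \<notin> P" by (rule D(7)[OF x y that])
  fix z assume "z \<in> B"
  then have z: "z \<in> A" using BA by blast
  show "R (x, z)" if "R (x, y)" "R (y, z)" by (rule D(2)[OF x y z that])
  show "R (sup x y, z)" if "R (x, z)" "R (y, z)" "inf x z = bot" "inf y z = bot" by (rule D(5)[OF x y z that])
  show "R (x, z)" if "R (x, y)" "y \<le> z" "inf x z = bot" by (rule D(6)[OF x y z that])
qed

lemma antilexicographic_on_cong:
  assumes A: "finite_subalgebra A" and eq: "\<And>i. i \<in> A \<times> A \<Longrightarrow> R i = R' i"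
    and R: "antilexicographic_on A P R"
  shows "antilexicographic_on A P R'"
proof -
  have A': "bot \<in> A" "x \<in> A \<Longrightarrow> y \<in> A \<Longrightarrow> sup x y \<in> A" "x \<in> A \<Longrightarrow> y \<in> A \<Longrightarrow> x - y \<in> A" for x y
    using A by (auto simp: finite_subalgebra_def diff_eq)
  have e: "R' (x, y) = R (x, y)" if "x \<in> A" "y \<in> A" for x y using eq[of "(x, y)"] that by simp
  note D = antilexicographic_onD[OF R]
  show ?thesis
  proof (rule antilexicographic_onI)
    fix x assume x: "x \<in> A"
    show "\<not> R' (x, x)" using D(1) x e by simp
    show "R' (bot, x)" if "x \<noteq> bot" using D(8) x e A' that by simp
    fix y assume y: "y \<in> A"
    show "R' (x, y) \<or> R' (y, x)" if "x \<noteq> y" using D(3) x y e that by simp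
    show "R' (x, y) \<longleftrightarrow> R' (x - y, y - x)" using D(4)[OF x y] x y e A' by simp
    show "R' (x, y)" if "x \<in> P" "y \<notin> P" using D(7)[OF x y that] x y e by simp
    fix z assume z: "z \<in> A"
    show "R' (x, z)" if "R' (x, y)" "R' (y, z)" using D(2)[OF x y z] x y z e that by simp
    show "R' (sup x y, z)" if "R' (x, z)" "R' (y, z)" "inf x z = bot" "inf y z = bot"
      using D(5)[OF x y z] x y z e that A' by simp
    show "R' (x, z)" if "R' (x, y)" "y \<le> z" "inf x z = bot" using D(6)[OF x y z] x y z e that by simp
  qed
qed

text \<open>Any enumeration of the atoms that starts with those in the ideal gives such an ordering.\<close>

lemma ex_antilexicographic_on:
  fixes A :: "'a pfin set"
  assumes inf: "infinite (UNIV :: 'a set)" and A: "finite_subalgebra A"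
  shows "\<exists>R. antilexicographic_on A countable_classes R"
proof -
  let ?P = "countable_classes :: 'a pfin set"
  have "finite (atoms A)" using A by (auto simp: finite_subalgebra_def atoms_def)
  then obtain ys where ys: "distinct ys" "set ys = atoms A" using finite_distinct_list by metis
  let ?xs1 = "filter (\<lambda>a. a \<in> ?P) ys" and ?xs2 = "filter (\<lambda>a. a \<notin> ?P) ys"
  let ?xs = "?xs1 @ ?xs2"
  have xs: "distinct ?xs" "set ?xs = atoms A" using ys by auto
  obtain p where p: "partition_fun (length ?xs) p" "\<forall>i<length ?xs. ?xs ! i = cls p {i}" "A = partition_algebra (length ?xs) p"
    using subalgebra_is_partition[OF inf A xs] by blast
  have P: "cls p {i} \<in> ?P \<longleftrightarrow> i < length ?xs1" if i: "i < length ?xs" for i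
  proof (cases "i < length ?xs1")
    case True
    then have "?xs ! i \<in> set ?xs1" by (metis nth_append nth_mem)
    then show ?thesis using True p(2) i by auto
  next
    case False
    then have "?xs ! i \<in> set ?xs2" using i by (auto simp: nth_append simp del: set_filter)
    then show ?thesis using False p(2) i by auto
  qed
  define R where "R = (\<lambda>z. z \<in> antilex A ?xs)"
  have "antilexicographic_on (partition_algebra (length ?xs) p) ?P R"
  proof (rule antilexicographic_on_partition[OF p(1)])
    fix i j assume "i < length ?xs" "j < length ?xs" "cls p {i} \<in> ?P" "cls p {j} \<notin> ?P"
    then show "i < j" using P[of i] P[of j] by linarith
  next
    fix S T assume "S \<subseteq> {..<length ?xs}" "T \<subseteq> {..<length ?xs}"
    then show "R (cls p S, cls p T) = antilex_less S T"
      unfolding R_def p(3) using p(2) by (intro antilex_partition[OF p(1)]) auto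
  qed
  then show ?thesis unfolding p(3)[symmetric] by blast
qed

lemma NO_eq_Inter:
  "NO (countable_classes :: omega1 pfin set) =
    (\<Inter>A\<in>{A. finite_subalgebra A}. {R. antilexicographic_on A countable_classes R})"
proof (rule Set.set_eqI)
  fix R :: "omega1 pfin \<times> omega1 pfin \<Rightarrow> bool"
  show "R \<in> NO countable_classes \<longleftrightarrow> R \<in> (\<Inter>A\<in>{A. finite_subalgebra A}. {R. antilexicographic_on A countable_classes R})"
  proof
    assume "R \<in> NO countable_classes"
    then have R: "antilexicographic countable_classes R" by (simp only: NO_iff_antilexicographic)
    show "R \<in> (\<Inter>A\<in>{A. finite_subalgebra A}. {R. antilexicographic_on A countable_classes R})"
      by (intro INT_I CollectI antilexicographic_on_mono[OF R] subset_UNIV)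
  next
    assume R: "R \<in> (\<Inter>A\<in>{A. finite_subalgebra A}. {R. antilexicographic_on A countable_classes R})"
    have "antilexicographic countable_classes R"
      by (rule antilexicographic_local) (use R in blast)
    then show "R \<in> NO countable_classes" by (simp only: NO_iff_antilexicographic)
  qed
qed

lemma ex_finite_subalgebra: "\<exists>A :: 'a pfin set. finite_subalgebra A"
  using finite_subset_of_subalgebra[of "{}"] by blast

lemma closedin_antilexicographic_on:
  fixes A :: "'a::boolean_algebra set"
  assumes "finite_subalgebra A"
  shows "closedin (pointwise_topology UNIV) {R. antilexicographic_on A P R}"
proof (rule closedin_finitely_determined)
  show "finite (A \<times> A)" using assms by (simp add: finite_subalgebra_def)
  fix f g assume "\<And>i. i \<in> A \<times> A \<Longrightarrow> f i = g i" "antilexicographic_on A P f"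
  then show "antilexicographic_on A P g" by (rule antilexicographic_on_cong[OF assms])
qed

lemma closedin_NO: "closedin (pointwise_topology UNIV) (NO (countable_classes :: omega1 pfin set))"
  unfolding NO_eq_Inter
  by (rule closedin_INT) (use ex_finite_subalgebra closedin_antilexicographic_on in auto)

lemma compact_NO: "compact_space (pointwise_topology (NO (countable_classes :: omega1 pfin set)))"
  unfolding pointwise_subtopology[of "NO _"]
  by (rule compact_space_subtopology[OF closedin_compact_space[OF compact_pointwise closedin_NO]])

lemma compact_space_indexed_fip:
  assumes X: "compact_space X" and K: "\<And>i. i \<in> I \<Longrightarrow> closedin X (K i)"
    and fip: "\<And>J. finite J \<Longrightarrow> J \<subseteq> I \<Longrightarrow> \<exists>x\<in>topspace X. \<forall>i\<in>J. x \<in> K i"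
  shows "\<exists>x\<in>topspace X. \<forall>i\<in>I. x \<in> K i"
proof -
  have "compactin X (topspace X)" using X by (simp add: compact_space_def)
  then have "topspace X \<inter> \<Inter>\<U> \<noteq> {}"
    if "\<forall>C\<in>\<U>. closedin X C" "\<forall>\<F>. finite \<F> \<and> \<F> \<subseteq> \<U> \<longrightarrow> topspace X \<inter> \<Inter>\<F> \<noteq> {}" for \<U>
    using that unfolding compactin_fip by simp
  moreover have "\<forall>C\<in>K ` I. closedin X C" using K by simp
  moreover have "\<forall>\<F>. finite \<F> \<and> \<F> \<subseteq> K ` I \<longrightarrow> topspace X \<inter> \<Inter>\<F> \<noteq> {}"
  proof (intro allI impI)
    fix \<F> assume "finite \<F> \<and> \<F> \<subseteq> K ` I"
    then obtain J where J: "J \<subseteq> I" "finite J" "\<F> = K ` J" using finite_subset_image[of \<F> K I] by auto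
    obtain x where "x \<in> topspace X" "\<forall>i\<in>J. x \<in> K i" using fip[OF J(2,1)] by blast
    then have "x \<in> topspace X \<inter> \<Inter>\<F>" using J(3) by simp
    then show "topspace X \<inter> \<Inter>\<F> \<noteq> {}" by blast
  qed
  ultimately have "topspace X \<inter> \<Inter>(K ` I) \<noteq> {}" by simp
  then show ?thesis by auto
qed

text \<open>A finite family of finite subalgebras is contained in one finite subalgebra, so the closed
sets of orderings that are natural on one finite subalgebra have the finite intersection property.\<close>

lemma NO_nonempty: "NO (countable_classes :: omega1 pfin set) \<noteq> {}"
proof -
  let ?K = "\<lambda>A :: omega1 pfin set. {R. antilexicographic_on A countable_classes R}"
  have "\<exists>R\<in>topspace (pointwise_topology UNIV). \<forall>A\<in>{A. finite_subalgebra A}. R \<in> ?K A"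
  proof (rule compact_space_indexed_fip[OF compact_pointwise])
    show "closedin (pointwise_topology UNIV) (?K A)" if "A \<in> {A. finite_subalgebra A}" for A
      using that closedin_antilexicographic_on by simp
  next
    fix \<A> :: "omega1 pfin set set" assume \<A>: "finite \<A>" "\<A> \<subseteq> {A. finite_subalgebra A}"
    have "finite (\<Union>\<A>)" using \<A> by (auto simp: finite_subalgebra_def)
    from finite_subset_of_subalgebra[OF this]
    obtain A where A: "finite_subalgebra A" "\<Union>\<A> \<subseteq> A" by (elim exE conjE)
    obtain R where R: "antilexicographic_on A countable_classes R"
      using ex_antilexicographic_on[OF infinite_omega1 A(1)] by (elim exE)
    have "R \<in> ?K B" if "B \<in> \<A>" for B
      using antilexicographic_on_mono[OF R, of B] that A(2) by (simp add: Sup_le_iff)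
    then show "\<exists>R\<in>topspace (pointwise_topology UNIV). \<forall>A\<in>\<A>. R \<in> ?K A"
      by (intro bexI[of _ R] ballI) simp_all
  qed
  then show ?thesis unfolding NO_eq_Inter by auto
qed

text \<open>The pullback along \<open>h\<close> is the translate of the ordering by the inverse of \<open>h\<close>.\<close>

definition pullback :: "('a \<Rightarrow> 'a) \<Rightarrow> ('a \<times> 'a \<Rightarrow> bool) \<Rightarrow> ('a \<times> 'a \<Rightarrow> bool)"
  where "pullback h R = (\<lambda>(a, b). R (h a, h b))"

lemma pullback_simp [simp]: "pullback h R (a, b) = R (h a, h b)"
  by (simp add: pullback_def)

lemma antilexicographic_pullback:
  assumes h: "boolean_iso h" and P: "\<And>a. h a \<in> P \<longleftrightarrow> a \<in> P" and R: "antilexicographic P R"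
  shows "antilexicographic P (pullback h R)"
proof -
  note D = antilexicographic_onD[OF R UNIV_I]
  note hD = boolean_isoD[OF h] boolean_iso_diff[OF h] boolean_iso_le[OF h] boolean_iso_inj[OF h]
  have bot: "h x = bot \<longleftrightarrow> x = bot" for x using hD(5) boolean_iso_inj[OF h] by metis
  have disj: "inf (h x) (h z) = bot" if "inf x z = bot" for x z using that hD(2,5) by metis
  show ?thesis
  proof (rule antilexicographic_onI)
    fix x y z
    show "\<not> pullback h R (x, x)" using D(1) by simp
    show "pullback h R (x, z)" if "pullback h R (x, y)" "pullback h R (y, z)"
      using D(2)[OF UNIV_I UNIV_I] that by simp
    show "pullback h R (x, y) \<or> pullback h R (y, x)" if "x \<noteq> y"
      using D(3)[OF UNIV_I] that boolean_iso_inj[OF h] by simp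
    show "pullback h R (x, y) \<longleftrightarrow> pullback h R (x - y, y - x)"
      using D(4)[OF UNIV_I, of "h x" "h y"] by (simp add: boolean_iso_diff[OF h])
    show "pullback h R (sup x y, z)" if "pullback h R (x, z)" "pullback h R (y, z)" "inf x z = bot" "inf y z = bot"
      using D(5)[OF UNIV_I UNIV_I, of "h x" "h z" "h y"] that by (simp add: hD(3) disj)
    show "pullback h R (x, z)" if "pullback h R (x, y)" "y \<le> z" "inf x z = bot"
      using D(6)[OF UNIV_I UNIV_I, of "h x" "h y" "h z"] that by (simp add: boolean_iso_le[OF h] disj)
    show "pullback h R (x, y)" if "x \<in> P" "y \<notin> P"
      using D(7)[OF UNIV_I, of "h x" "h y"] that P by simp
    show "pullback h R (bot, x)" if "x \<noteq> bot"
      using D(8)[of "h x"] that bot by (simp add: hD(5))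
  qed
qed

section \<open>Embeddings of finite subalgebras as words\<close>

text \<open>A parameter \<open>b\<close> must not occur before a smaller parameter has occurred.\<close>

lemma param_wordI:
  assumes "c \<le> k" "\<And>j. j < length w \<Longrightarrow> w ! j < k" "\<And>a. c \<le> a \<Longrightarrow> a < k \<Longrightarrow> a \<in> set w"
    "\<And>a b j. c \<le> a \<Longrightarrow> a < b \<Longrightarrow> b < k \<Longrightarrow> j < length w \<Longrightarrow> w ! j = b \<Longrightarrow> \<exists>i<j. w ! i = a"
  shows "param_word c w k"
  using assms
proof (induction w arbitrary: c)
  case Nil
  then show ?case by (metis empty_iff list.set(1) nat_less_le order_refl param_word.simps(1))
next
  case (Cons x w)
  have x: "x < k" using Cons.prems(2)[of 0] by simp
  have "x \<le> c"
  proof (rule ccontr)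
    assume "\<not> x \<le> c"
    then show False using Cons.prems(4)[of c x 0] x by simp
  qed
  have letters: "w ! j < k" if "j < length w" for j using Cons.prems(2)[of "Suc j"] that by simp
  have order: "\<exists>i<j. w ! i = a" if h: "c' \<le> a" "a < b" "b < k" "j < length w" "w ! j = b" "c \<le> c'" "x < c'" for a b j c'
  proof -
    obtain i where i: "i < Suc j" "(x # w) ! i = a"
      using Cons.prems(4)[of a b "Suc j"] h by auto
    then obtain i' where "i = Suc i'" using h by (cases i) auto
    then show ?thesis using i by auto
  qed
  show ?case
  proof (cases "x < c")
    case True
    have "param_word c w k"
    proof (rule Cons.IH[OF Cons.prems(1) letters])
      show "a \<in> set w" if "c \<le> a" "a < k" for a using Cons.prems(3)[OF that] that True by auto
      show "\<exists>i<j. w ! i = a" if "c \<le> a" "a < b" "b < k" "j < length w" "w ! j = b" for a b j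
        using order[OF that] True by simp
    qed
    then show ?thesis using True by simp
  next
    case False
    then have xc: "x = c" using \<open>x \<le> c\<close> by simp
    have "param_word (Suc c) w k"
    proof (rule Cons.IH[OF _ letters])
      show "Suc c \<le> k" using x xc by simp
      show "a \<in> set w" if "Suc c \<le> a" "a < k" for a using Cons.prems(3)[of a] that xc by auto
      show "\<exists>i<j. w ! i = a" if "Suc c \<le> a" "a < b" "b < k" "j < length w" "w ! j = b" for a b j
        using order[OF that] xc by simp
    qed
    then show ?thesis using xc by simp
  qed
qed

lemma typed_word_facts:
  assumes w: "typed_word N1 N n1 n w" and le: "N1 \<le> N"
  shows "length w = N" "n1 \<le> n" "\<And>j. j < N \<Longrightarrow> w ! j < n" "\<And>j. j < N1 \<Longrightarrow> w ! j < n1"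
    "\<And>i. i < n1 \<Longrightarrow> \<exists>j<N1. w ! j = i" "\<And>i. i < n \<Longrightarrow> \<exists>j<N. w ! j = i"
proof -
  obtain w1 w2 where *: "w = w1 @ w2" "length w1 = N1" "length w2 = N - N1" "param_word 0 w1 n1" "param_word n1 w2 n"
    using typed_word_split[OF w le] .
  show len: "length w = N" using * le by simp
  show n: "n1 \<le> n" using param_word_le[OF *(5)] .
  show "w ! j < n" if "j < N" for j
    using typed_word_set[OF w n le] that len nth_mem by fastforce
  show "w ! j < n1" if "j < N1" for j
  proof -
    have "w1 ! j \<in> set w1" using that *(2) by simp
    then have "w1 ! j < n1" using param_word_set[OF *(4)] by auto
    then show ?thesis using that *(1,2) by (simp add: nth_append)
  qed
  have 1: "\<exists>j<N1. w ! j = i" if "i < n1" for i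
  proof -
    have "i \<in> set w1" using param_word_onto[OF *(4)] that by auto
    then show ?thesis using *(1,2) by (auto simp: in_set_conv_nth nth_append)
  qed
  then show "\<exists>j<N1. w ! j = i" if "i < n1" for i using that .
  show "\<exists>j<N. w ! j = i" if "i < n" for i
  proof (cases "i < n1")
    case True
    then show ?thesis using 1 le by (meson less_le_trans)
  next
    case False
    then have "i \<in> set w2" using param_word_onto[OF *(5)] that by auto
    then show ?thesis using *(1) len by (metis in_set_conv_nth Un_iff set_append)
  qed
qed

text \<open>Pieces are numbered from the largest one downwards: the largest piece on which two elements differ
then has the least index, and words are read from the left.\<close>

definition decreasing_partition :: "('a pfin \<times> 'a pfin \<Rightarrow> bool) \<Rightarrow> nat \<Rightarrow> ('a \<Rightarrow> nat) \<Rightarrow> bool"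
  where "decreasing_partition R n p \<longleftrightarrow> partition_fun n p \<and> (\<forall>i j. i < j \<longrightarrow> j < n \<longrightarrow> R (cls p {j}, cls p {i}))"

lemma decreasing_partition_of_subalgebra:
  fixes A :: "'a pfin set" and R :: "'a pfin \<times> 'a pfin \<Rightarrow> bool"
  assumes inf: "infinite (UNIV :: 'a set)" and A: "finite_subalgebra A" and lin: "strict_linear_order (Collect R)"
  shows "\<exists>n p. decreasing_partition R n p \<and> A = partition_algebra n p"
proof -
  have "strict_linear_order (Collect (\<lambda>(a, b). R (b, a)))"
    using lin unfolding strict_linear_order_on_def irrefl_def trans_def total_on_def
    by (auto 0 4)
  from partition_refining[OF inf A this] show ?thesis
    unfolding decreasing_partition_def by auto
qed

text \<open>The number of pieces outside the ideal; in a decreasing partition they are the first ones.\<close>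

definition big_count :: "nat \<Rightarrow> ('a \<Rightarrow> nat) \<Rightarrow> nat"
  where "big_count n p = card {i. i < n \<and> cls p {i} \<notin> countable_classes}"

lemma big_count:
  fixes p :: "omega1 \<Rightarrow> nat"
  assumes R: "antilexicographic countable_classes R" and p: "decreasing_partition R n p"
  shows "\<And>i. i < n \<Longrightarrow> cls p {i} \<notin> countable_classes \<longleftrightarrow> i < big_count n p" "0 < big_count n p" "big_count n p \<le> n"
proof -
  let ?P = "countable_classes :: omega1 pfin set"
  let ?I = "{i. i < n \<and> cls p {i} \<notin> ?P}"
  have pf: "partition_fun n p" and dec: "\<And>i j. i < j \<Longrightarrow> j < n \<Longrightarrow> R (cls p {j}, cls p {i})"
    using p by (auto simp: decreasing_partition_def)
  have down: "j \<in> ?I" if "i \<in> ?I" "j < i" for i j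
  proof -
    have "R (cls p {i}, cls p {j})" using dec that by simp
    then have "\<not> R (cls p {j}, cls p {i})" by (rule strict_linear_orderD(2)[OF antilexicographic_linear[OF R]])
    then have "cls p {j} \<notin> ?P" using antilexicographic_onD(7)[OF R UNIV_I UNIV_I] that by blast
    then show ?thesis using that by simp
  qed
  have fin: "finite ?I" by simp
  show I: "cls p {i} \<notin> ?P \<longleftrightarrow> i < big_count n p" if i: "i < n" for i
  proof
    assume "cls p {i} \<notin> ?P"
    then have "{..i} \<subseteq> ?I" using down[of i] i by (auto simp: le_less)
    then show "i < big_count n p" unfolding big_count_def using card_mono[OF fin, of "{..i}"] by simp
  next
    assume lt: "i < big_count n p"
    show "cls p {i} \<notin> ?P"
    proof
      assume "cls p {i} \<in> ?P"
      then have "?I \<subseteq> {..<i}" using down[of _ i] i by (metis (no_types, lifting) CollectD lessThan_iff linorder_neqE_nat subsetI)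
      then have "card ?I \<le> i" using card_mono[of "{..<i}" ?I] by simp
      then show False using lt by (simp add: big_count_def)
    qed
  qed
  have "Orderings.top \<notin> ?P"
    using uncountable_omega1 by (simp add: top_pfin_def abs_pfin_countable_iff)
  moreover have "cls p {..<n} = Orderings.top"
    using cls_restrict[OF pf, of UNIV] by simp
  ultimately obtain i where "i < n" "cls p {i} \<notin> ?P"
    using cls_countable_iff[of "{..<n}" p] by auto
  then have "i \<in> ?I" by simp
  then show "0 < big_count n p" unfolding big_count_def using fin by (metis card_gt_0_iff empty_iff)
  show "big_count n p \<le> n" unfolding big_count_def using card_mono[of "{..<n}" ?I] by auto
qed

text \<open>If \<open>S\<close> contained an index below all of \<open>T\<close>, the corresponding piece would exceed the join over \<open>T\<close>.\<close>

lemma decreasing_partition_least: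
  assumes R: "antilexicographic P R" and c: "decreasing_partition R N c"
    and S: "S \<subseteq> {..<N}" "T \<subseteq> {..<N}" "S \<inter> T = {}" and less: "R (cls c S, cls c T)"
  shows "\<exists>m\<in>T. \<forall>i\<in>S. m < i"
proof (rule ccontr)
  assume neg: "\<not> (\<exists>m\<in>T. \<forall>i\<in>S. m < i)"
  have pf: "partition_fun N c" and dec: "\<And>i j. i < j \<Longrightarrow> j < N \<Longrightarrow> R (cls c {j}, cls c {i})"
    using c by (auto simp: decreasing_partition_def)
  note lin = strict_linear_orderD[OF antilexicographic_linear[OF R]]
  have "T \<noteq> {}"
  proof
    assume "T = {}"
    then have "R (cls c S, bot)" using less by simp
    moreover from this have "cls c S \<noteq> bot" using lin(1) by metis
    ultimately show False using antilexicographic_onD(8)[OF R UNIV_I] lin(2) by blast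
  qed
  have fin: "finite T" "finite S" using S finite_subset by blast+
  let ?m = "Min T"
  have m: "?m \<in> T" using fin(1) \<open>T \<noteq> {}\<close> by (rule Min_in)
  then obtain i where i: "i \<in> S" "\<not> ?m < i" using neg by blast
  have iT: "i < t" if "t \<in> T" for t
  proof -
    have "?m \<le> t" using fin(1) that by simp
    moreover have "i \<noteq> t" using i(1) that S(3) by blast
    ultimately show ?thesis using i(2) by simp
  qed
  have iN: "i < N" using i S by auto
  have "cls c {i} \<noteq> bot" using cls_eq_bot_iff[OF pf, of "{i}"] iN by simp
  moreover have "R (cls c {t}, cls c {i})" if "t \<in> T" for t
    using dec[OF iT[OF that]] that S(2) by auto
  moreover have "inf (cls c {t}) (cls c {i}) = bot" if "t \<in> T" for t
    using iT[OF that] by (simp add: cls_simps)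
  ultimately have "R (cls c T, cls c {i})" using antilexicographic_join[OF R fin(1)] by blast
  moreover have "cls c {i} \<le> cls c S" using cls_le_iff[OF pf, of "{i}"] iN i by simp
  moreover have "inf (cls c T) (cls c S) = bot" using S(3) by (simp add: cls_simps Int_commute)
  ultimately have "R (cls c T, cls c S)" by (rule antilexicographic_onD(6)[OF R UNIV_I UNIV_I UNIV_I])
  then show False using less lin(2) by blast
qed

text \<open>The letter at position \<open>j\<close> is the index of the image that contains the piece \<open>j\<close> of \<open>c\<close>. As the pulled back
ordering is decreasing along \<open>p\<close>, the image of \<open>a < b\<close> is larger than that of \<open>b\<close>, so the letter \<open>a\<close> occurs before \<open>b\<close>
does. A piece outside the ideal cannot be contained in the image of an element of the ideal.\<close>

lemma embedding_word:
  fixes c p :: "omega1 \<Rightarrow> nat"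
  assumes R: "antilexicographic countable_classes R" and c: "decreasing_partition R N c"
    and k: "boolean_iso k" and pres: "\<And>a. k a \<in> countable_classes \<longleftrightarrow> a \<in> countable_classes"
    and p: "decreasing_partition (pullback k R) n p"
    and mem: "\<And>i. i < n \<Longrightarrow> k (cls p {i}) \<in> partition_algebra N c"
  shows "\<exists>u. typed_word (big_count N c) N (big_count n p) n u \<and> (\<forall>i<n. k (cls p {i}) = cls (\<lambda>x. u ! c x) {i})"
proof -
  let ?P = "countable_classes :: omega1 pfin set"
  have pc: "partition_fun N c" using c by (simp add: decreasing_partition_def)
  have pp: "partition_fun n p" and dec: "\<And>i j. i < j \<Longrightarrow> j < n \<Longrightarrow> R (k (cls p {j}), k (cls p {i}))"
    using p by (auto simp: decreasing_partition_def)
  note Rk = antilexicographic_pullback[OF k pres R]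
  note bc = big_count[OF R c] and bp = big_count[OF Rk p]
  note kD = boolean_isoD[OF k]
  have "\<forall>i. \<exists>B. i < n \<longrightarrow> B \<subseteq> {..<N} \<and> k (cls p {i}) = cls c B"
    using mem by (auto simp: partition_algebra_def)
  then obtain B where B: "B i \<subseteq> {..<N}" "k (cls p {i}) = cls c (B i)" if "i < n" for i by metis
  have disj: "B i \<inter> B j = {}" if "i < n" "j < n" "i \<noteq> j" for i j
  proof -
    have "cls c (B i \<inter> B j) = inf (k (cls p {i})) (k (cls p {j}))" using B that by (simp add: cls_simps)
    also have "\<dots> = k (inf (cls p {i}) (cls p {j}))" by (simp add: kD(2))
    also have "\<dots> = bot" using that by (simp add: cls_simps kD(5))
    finally show ?thesis using cls_eq_bot_iff[OF pc, of "B i \<inter> B j"] B(1)[OF that(1)] by blast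
  qed
  have cover: "\<exists>i<n. j \<in> B i" if j: "j < N" for j
  proof -
    have un: "k (cls p {..<m}) = cls c (\<Union>i<m. B i)" if "m \<le> n" for m
      using that
    proof (induction m)
      case (Suc m)
      have "cls p {..<Suc m} = sup (cls p {..<m}) (cls p {m})" by (simp add: cls_simps lessThan_Suc)
      then have "k (cls p {..<Suc m}) = sup (cls c (\<Union>i<m. B i)) (cls c (B m))"
        using Suc B(2)[of m] by (simp only: kD(3))
      then show ?case by (simp add: cls_simps lessThan_Suc Un_commute)
    qed (simp add: kD(5))
    have "cls p {..<n} = Orderings.top" using cls_restrict[OF pp, of UNIV] by simp
    then have "cls c (\<Union>i<n. B i) = Orderings.top" using un[of n] kD(6) by simp
    then have "cls c {j} \<le> cls c (\<Union>i<n. B i)" by simp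
    then show ?thesis using cls_le_iff[OF pc, of "{j}" "\<Union>i<n. B i"] j by auto
  qed
  then obtain v where v: "v j < n" "j \<in> B (v j)" if "j < N" for j by metis
  have vB: "v j = i \<longleftrightarrow> j \<in> B i" if "j < N" "i < n" for i j
    using v[OF that(1)] disj[of "v j" i] that by blast
  define u where "u = map v [0..<N]"
  have u: "length u = N" "u ! j = v j" if "j < N" for j using that by (auto simp: u_def)
  have lu: "length u = N" by (simp add: u_def)
  have Bne: "B i \<noteq> {}" if "i < n" for i
  proof
    assume "B i = {}"
    then have "k (cls p {i}) = k bot" using B[OF that] kD(5) by simp
    then have "cls p {i} = bot" using boolean_iso_inj[OF k] by blast
    then show False using cls_eq_bot_iff[OF pp, of "{i}"] that by simp
  qed
  have first: "\<exists>m\<in>B a. \<forall>i\<in>B b. m < i" if "a < b" "b < n" for a b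
    by (rule decreasing_partition_least[OF R c]) (use B disj[of b a] that dec[OF that] in auto)
  have type: "cls p {i} \<in> ?P \<longleftrightarrow> (\<forall>j\<in>B i. cls c {j} \<in> ?P)" if "i < n" for i
    using cls_countable_iff[of "B i" c] B[OF that] pres[of "cls p {i}"] finite_subset[OF B(1)[OF that]] by simp
  let ?N1 = "big_count N c" and ?n1 = "big_count n p"
  have small: "?N1 \<le> j" if "j \<in> B i" "i < n" "?n1 \<le> i" for i j
  proof -
    have "j < N" using B(1)[OF that(2)] that(1) by auto
    moreover have "cls p {i} \<in> ?P" using bp(1)[OF that(2)] that(3) by auto
    ultimately show ?thesis using type[OF that(2)] that(1) bc(1)[of j] by auto
  qed
  have 1: "param_word 0 (take ?N1 u) ?n1"
  proof (rule param_wordI)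
    show "take ?N1 u ! j < ?n1" if "j < length (take ?N1 u)" for j
    proof (rule ccontr)
      assume "\<not> take ?N1 u ! j < ?n1"
      moreover have "j < N" "j < ?N1" using that lu by auto
      ultimately show False using small[of j "v j"] v[of j] u(2)[of j] by auto
    qed
    show "a \<in> set (take ?N1 u)" if a: "0 \<le> a" "a < ?n1" for a
    proof -
      have "a < n" using a bp(3) by simp
      then have "cls p {a} \<notin> ?P" using bp(1) a by simp
      then obtain j where j: "j \<in> B a" "cls c {j} \<notin> ?P" using type[OF \<open>a < n\<close>] by blast
      have jN: "j < N" using j(1) B(1)[OF \<open>a < n\<close>] by auto
      have "j < ?N1" using bc(1)[OF jN] j(2) by simp
      moreover have "u ! j = a" using u(2)[OF jN] vB[OF jN \<open>a < n\<close>] j(1) by simp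
      ultimately show ?thesis using lu jN by (auto simp: in_set_conv_nth intro!: exI[of _ j])
    qed
    show "\<exists>i<j. take ?N1 u ! i = a"
      if h: "0 \<le> a" "a < b" "b < ?n1" "j < length (take ?N1 u)" "take ?N1 u ! j = b" for a b j
    proof -
      have n: "b < n" "a < n" using h bp(3) by auto
      have j: "j < N" "j < ?N1" "v j = b" using h lu u(2)[of j] by auto
      obtain m where m: "m \<in> B a" "\<forall>i\<in>B b. m < i" using first[OF h(2) n(1)] by blast
      have "m < j" using m(2) v(2)[OF j(1)] j(3) by simp
      then show ?thesis using j u(2)[of m] vB[of m a] m(1) n by (intro exI[of _ m]) simp
    qed
  qed simp
  have 2: "param_word ?n1 (drop ?N1 u) n"
  proof (rule param_wordI)
    show "?n1 \<le> n" by (rule bp(3))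
    show "drop ?N1 u ! j < n" if "j < length (drop ?N1 u)" for j
      using that v(1)[of "?N1 + j"] u(2)[of "?N1 + j"] lu by simp
    show "a \<in> set (drop ?N1 u)" if a: "?n1 \<le> a" "a < n" for a
    proof -
      obtain j where j: "j \<in> B a" using Bne[OF a(2)] by blast
      have jN: "j < N" using j(1) B(1)[OF a(2)] by auto
      have "?N1 \<le> j" by (rule small[OF j a(2,1)])
      moreover have "u ! j = a" using u(2)[OF jN] vB[OF jN a(2)] j(1) by simp
      ultimately show ?thesis using lu jN by (auto simp: in_set_conv_nth intro!: exI[of _ "j - ?N1"])
    qed
    show "\<exists>i<j. drop ?N1 u ! i = a"
      if h: "?n1 \<le> a" "a < b" "b < n" "j < length (drop ?N1 u)" "drop ?N1 u ! j = b" for a b j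
    proof -
      have j: "?N1 + j < N" "v (?N1 + j) = b" using h lu u(2)[of "?N1 + j"] by auto
      have an: "a < n" using h by simp
      obtain m where m: "m \<in> B a" "\<forall>i\<in>B b. m < i" using first[OF h(2,3)] by blast
      have lt: "m < ?N1 + j" using m(2) v(2)[OF j(1)] j(2) by simp
      have ge: "?N1 \<le> m" by (rule small[OF m(1) an h(1)])
      have "u ! m = a" using u(2)[of m] vB[of m a] m(1) an lt j(1) by simp
      then show ?thesis using lt ge lu j(1) by (intro exI[of _ "m - ?N1"]) auto
    qed
  qed
  have "k (cls p {i}) = cls (\<lambda>x. u ! c x) {i}" if "i < n" for i
  proof -
    have "(\<lambda>x. u ! c x) -` {i} = c -` B i"
    proof (rule Set.set_eqI)
      fix x
      have "c x < N" using pc by (simp add: partition_fun_def)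
      then show "x \<in> (\<lambda>x. u ! c x) -` {i} \<longleftrightarrow> x \<in> c -` B i" using u(2) vB that by simp
    qed
    then show ?thesis using B(2)[OF that] by (simp add: cls_def)
  qed
  then show ?thesis using 1 2 lu by (auto simp: typed_word_def)
qed

lemma word_partition:
  fixes d :: "omega1 \<Rightarrow> nat"
  assumes d: "partition_fun N d" and type: "\<And>j. j < N \<Longrightarrow> cls d {j} \<notin> countable_classes \<longleftrightarrow> j < N1"
    and N1: "N1 \<le> N" and w: "typed_word N1 N n1 n w"
  shows "partition_fun n (\<lambda>x. w ! d x)" "\<And>i. i < n \<Longrightarrow> cls (\<lambda>x. w ! d x) {i} \<notin> countable_classes \<longleftrightarrow> i < n1"
proof -
  note W = typed_word_facts[OF w N1]
  let ?P = "countable_classes :: omega1 pfin set"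
  have dN: "d x < N" for x using d by (simp add: partition_fun_def)
  have eq: "cls (\<lambda>x. w ! d x) {i} = cls d {j. j < N \<and> w ! j = i}" for i
    using dN by (simp add: cls_def vimage_def)
  show "partition_fun n (\<lambda>x. w ! d x)"
    unfolding partition_fun_def
  proof (intro conjI allI impI)
    show "w ! d x < n" for x using W(3) dN by simp
    fix i assume "i < n"
    then obtain j where j: "j < N" "w ! j = i" using W(6) by blast
    have "d -` {j} \<subseteq> (\<lambda>x. w ! d x) -` {i}" using j by auto
    moreover have "infinite (d -` {j})" using d j by (simp add: partition_fun_def)
    ultimately show "infinite ((\<lambda>x. w ! d x) -` {i})" using finite_subset by blast
  qed
  show "cls (\<lambda>x. w ! d x) {i} \<notin> ?P \<longleftrightarrow> i < n1" if "i < n" for i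
  proof -
    have "cls (\<lambda>x. w ! d x) {i} \<notin> ?P \<longleftrightarrow> (\<exists>j<N. w ! j = i \<and> cls d {j} \<notin> ?P)"
      unfolding eq by (subst cls_countable_iff) auto
    also have "\<dots> \<longleftrightarrow> (\<exists>j<N1. w ! j = i)"
    proof
      assume "\<exists>j<N. w ! j = i \<and> cls d {j} \<notin> ?P"
      then obtain j where "j < N" "w ! j = i" "cls d {j} \<notin> ?P" by blast
      then show "\<exists>j<N1. w ! j = i" using type[of j] by blast
    next
      assume "\<exists>j<N1. w ! j = i"
      then obtain j where j: "j < N1" "w ! j = i" by blast
      then have "j < N" using N1 by simp
      then show "\<exists>j<N. w ! j = i \<and> cls d {j} \<notin> ?P" using j type[of j] by blast
    qed
    also have "\<dots> \<longleftrightarrow> i < n1" using W(4,5) by blast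
    finally show ?thesis .
  qed
qed

text \<open>Split the points into countably many copies of \<open>\<omega>\<^sub>1\<close>. Copy \<open>j\<close> is used as a whole for an uncountable piece
and through an infinite sequence in it for a countable piece; all remaining points join piece \<open>0\<close>,
which is uncountable.\<close>

lemma ex_partition_with_counts:
  assumes "0 < N1" "N1 \<le> N"
  shows "\<exists>d :: omega1 \<Rightarrow> nat. partition_fun N d \<and> (\<forall>j<N. cls d {j} \<notin> countable_classes \<longleftrightarrow> j < N1)"
proof -
  obtain \<iota> :: "nat \<Rightarrow> omega1" where \<iota>: "inj \<iota>"
    using infinite_countable_subset[OF infinite_omega1] by blast
  have "\<exists>b :: omega1 \<Rightarrow> omega1 \<times> nat. bij b"
  proof -
    include cardinal_syntax
    have "|UNIV :: nat set| \<le>o |UNIV :: omega1 set|" using \<iota> card_of_ordLeq[of "UNIV :: nat set" "UNIV :: omega1 set"] by blast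
    then have "|(UNIV :: omega1 set) \<times> (UNIV :: nat set)| =o |UNIV :: omega1 set|"
      using card_of_Times_infinite[OF infinite_omega1, of "UNIV :: nat set"] by blast
    then have "|UNIV :: omega1 set| =o |(UNIV :: omega1 set) \<times> (UNIV :: nat set)|" by (rule ordIso_symmetric)
    then obtain b :: "omega1 \<Rightarrow> omega1 \<times> nat" where "bij_betw b UNIV (UNIV \<times> UNIV)"
      using card_of_ordIso[of "UNIV :: omega1 set" "(UNIV :: omega1 set) \<times> (UNIV :: nat set)"] by blast
    then show ?thesis by auto
  qed
  then obtain b :: "omega1 \<Rightarrow> omega1 \<times> nat" where b: "bij b" by blast
  have inj: "inj b" and surj: "surj b" using b by (auto simp: bij_def)
  define d where "d w = (if snd (b w) < N1 \<or> snd (b w) < N \<and> fst (b w) \<in> range \<iota> then snd (b w) else 0)" for w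
  have big: "uncountable (d -` {j})" if j: "j < N1" for j
  proof
    assume "countable (d -` {j})"
    then have "countable ((fst \<circ> b) ` (d -` {j}))" by (rule countable_image)
    moreover have "(fst \<circ> b) ` (d -` {j}) = UNIV"
    proof -
      have "x \<in> (fst \<circ> b) ` (d -` {j})" for x
      proof -
        obtain w where "b w = (x, j)" using surj by (metis surj_def)
        then show ?thesis using j by (intro image_eqI[of _ _ w]) (auto simp: d_def)
      qed
      then show ?thesis by blast
    qed
    ultimately show False using uncountable_omega1 by simp
  qed
  have small: "countable (d -` {j}) \<and> infinite (d -` {j})" if j: "N1 \<le> j" "j < N" for j
  proof
    have "b ` (d -` {j}) \<subseteq> range \<iota> \<times> {j}"
    proof (rule image_subsetI)
      fix w assume "w \<in> d -` {j}"
      then have "fst (b w) \<in> range \<iota>" "snd (b w) = j"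
        using j assms(1) by (auto simp: d_def split: if_splits)
      then show "b w \<in> range \<iota> \<times> {j}" by (simp add: mem_Times_iff)
    qed
    then have "countable (b ` (d -` {j}))" by (rule countable_subset) simp
    then show "countable (d -` {j})" using inj countable_image_inj_on inj_on_subset by blast
    show "infinite (d -` {j})"
    proof
      assume "finite (d -` {j})"
      then have "finite ((fst \<circ> b) ` (d -` {j}))" by simp
      moreover have "range \<iota> \<subseteq> (fst \<circ> b) ` (d -` {j})"
      proof
        fix x assume x: "x \<in> range \<iota>"
        obtain w where "b w = (x, j)" using surj by (metis surj_def)
        then show "x \<in> (fst \<circ> b) ` (d -` {j})" using j x by (intro image_eqI[of _ _ w]) (auto simp: d_def)
      qed
      ultimately have "finite (range \<iota>)" by (rule rev_finite_subset)
      then show False using \<iota> by (simp add: finite_image_iff)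
    qed
  qed
  have "partition_fun N d"
    unfolding partition_fun_def
  proof (intro conjI allI impI)
    show "d x < N" for x using assms by (auto simp: d_def)
    show "infinite (d -` {j})" if "j < N" for j
      using big[of j] small[of j] that countable_finite by (cases "j < N1") auto
  qed
  moreover have "cls d {j} \<notin> countable_classes \<longleftrightarrow> j < N1" if "j < N" for j
    using big[of j] small[of j] that by (cases "j < N1") (auto simp: cls_def abs_pfin_countable_iff)
  ultimately show ?thesis by blast
qed

section \<open>Flows and factor maps\<close>

lemma flowD:
  assumes "flow G T Y \<psi>"
  shows "compact_space Y" "Hausdorff_space Y" "continuous_map (prod_topology T Y) Y (\<lambda>(g, y). \<psi> g y)"
    "group G" "topspace T = carrier G"
    "\<And>g y. g \<in> carrier G \<Longrightarrow> y \<in> topspace Y \<Longrightarrow> \<psi> g y \<in> topspace Y"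
    "\<And>y. y \<in> topspace Y \<Longrightarrow> \<psi> \<one>\<^bsub>G\<^esub> y = y"
    "\<And>g h y. g \<in> carrier G \<Longrightarrow> h \<in> carrier G \<Longrightarrow> y \<in> topspace Y \<Longrightarrow> \<psi> (g \<otimes>\<^bsub>G\<^esub> h) y = \<psi> g (\<psi> h y)"
proof -
  have act: "group_action G (topspace Y) \<psi>" using assms by (simp add: flow_def)
  show "compact_space Y" "Hausdorff_space Y" "continuous_map (prod_topology T Y) Y (\<lambda>(g, y). \<psi> g y)"
    "group G" "topspace T = carrier G"
    using assms by (simp_all add: flow_def topological_group_def)
  show "\<psi> g y \<in> topspace Y" if "g \<in> carrier G" "y \<in> topspace Y" for g y
    by (rule group_action.element_image[OF act that refl])
  show "\<psi> \<one>\<^bsub>G\<^esub> y = y" if "y \<in> topspace Y" for y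
    using group_action.id_eq_one[OF act] that by (metis restrict_apply')
  show "\<psi> (g \<otimes>\<^bsub>G\<^esub> h) y = \<psi> g (\<psi> h y)" if "g \<in> carrier G" "h \<in> carrier G" "y \<in> topspace Y" for g h y
    by (rule group_action.composition_rule[OF act that(3,1,2)])
qed

lemma continuous_map_translate:
  assumes "flow G T Y \<psi>" "g \<in> carrier G"
  shows "continuous_map Y Y (\<psi> g)"
proof -
  have "continuous_map Y (prod_topology T Y) (\<lambda>y. (g, y))"
    using flowD(5)[OF assms(1)] assms(2) by (simp add: continuous_map_pairwise o_def)
  from continuous_map_compose[OF this flowD(3)[OF assms(1)]] show ?thesis by (simp add: o_def)
qed

text \<open>The pairs \<open>(g, y)\<close> for which \<open>g\<close> moves the value at \<open>y\<close> by less than \<open>e\<close> form a neighbourhood of the slice over the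
identity. By compactness of \<open>Y\<close> it contains a tube, and neighbourhoods of the identity are given by
stabilizers of finite sets.\<close>

lemma uniformly_small_displacement:
  fixes \<psi> :: "('a::boolean_algebra \<Rightarrow> 'a) \<Rightarrow> 'y \<Rightarrow> 'y"
  assumes fl: "flow aut_group (pointwise_topology (carrier aut_group)) Y \<psi>"
    and f: "continuous_map Y euclideanreal f" and e: "0 < e"
  shows "\<exists>F. finite F \<and> (\<forall>g. boolean_iso g \<longrightarrow> (\<forall>a\<in>F. g a = a) \<longrightarrow> (\<forall>y\<in>topspace Y. \<bar>f (\<psi> g y) - f y\<bar> < e))"
proof -
  let ?C = "carrier (aut_group :: ('a \<Rightarrow> 'a) monoid)"
  let ?T = "pointwise_topology ?C"
  note F = flowD[OF fl]
  let ?h = "\<lambda>z. f (case z of (g, y) \<Rightarrow> \<psi> g y) - f (snd z)"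
  have "continuous_map (prod_topology ?T Y) euclideanreal ?h"
  proof (intro continuous_map_diff)
    show "continuous_map (prod_topology ?T Y) euclideanreal (\<lambda>z. f (case z of (g, y) \<Rightarrow> \<psi> g y))"
      using continuous_map_compose[OF F(3) f] by (simp add: o_def)
    show "continuous_map (prod_topology ?T Y) euclideanreal (\<lambda>z. f (snd z))"
      using continuous_map_compose[OF continuous_map_snd f] by (simp add: o_def)
  qed
  then have W: "openin (prod_topology ?T Y) {z \<in> topspace (prod_topology ?T Y). ?h z \<in> {-e<..<e}}"
    by (rule openin_continuous_map_preimage) (simp add: open_openin[symmetric])
  have K: "compactin Y (topspace Y)" using F(1) by (simp add: compact_space_def)
  have id: "id \<in> topspace ?T" using boolean_iso_id by simp
  have sub: "{id} \<times> topspace Y \<subseteq> {z \<in> topspace (prod_topology ?T Y). ?h z \<in> {-e<..<e}}"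
    using F(7) e boolean_iso_id by auto
  from tube_lemma_right[OF W K id sub] obtain U V where U: "openin ?T U" "openin Y V" "id \<in> U" "topspace Y \<subseteq> V"
    "U \<times> V \<subseteq> {z \<in> topspace (prod_topology ?T Y). ?h z \<in> {-e<..<e}}"
    by (elim exE conjE)
  from pointwise_nbhd[OF U(1,3)] obtain I where I: "finite I" "{g \<in> ?C. \<forall>i\<in>I. g i = id i} \<subseteq> U"
    by (elim exE conjE)
  have "\<bar>f (\<psi> g y) - f y\<bar> < e" if g: "boolean_iso g" "\<forall>a\<in>I. g a = a" and y: "y \<in> topspace Y" for g y
  proof -
    have "g \<in> U" using I(2) g by auto
    then have "(g, y) \<in> U \<times> V" using y U(4) by blast
    then have "?h (g, y) \<in> {-e<..<e}" using U(5) by blast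
    then show ?thesis by (simp add: abs_less_iff)
  qed
  then show ?thesis using I(1) by blast
qed

lemma fixes_partition_algebra:
  assumes g: "boolean_iso g" and p: "partition_fun n p" and fixed: "\<And>i. i < n \<Longrightarrow> g (cls p {i}) = cls p {i}"
    and a: "a \<in> partition_algebra n p"
  shows "g a = a"
proof -
  obtain S where S: "a = cls p S" "S \<subseteq> {..<n}" using a by (auto simp: partition_algebra_def)
  have "finite S" using S finite_subset by blast
  then have "g (cls p S) = cls p S" using S(2)
  proof (induction S rule: finite_induct)
    case empty
    then show ?case by (simp add: boolean_isoD(5)[OF g])
  next
    case (insert i S)
    have eq: "cls p (insert i S) = sup (cls p {i}) (cls p S)" by (simp add: cls_simps)
    show ?case unfolding eq boolean_isoD(3)[OF g] using insert fixed[of i] by simp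
  qed
  then show ?thesis using S by simp
qed

lemma NO_action_eq: "R \<in> NO P \<Longrightarrow> NO_action P g R = pullback (inv_into UNIV g) R"
  by (simp add: NO_action_def pullback_def)

lemma pullback_comp: "pullback f (pullback g R) = pullback (g \<circ> f) R"
  by (simp add: fun_eq_iff pullback_def split: prod.splits)

lemma pullback_id: "pullback id R = R"
  by (simp add: fun_eq_iff pullback_def split: prod.splits)

lemma inv_into_comp:
  fixes f g :: "'a::boolean_algebra \<Rightarrow> 'a"
  assumes "boolean_iso f" "boolean_iso g"
  shows "inv_into UNIV (f \<circ> g) = inv_into UNIV g \<circ> inv_into UNIV f"
proof
  fix x
  show "inv_into UNIV (f \<circ> g) x = (inv_into UNIV g \<circ> inv_into UNIV f) x"
    using inv_comp(3)[OF assms(1)] inv_comp(3)[OF assms(2)] by (subst inv_comp(5)[OF boolean_iso_comp[OF assms]]) simp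
qed

lemma inv_into_inv:
  fixes f :: "'a::boolean_algebra \<Rightarrow> 'a"
  shows "boolean_iso f \<Longrightarrow> inv_into UNIV (inv_into UNIV f) = f"
  by (rule ext) (simp add: inv_comp(5)[OF boolean_iso_inv] inv_comp(4))

lemma group_actionI:
  assumes G: "group G" and closed: "\<And>g x. g \<in> carrier G \<Longrightarrow> x \<in> E \<Longrightarrow> \<phi> g x \<in> E"
    and ext: "\<And>g. g \<in> carrier G \<Longrightarrow> \<phi> g \<in> extensional E"
    and one: "\<And>x. x \<in> E \<Longrightarrow> \<phi> \<one>\<^bsub>G\<^esub> x = x"
    and mult: "\<And>g h x. g \<in> carrier G \<Longrightarrow> h \<in> carrier G \<Longrightarrow> x \<in> E \<Longrightarrow> \<phi> (g \<otimes>\<^bsub>G\<^esub> h) x = \<phi> g (\<phi> h x)"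
  shows "group_action G E \<phi>"
proof -
  interpret group G by (rule G)
  have Bij: "\<phi> g \<in> Bij E" if g: "g \<in> carrier G" for g
  proof -
    have "\<phi> (inv\<^bsub>G\<^esub> g) (\<phi> g x) = x" "\<phi> g (\<phi> (inv\<^bsub>G\<^esub> g) x) = x" if "x \<in> E" for x
      using mult[symmetric] one g that by (simp_all add: l_inv r_inv)
    then have "bij_betw (\<phi> g) E E"
      using closed g by (intro bij_betw_byWitness[where f' = "\<phi> (inv\<^bsub>G\<^esub> g)"]) auto
    then show ?thesis using ext g by (simp add: Bij_def)
  qed
  have "\<phi> (g \<otimes>\<^bsub>G\<^esub> h) = compose E (\<phi> g) (\<phi> h)" if "g \<in> carrier G" "h \<in> carrier G" for g h
    using that mult ext by (intro extensionalityI[of _ E]) (auto simp: compose_def)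
  then have "\<phi> \<in> hom G (BijGroup E)"
    using Bij by (auto simp: hom_def BijGroup_def)
  then show ?thesis
    by (simp add: group_action_def group_hom_def group_hom_axioms_def G group_BijGroup)
qed

text \<open>In a proper enumeration the elements of the ideal occupy an initial segment, whose length does not
depend on the enumeration.\<close>

lemma proper_enum_card:
  assumes xs: "distinct xs" "set xs = B"
    and ord: "\<And>i j. i < length xs \<Longrightarrow> j < length xs \<Longrightarrow> xs ! i \<in> P \<Longrightarrow> xs ! j \<notin> P \<Longrightarrow> i < j"
    and i: "i < length xs"
  shows "xs ! i \<in> P \<longleftrightarrow> i < card (B \<inter> P)"
proof -
  let ?I = "{i. i < length xs \<and> xs ! i \<in> P}"
  have "B \<inter> P = (!) xs ` ?I" using xs(2) by (auto simp: in_set_conv_nth)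
  moreover have "inj_on ((!) xs) ?I" using xs(1) by (auto simp: inj_on_def nth_eq_iff_index_eq)
  ultimately have card: "card (B \<inter> P) = card ?I" by (simp add: card_image)
  have down: "j \<in> ?I" if "k \<in> ?I" "j < k" for j k
    using ord[of k j] that by (cases "xs ! j \<in> P") auto
  have fin: "finite ?I" by simp
  show ?thesis
  proof
    assume "xs ! i \<in> P"
    then have "{..i} \<subseteq> ?I" using down i by (auto simp: le_less)
    then have "card {..i} \<le> card ?I" by (rule card_mono[OF fin])
    then show "i < card (B \<inter> P)" using card by simp
  next
    assume lt: "i < card (B \<inter> P)"
    show "xs ! i \<in> P"
    proof (rule ccontr)
      assume "xs ! i \<notin> P"
      then have "?I \<subseteq> {..<i}" using ord[of _ i] i by auto
      then have "card ?I \<le> i" using card_mono[of "{..<i}" ?I] by simp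
      then show False using lt card by simp
    qed
  qed
qed

text \<open>Both orderings number the atoms of \<open>A\<close>, with the same number of countable atoms first, and matching the
two numberings is an instance of homogeneity.\<close>

lemma NO_locally_conjugate:
  fixes R S :: "omega1 pfin \<times> omega1 pfin \<Rightarrow> bool"
  assumes R: "R \<in> NO countable_classes" and S: "S \<in> NO countable_classes" and A: "finite_subalgebra A"
  shows "\<exists>k. boolean_iso k \<and> (\<forall>i\<in>A \<times> A. pullback k R i = S i)"
proof -
  let ?P = "countable_classes :: omega1 pfin set"
  have enum: "\<exists>n p. n = card (atoms A) \<and> partition_fun n p \<and> A = partition_algebra n p \<and>
      (\<forall>i<n. cls p {i} \<in> ?P \<longleftrightarrow> i < card (atoms A \<inter> ?P)) \<and>
      (\<forall>U V. U \<subseteq> {..<n} \<longrightarrow> V \<subseteq> {..<n} \<longrightarrow> R (cls p U, cls p V) = antilex_less U V)"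
    if R: "antilexicographic ?P R" for R
  proof -
    have lin: "strict_linear_order (Collect R)" by (rule antilexicographic_linear[OF R])
    obtain n p xs where p: "partition_fun n p" "A = partition_algebra n p" "distinct xs" "set xs = atoms A" "length xs = n"
      "\<And>i. i < n \<Longrightarrow> xs ! i = cls p {i}" "\<And>i j. i < j \<Longrightarrow> j < n \<Longrightarrow> R (cls p {i}, cls p {j})"
      using partition_refining[OF infinite_omega1 A lin] by blast
    have "i < j" if "i < length xs" "j < length xs" "xs ! i \<in> ?P" "xs ! j \<notin> ?P" for i j
      by (rule increasing_partition_proper[OF R p(7)]) (use that p(5,6) in auto)
    then have "xs ! i \<in> ?P \<longleftrightarrow> i < card (atoms A \<inter> ?P)" if "i < n" for i
      using proper_enum_card[OF p(3,4)] that p(5) by blast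
    then have "\<forall>i<n. cls p {i} \<in> ?P \<longleftrightarrow> i < card (atoms A \<inter> ?P)" using p(6) by metis
    moreover have "R (cls p U, cls p V) = antilex_less U V" if "U \<subseteq> {..<n}" "V \<subseteq> {..<n}" for U V
      by (rule antilexicographic_partition[OF R p(1) p(7) that])
    moreover have "n = card (atoms A)" using p(3,4,5) distinct_card by metis
    ultimately show ?thesis
      using p(1,2) by (intro exI[of _ n] exI[of _ p]) (intro conjI allI impI; assumption?; blast)
  qed
  obtain n p where p: "n = card (atoms A)" "partition_fun n p" "A = partition_algebra n p"
      "\<forall>i<n. cls p {i} \<in> ?P \<longleftrightarrow> i < card (atoms A \<inter> ?P)"
      "\<forall>U V. U \<subseteq> {..<n} \<longrightarrow> V \<subseteq> {..<n} \<longrightarrow> R (cls p U, cls p V) = antilex_less U V"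
    using enum[OF R[unfolded NO_iff_antilexicographic]] by (elim exE conjE)
  obtain n' q where q: "n' = card (atoms A)" "partition_fun n' q" "A = partition_algebra n' q"
      "\<forall>i<n'. cls q {i} \<in> ?P \<longleftrightarrow> i < card (atoms A \<inter> ?P)"
      "\<forall>U V. U \<subseteq> {..<n'} \<longrightarrow> V \<subseteq> {..<n'} \<longrightarrow> S (cls q U, cls q V) = antilex_less U V"
    using enum[OF S[unfolded NO_iff_antilexicographic]] by (elim exE conjE)
  have nn: "n' = n" using p(1) q(1) by simp
  have "\<exists>k. boolean_iso k \<and> (\<forall>U. k (cls q U) = cls p U)"
    by (rule partition_homogeneous[OF q(2)[unfolded nn] p(2)]) (use p(4) q(4) nn in simp)
  then obtain k where k: "boolean_iso k" "\<And>U. k (cls q U) = cls p U" by blast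
  have "pullback k R i = S i" if i: "i \<in> A \<times> A" for i
  proof -
    obtain U V where "i = (cls q U, cls q V)" "U \<subseteq> {..<n}" "V \<subseteq> {..<n}"
      using i unfolding q(3) nn partition_algebra_def by auto
    then show ?thesis using p(5) q(5) k(2) nn by simp
  qed
  then show ?thesis using k(1) by blast
qed

text \<open>Projections along compact spaces are closed.\<close>

lemma continuous_map_closed_graph:
  assumes Y: "compact_space Y" and Z: "closedin (prod_topology X Y) Z"
    and graph: "\<And>x. x \<in> topspace X \<Longrightarrow> (x, F x) \<in> Z" and unique: "\<And>x y. (x, y) \<in> Z \<Longrightarrow> y = F x"
  shows "continuous_map X Y F"
  unfolding continuous_map_closedin
proof (intro conjI allI impI)
  have sub: "Z \<subseteq> topspace X \<times> topspace Y" using closedin_subset[OF Z] by simp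
  then show "F \<in> topspace X \<rightarrow> topspace Y" using graph by blast
  fix C assume C: "closedin Y C"
  have "closedin (prod_topology X Y) (topspace X \<times> C)" using C by (simp add: closedin_prod_Times_iff)
  then have "closedin (prod_topology X Y) (Z \<inter> topspace X \<times> C)" using Z by (rule closedin_Int[rotated])
  then have "closedin X (fst ` (Z \<inter> topspace X \<times> C))"
    using closed_map_fst[OF Y, of X] unfolding closed_map_def by blast
  moreover have "fst ` (Z \<inter> topspace X \<times> C) = {x \<in> topspace X. F x \<in> C}"
  proof
    show "fst ` (Z \<inter> topspace X \<times> C) \<subseteq> {x \<in> topspace X. F x \<in> C}" using unique by auto
    show "{x \<in> topspace X. F x \<in> C} \<subseteq> fst ` (Z \<inter> topspace X \<times> C)" using graph by force
  qed
  ultimately show "closedin X {x \<in> topspace X. F x \<in> C}" by simp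
qed

context
  assumes no_iso: "\<nexists>f :: nat pfin \<Rightarrow> omega1 pfin. boolean_iso f"
begin

lemmas preserves_countable = automorphism_preserves_countable[OF no_iso]

lemma pullback_in_NO:
  fixes R :: "omega1 pfin \<times> omega1 pfin \<Rightarrow> bool"
  assumes "boolean_iso h" "R \<in> NO countable_classes"
  shows "pullback h R \<in> NO countable_classes"
  using antilexicographic_pullback[OF assms(1) preserves_countable[OF assms(1)]] assms(2) by (simp only: NO_iff_antilexicographic)

lemma NO_flow:
  shows "flow (aut_group :: (omega1 pfin \<Rightarrow> omega1 pfin) monoid) (pointwise_topology (carrier aut_group))
    (pointwise_topology (NO countable_classes)) (NO_action countable_classes)"
proof -
  let ?N = "NO (countable_classes :: omega1 pfin set)"
  let ?C = "carrier (aut_group :: (omega1 pfin \<Rightarrow> omega1 pfin) monoid)"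
  let ?A = "NO_action (countable_classes :: omega1 pfin set)"
  have closed: "?A g R \<in> ?N" if "boolean_iso g" "R \<in> ?N" for g R
    unfolding NO_action_eq[OF that(2)]
    by (rule pullback_in_NO[OF boolean_iso_inv[OF that(1)] that(2)])
  have "group_action aut_group ?N ?A"
  proof (rule group_actionI[OF group_aut])
    show "?A g R \<in> ?N" if "g \<in> ?C" "R \<in> ?N" for g R using closed that by simp
    show "?A g \<in> extensional ?N" for g by (simp add: NO_action_def)
    show "?A \<one>\<^bsub>aut_group\<^esub> R = R" if "R \<in> ?N" for R
    proof -
      have "inv_into UNIV (id :: omega1 pfin \<Rightarrow> omega1 pfin) = id"
        by (rule ext) (simp add: inv_comp(5)[OF boolean_iso_id])
      then show ?thesis by (simp add: NO_action_eq[OF that] pullback_id)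
    qed
    show "?A (g \<otimes>\<^bsub>aut_group\<^esub> h) R = ?A g (?A h R)" if "g \<in> ?C" "h \<in> ?C" "R \<in> ?N" for g h R
    proof -
      have g: "boolean_iso g" and h: "boolean_iso h" using that by auto
      have "?A g (?A h R) = pullback (inv_into UNIV g) (?A h R)"
        by (rule NO_action_eq[OF closed[OF h that(3)]])
      then show ?thesis
        by (simp add: NO_action_eq[OF that(3)] inv_into_comp[OF g h] pullback_comp)
    qed
  qed
  moreover have "continuous_map (prod_topology (pointwise_topology ?C) (pointwise_topology ?N)) (pointwise_topology ?N) (\<lambda>(g, R). ?A g R)"
    unfolding continuous_map_pointwise_iff
  proof (intro conjI allI ballI)
    show "(\<lambda>(g, R). ?A g R) \<in> topspace (prod_topology (pointwise_topology ?C) (pointwise_topology ?N)) \<rightarrow> ?N"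
      using closed by auto
    fix i :: "omega1 pfin \<times> omega1 pfin" and gR
    assume "gR \<in> topspace (prod_topology (pointwise_topology ?C) (pointwise_topology ?N))"
    then obtain g R where gR: "gR = (g, R)" "boolean_iso g" "R \<in> ?N" by auto
    obtain a b where i: "i = (a, b)" by (cases i)
    let ?a = "inv_into UNIV g a" and ?b = "inv_into UNIV g b"
    let ?U = "({h \<in> ?C. h ?a \<in> {a}} \<inter> {h \<in> ?C. h ?b \<in> {b}}) \<times> {S \<in> ?N. S (?a, ?b) \<in> {R (?a, ?b)}}"
    have "openin (prod_topology (pointwise_topology ?C) (pointwise_topology ?N)) ?U"
      unfolding openin_prod_Times_iff by (intro disjI2 conjI openin_Int openin_pointwise_eval)
    moreover have "gR \<in> ?U" using gR inv_comp(3)[OF gR(2)] by simp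
    moreover have "(case y of (g, R) \<Rightarrow> ?A g R) i = (case gR of (g, R) \<Rightarrow> ?A g R) i" if "y \<in> ?U" for y
    proof -
      obtain h S where y: "y = (h, S)" by (cases y)
      have hS: "boolean_iso h" "h ?a = a" "h ?b = b" "S \<in> ?N" "S (?a, ?b) = R (?a, ?b)" using that y by auto
      then have "inv_into UNIV h a = ?a" "inv_into UNIV h b = ?b" by (simp_all add: inv_comp(5)[OF hS(1)])
      then show ?thesis using hS gR i y by (simp add: NO_action_eq)
    qed
    ultimately show "\<exists>U. openin (prod_topology (pointwise_topology ?C) (pointwise_topology ?N)) U \<and> gR \<in> U \<and>
        (\<forall>y\<in>U. (case y of (g, R) \<Rightarrow> ?A g R) i = (case gR of (g, R) \<Rightarrow> ?A g R) i)"
      by (intro exI[of _ ?U] conjI ballI)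
  qed
  ultimately show ?thesis
    unfolding flow_def topspace_pointwise
    by (intro conjI topological_group_aut compact_NO Hausdorff_pointwise)
qed

section \<open>Minimality of the space of natural orderings\<close>

text \<open>A basic neighbourhood of \<open>S\<close> concerns a finite subalgebra, on which \<open>S\<close> is a translate of \<open>R\<close>.\<close>

lemma orbit_dense:
  fixes R :: "omega1 pfin \<times> omega1 pfin \<Rightarrow> bool"
  assumes R: "R \<in> NO countable_classes"
    and C: "closedin (pointwise_topology (NO countable_classes)) C"
    and orbit: "\<And>k. boolean_iso k \<Longrightarrow> pullback k R \<in> NO countable_classes \<Longrightarrow> pullback k R \<in> C"
  shows "C = NO countable_classes"
proof (rule ccontr)
  let ?N = "NO (countable_classes :: omega1 pfin set)"
  assume "C \<noteq> ?N"
  moreover have "C \<subseteq> ?N" using closedin_subset[OF C] by simp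
  ultimately obtain S where S: "S \<in> ?N - C" by blast
  have "openin (pointwise_topology ?N) (?N - C)" using C by (simp add: closedin_def)
  from pointwise_nbhd[OF this S] obtain I where I: "finite I" "{f \<in> ?N. \<forall>i\<in>I. f i = S i} \<subseteq> ?N - C"
    by (elim exE conjE)
  have "finite (fst ` I \<union> snd ` I)" using I(1) by simp
  from finite_subset_of_subalgebra[OF this] obtain A where A: "finite_subalgebra A" "fst ` I \<union> snd ` I \<subseteq> A"
    by (elim exE conjE)
  from NO_locally_conjugate[OF R _ A(1), of S] S
  obtain k where k: "boolean_iso k" "\<forall>i\<in>A \<times> A. pullback k R i = S i" by blast
  have N: "pullback k R \<in> ?N" by (rule pullback_in_NO[OF k(1) R])
  have "i \<in> A \<times> A" if "i \<in> I" for i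
    using A(2) that by (cases i) force
  then have "\<forall>i\<in>I. pullback k R i = S i" using k(2) by blast
  then have "pullback k R \<in> {f \<in> ?N. \<forall>i\<in>I. f i = S i}" using N by simp
  then have "pullback k R \<notin> C" using I(2) by blast
  then show False using orbit[OF k(1) N] by simp
qed

lemma NO_minimal_flow:
  shows "minimal_flow (aut_group :: (omega1 pfin \<Rightarrow> omega1 pfin) monoid) (pointwise_topology (carrier aut_group))
    (pointwise_topology (NO countable_classes)) (NO_action countable_classes)"
  unfolding minimal_flow_def
proof (intro conjI allI impI)
  let ?N = "NO (countable_classes :: omega1 pfin set)"
  show "flow (aut_group :: (omega1 pfin \<Rightarrow> omega1 pfin) monoid) (pointwise_topology (carrier aut_group))
    (pointwise_topology (NO countable_classes)) (NO_action countable_classes)"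
    by (rule NO_flow)
  show "topspace (pointwise_topology ?N) \<noteq> {}" using NO_nonempty by simp
  fix C
  assume C: "closedin (pointwise_topology ?N) C \<and> C \<noteq> {} \<and>
    (\<forall>g\<in>carrier aut_group. NO_action countable_classes g ` C \<subseteq> C)"
  then obtain R where R: "R \<in> C" by blast
  have RN: "R \<in> ?N" using R closedin_subset[of _ C] C by fastforce
  have "C = ?N"
  proof (rule orbit_dense[OF RN])
    show "closedin (pointwise_topology ?N) C" using C by blast
    fix k :: "omega1 pfin \<Rightarrow> omega1 pfin" assume k: "boolean_iso k"
    have "NO_action countable_classes (inv_into UNIV k) R \<in> C"
      using C R boolean_iso_inv[OF k] by (auto simp: image_subset_iff)
    then show "pullback k R \<in> C" by (simp add: NO_action_eq[OF RN] inv_into_inv[OF k])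
  qed
  then show "C = topspace (pointwise_topology ?N)" by simp
qed

section \<open>A point whose translates follow the ordering\<close>

text \<open>The Ramsey argument. A finite subalgebra \<open>A\<close> contains the images of all the partitions involved.
Its \<open>N\<close> atoms are sent by a suitable automorphism \<open>h\<close> to joins of pieces of a partition \<open>d\<close> into \<open>N'\<close> pieces,
according to a word \<open>W\<close> supplied by \<open>typed_ramsey_simultaneous\<close>. The colour of a word \<open>w\<close> is a rounded
value of \<open>f i\<close> at the translate of \<open>y0\<close> by the inverse of an automorphism that realises \<open>w\<close> as an embedding
of the partition \<open>p i\<close> into \<open>d\<close>; the choice of the automorphism affects the value by less than \<open>1/4\<close>.
Rounding to multiples of \<open>1/4\<close> costs another \<open>1/4\<close>, which together with the choices for \<open>k i\<close> and \<open>k' i\<close>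
gives the bound \<open>3/4\<close>.\<close>

lemma ex_homogeneous_translate:
  fixes \<psi> :: "(omega1 pfin \<Rightarrow> omega1 pfin) \<Rightarrow> 'y \<Rightarrow> 'y"
    and f :: "'i \<Rightarrow> 'y \<Rightarrow> real" and n :: "'i \<Rightarrow> nat" and p :: "'i \<Rightarrow> omega1 \<Rightarrow> nat"
    and k k' :: "'i \<Rightarrow> omega1 pfin \<Rightarrow> omega1 pfin"
  assumes fl: "flow aut_group (pointwise_topology (carrier aut_group)) Y \<psi>" and y0: "y0 \<in> topspace Y"
    and R: "antilexicographic countable_classes R" and J: "finite J"
    and f: "\<And>i y. i \<in> J \<Longrightarrow> y \<in> topspace Y \<Longrightarrow> 0 \<le> f i y \<and> f i y \<le> 1"
    and small: "\<And>i g y. i \<in> J \<Longrightarrow> boolean_iso g \<Longrightarrow> (\<And>j. j < n i \<Longrightarrow> g (cls (p i) {j}) = cls (p i) {j}) \<Longrightarrow>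
      y \<in> topspace Y \<Longrightarrow> \<bar>f i (\<psi> g y) - f i y\<bar> < 1/4"
    and k: "\<And>i. i \<in> J \<Longrightarrow> boolean_iso (k i)" "\<And>i. i \<in> J \<Longrightarrow> decreasing_partition (pullback (k i) R) (n i) (p i)"
    and k': "\<And>i. i \<in> J \<Longrightarrow> boolean_iso (k' i)" "\<And>i. i \<in> J \<Longrightarrow> decreasing_partition (pullback (k' i) R) (n i) (p i)"
  shows "\<exists>y\<in>topspace Y. \<forall>i\<in>J. \<bar>f i (\<psi> (inv_into UNIV (k i)) y) - f i (\<psi> (inv_into UNIV (k' i)) y)\<bar> \<le> 3/4"
proof -
  let ?P = "countable_classes :: omega1 pfin set"
  note F = flowD[OF fl]
  define E where "E = (\<Union>i\<in>J. (\<lambda>j. k i (cls (p i) {j})) ` {..<n i} \<union> (\<lambda>j. k' i (cls (p i) {j})) ` {..<n i})"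
  have "finite E" using J by (simp add: E_def)
  from finite_subset_of_subalgebra[OF this] obtain A where A: "finite_subalgebra A" "E \<subseteq> A" by (elim exE conjE)
  obtain N c where c: "decreasing_partition R N c" "A = partition_algebra N c"
    using decreasing_partition_of_subalgebra[OF infinite_omega1 A(1) antilexicographic_linear[OF R]] by (elim exE conjE)
  have pc: "partition_fun N c" using c(1) by (simp add: decreasing_partition_def)
  note bc = big_count[OF R c(1)]
  let ?n1 = "\<lambda>i. big_count (n i) (p i)"
  have Rk: "antilexicographic ?P (pullback (k i) R)" if "i \<in> J" for i
    by (rule antilexicographic_pullback[OF k(1)[OF that] preserves_countable[OF k(1)[OF that]] R])
  note bp = big_count[OF Rk k(2)]
  have n1: "0 < ?n1 i" if "i \<in> J" for i by (rule bp(2)[OF that that])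
  have "\<exists>M1 M. 0 < M1 \<and> M1 \<le> M \<and> (\<forall>col :: 'i \<Rightarrow> nat list \<Rightarrow> nat. (\<forall>i w. col i w < 5) \<longrightarrow>
    (\<exists>W. typed_word M1 M (big_count N c) N W \<and> (\<forall>i\<in>J. typed_homogeneous (big_count N c) N (?n1 i) (n i) (col i) W)))"
    by (rule typed_ramsey_simultaneous[OF J bc(2,3) n1])
  then obtain N1' N' where N': "0 < N1'" "N1' \<le> N'" "\<forall>col :: 'i \<Rightarrow> nat list \<Rightarrow> nat. (\<forall>i w. col i w < 5) \<longrightarrow>
    (\<exists>W. typed_word N1' N' (big_count N c) N W \<and> (\<forall>i\<in>J. typed_homogeneous (big_count N c) N (?n1 i) (n i) (col i) W))"
    by (elim exE conjE)
  obtain d :: "omega1 \<Rightarrow> nat" where d: "partition_fun N' d" "\<And>j. j < N' \<Longrightarrow> cls d {j} \<notin> ?P \<longleftrightarrow> j < N1'"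
    using ex_partition_with_counts[OF N'(1,2)] by blast
  have wp: "partition_fun m (\<lambda>x. w ! d x)" "\<And>j. j < m \<Longrightarrow> cls (\<lambda>x. w ! d x) {j} \<notin> ?P \<longleftrightarrow> j < m1"
    if "typed_word N1' N' m1 m w" for m1 m w
    using word_partition[OF d(1) _ N'(2) that] d(2) by simp_all
  have ex_g: "\<exists>g. boolean_iso g \<and> (\<forall>S. g (cls (p i) S) = cls (\<lambda>x. w ! d x) S)"
    if i: "i \<in> J" and w: "typed_word N1' N' (?n1 i) (n i) w" for i w
  proof (rule partition_homogeneous)
    show "partition_fun (n i) (p i)" using k(2)[OF i] by (simp add: decreasing_partition_def)
    show "partition_fun (n i) (\<lambda>x. w ! d x)" by (rule wp(1)[OF w])
    show "cls (p i) {j} \<in> ?P \<longleftrightarrow> cls (\<lambda>x. w ! d x) {j} \<in> ?P" if "j < n i" for j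
      using wp(2)[OF w that] bp(1)[OF i i that] by blast
  qed
  define g where "g i w = (SOME g. boolean_iso g \<and> (\<forall>S. g (cls (p i) S) = cls (\<lambda>x. w ! d x) S))" for i w
  have g: "boolean_iso (g i w)" "g i w (cls (p i) S) = cls (\<lambda>x. w ! d x) S"
    if "i \<in> J" "typed_word N1' N' (?n1 i) (n i) w" for i w S
    using someI_ex[OF ex_g[OF that]] unfolding g_def by blast+
  define val where "val i w = f i (\<psi> (inv_into UNIV (g i w)) y0)" for i w
  \<comment> \<open>The minimum only matters for words that are not typed; elsewhere the values lie in \<open>{0..1}\<close>.\<close>
  define col where "col i w = min 4 (nat \<lfloor>4 * val i w\<rfloor>)" for i w
  have "\<forall>i w. col i w < 5" by (simp add: col_def min_less_iff_disj)
  then obtain W where W: "typed_word N1' N' (big_count N c) N W"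
    "\<And>i. i \<in> J \<Longrightarrow> typed_homogeneous (big_count N c) N (?n1 i) (n i) (col i) W"
    using mp[OF spec[OF N'(3)], of col] by blast
  have "\<exists>h. boolean_iso h \<and> (\<forall>S. h (cls c S) = cls (\<lambda>x. W ! d x) S)"
  proof (rule partition_homogeneous[OF pc wp(1)[OF W(1)]])
    show "cls c {j} \<in> ?P \<longleftrightarrow> cls (\<lambda>x. W ! d x) {j} \<in> ?P" if "j < N" for j
      using wp(2)[OF W(1) that] bc(1)[OF that] by blast
  qed
  then obtain h where h: "boolean_iso h" "\<And>S. h (cls c S) = cls (\<lambda>x. W ! d x) S" by blast
  define y1 where "y1 = \<psi> (inv_into UNIV h) y0"
  have y1: "y1 \<in> topspace Y" unfolding y1_def using F(6) y0 boolean_iso_inv[OF h(1)] by simp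
  have approx: "\<exists>u. typed_word (big_count N c) N (?n1 i) (n i) u \<and>
      \<bar>f i (\<psi> (inv_into UNIV l) y1) - val i (map ((!) u) W)\<bar> < 1/4 \<and> val i (map ((!) u) W) \<in> {0..1}"
    if i: "i \<in> J" and l: "boolean_iso l" and dec: "decreasing_partition (pullback l R) (n i) (p i)"
      and mem: "\<And>j. j < n i \<Longrightarrow> l (cls (p i) {j}) \<in> E" for i l
  proof -
    have mem': "l (cls (p i) {j}) \<in> partition_algebra N c" if "j < n i" for j
      using mem[OF that] A(2) c(2) by blast
    have "\<exists>u. typed_word (big_count N c) N (?n1 i) (n i) u \<and> (\<forall>j<n i. l (cls (p i) {j}) = cls (\<lambda>x. u ! c x) {j})"
      by (rule embedding_word[OF R c(1) l preserves_countable[OF l] dec]) (rule mem')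
    then obtain u where u: "typed_word (big_count N c) N (?n1 i) (n i) u" "\<forall>j<n i. l (cls (p i) {j}) = cls (\<lambda>x. u ! c x) {j}"
      by (elim exE conjE)
    let ?w = "map ((!) u) W"
    have w: "typed_word N1' N' (?n1 i) (n i) ?w" by (rule typed_word_compose[OF W(1) u(1) bc(3) N'(2)])
    note gw = g[OF i w]
    have lW: "length W = N'" using typed_word_facts(1)[OF W(1) N'(2)] .
    have dN: "d x < N'" for x using d(1) by (simp add: partition_fun_def)
    have hl: "h (l (cls (p i) {j})) = g i ?w (cls (p i) {j})" if "j < n i" for j
    proof -
      have "l (cls (p i) {j}) = cls c {m. u ! m = j}" using u(2) that by (simp add: cls_def vimage_def)
      then have "h (l (cls (p i) {j})) = cls (\<lambda>x. W ! d x) {m. u ! m = j}" using h(2) by simp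
      also have "\<dots> = cls (\<lambda>x. ?w ! d x) {j}" using dN lW by (simp add: cls_def vimage_def)
      finally show ?thesis using gw(2) by simp
    qed
    let ?G = "g i ?w"
    \<comment> \<open>\<open>h \<circ> l\<close> and \<open>?G\<close> agree on the partition, so they differ by an automorphism fixing it.\<close>
    define v where "v = inv_into UNIV ?G \<circ> h \<circ> l"
    have v: "boolean_iso v" unfolding v_def
      by (intro boolean_iso_comp boolean_iso_inv gw(1) h(1) l)
    have vfix: "v (cls (p i) {j}) = cls (p i) {j}" if "j < n i" for j
      using hl[OF that] inv_comp(4)[OF gw(1)] by (simp add: v_def)
    have vi: "inv_into UNIV v (cls (p i) {j}) = cls (p i) {j}" if "j < n i" for j
      by (rule inv_comp(5)[OF v, THEN iffD2]) (rule vfix[OF that, symmetric])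
    have eq: "inv_into UNIV l \<circ> inv_into UNIV h = inv_into UNIV v \<circ> inv_into UNIV ?G"
    proof -
      have "h \<circ> l = ?G \<circ> v" unfolding v_def using inv_comp(3)[OF gw(1)] by (simp add: fun_eq_iff)
      then show ?thesis using inv_into_comp[OF h(1) l] inv_into_comp[OF gw(1) v] by simp
    qed
    let ?y = "\<psi> (inv_into UNIV ?G) y0"
    have yY: "?y \<in> topspace Y" using F(6) y0 boolean_iso_inv[OF gw(1)] by simp
    have "\<psi> (inv_into UNIV l) y1 = \<psi> (inv_into UNIV l \<circ> inv_into UNIV h) y0"
      unfolding y1_def using F(8)[of "inv_into UNIV l" "inv_into UNIV h" y0] y0 boolean_iso_inv[OF l] boolean_iso_inv[OF h(1)] by simp
    also have "\<dots> = \<psi> (inv_into UNIV v) ?y"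
      unfolding eq using F(8)[of "inv_into UNIV v" "inv_into UNIV ?G" y0] y0 boolean_iso_inv[OF v] boolean_iso_inv[OF gw(1)] by simp
    finally have "\<bar>f i (\<psi> (inv_into UNIV l) y1) - f i ?y\<bar> < 1/4"
      using small[OF i boolean_iso_inv[OF v] vi yY] by simp
    then show ?thesis using u(1) f[OF i yY] by (auto simp: val_def)
  qed
  have "\<bar>f i (\<psi> (inv_into UNIV (k i)) y1) - f i (\<psi> (inv_into UNIV (k' i)) y1)\<bar> \<le> 3/4" if i: "i \<in> J" for i
  proof -
    let ?Q = "\<lambda>l u. typed_word (big_count N c) N (?n1 i) (n i) u \<and>
      \<bar>f i (\<psi> (inv_into UNIV l) y1) - val i (map ((!) u) W)\<bar> < 1/4 \<and> val i (map ((!) u) W) \<in> {0..1}"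
    have "\<exists>u. ?Q (k i) u" by (rule approx[OF i k(1)[OF i] k(2)[OF i]]) (use i in \<open>auto simp: E_def\<close>)
    then obtain u where u: "typed_word (big_count N c) N (?n1 i) (n i) u"
        "\<bar>f i (\<psi> (inv_into UNIV (k i)) y1) - val i (map ((!) u) W)\<bar> < 1/4" "val i (map ((!) u) W) \<in> {0..1}"
      by (elim exE conjE)
    have "\<exists>u. ?Q (k' i) u" by (rule approx[OF i k'(1)[OF i] k'(2)[OF i]]) (use i in \<open>auto simp: E_def\<close>)
    then obtain u' where u': "typed_word (big_count N c) N (?n1 i) (n i) u'"
        "\<bar>f i (\<psi> (inv_into UNIV (k' i)) y1) - val i (map ((!) u') W)\<bar> < 1/4" "val i (map ((!) u') W) \<in> {0..1}"
      by (elim exE conjE)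
    have eq: "col i (map ((!) u) W) = col i (map ((!) u') W)"
      using W(2)[OF i] u(1) u'(1) unfolding typed_homogeneous_def by blast
    have fl: "\<lfloor>4 * val i (map ((!) u) W)\<rfloor> = \<lfloor>4 * val i (map ((!) u') W)\<rfloor>"
    proof -
      have bounds: "0 \<le> \<lfloor>4 * x\<rfloor> \<and> \<lfloor>4 * x\<rfloor> \<le> 4" if "x \<in> {0..1}" for x :: real
        using that floor_mono[of "4 * x" 4] by simp
      have "a = b" if "min 4 (nat a) = min 4 (nat b)" "0 \<le> a \<and> a \<le> 4" "0 \<le> b \<and> b \<le> 4" for a b :: int
        using that by (auto simp: min_def split: if_splits)
      from this[OF eq[unfolded col_def] bounds[OF u(3)] bounds[OF u'(3)]] show ?thesis .
    qed
    then have "\<bar>val i (map ((!) u) W) - val i (map ((!) u') W)\<bar> < 1/4" by linarith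
    then show ?thesis using u(2) u'(2) by linarith
  qed
  then show ?thesis using y1 by blast
qed

definition small_on_stabilizer ::
    "'y topology \<Rightarrow> (('a pfin \<Rightarrow> 'a pfin) \<Rightarrow> 'y \<Rightarrow> 'y) \<Rightarrow> ('y \<Rightarrow> real) \<Rightarrow> nat \<Rightarrow> ('a \<Rightarrow> nat) \<Rightarrow> bool"
  where "small_on_stabilizer Y \<psi> f n p \<longleftrightarrow> (\<forall>g. boolean_iso g \<longrightarrow> (\<forall>j<n. g (cls p {j}) = cls p {j}) \<longrightarrow>
      (\<forall>y\<in>topspace Y. \<bar>f (\<psi> g y) - f y\<bar> < 1/4))"

text \<open>The function \<open>f\<close> tests whether two translates of \<open>z\<close> are close. The constants leave room: if
\<open>f\<close> separates two points, its values there are \<open>0\<close> and \<open>1\<close>, which are more than \<open>3/4\<close> apart.\<close>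

definition follows_ordering ::
    "'y topology \<Rightarrow> ((omega1 pfin \<Rightarrow> omega1 pfin) \<Rightarrow> 'y \<Rightarrow> 'y) \<Rightarrow> (omega1 pfin \<times> omega1 pfin \<Rightarrow> bool) \<Rightarrow> 'y \<Rightarrow> bool"
  where "follows_ordering Y \<psi> R z \<longleftrightarrow> (\<forall>f n p k k'. continuous_map Y euclideanreal f \<longrightarrow> (\<forall>y\<in>topspace Y. 0 \<le> f y \<and> f y \<le> 1) \<longrightarrow>
      small_on_stabilizer Y \<psi> f n p \<longrightarrow> boolean_iso k \<longrightarrow> decreasing_partition (pullback k R) n p \<longrightarrow>
      boolean_iso k' \<longrightarrow> decreasing_partition (pullback k' R) n p \<longrightarrow>
      \<bar>f (\<psi> (inv_into UNIV k) z) - f (\<psi> (inv_into UNIV k') z)\<bar> \<le> 3/4)"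

text \<open>Each single requirement on \<open>z\<close> is closed, and finitely many of them are met by
\<open>ex_homogeneous_translate\<close>.\<close>

lemma ex_order_following_point:
  fixes \<psi> :: "(omega1 pfin \<Rightarrow> omega1 pfin) \<Rightarrow> 'y \<Rightarrow> 'y"
  assumes fl: "flow aut_group (pointwise_topology (carrier aut_group)) Y \<psi>" and ne: "topspace Y \<noteq> {}"
    and R: "antilexicographic countable_classes R"
  shows "\<exists>z\<in>topspace Y. follows_ordering Y \<psi> R z"
proof -
  let ?I = "{(f, n, p, k, k'). continuous_map Y euclideanreal f \<and> (\<forall>y\<in>topspace Y. 0 \<le> f y \<and> f y \<le> 1) \<and>
      small_on_stabilizer Y \<psi> f n p \<and> boolean_iso k \<and> decreasing_partition (pullback k R) n p \<and>
      boolean_iso k' \<and> decreasing_partition (pullback k' R) n p}"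
  define K where "K = (\<lambda>(f, n :: nat, p :: omega1 \<Rightarrow> nat, k, k').
      {y \<in> topspace Y. f (\<psi> (inv_into UNIV k) y) - f (\<psi> (inv_into UNIV k') y) \<in> {-(3/4)..3/4 :: real}})"
  have Kmem: "y \<in> K (f, n, p, k, k') \<longleftrightarrow> y \<in> topspace Y \<and>
      \<bar>f (\<psi> (inv_into UNIV k) y) - f (\<psi> (inv_into UNIV k') y)\<bar> \<le> 3/4" for y f n p k k'
  proof -
    have "x \<in> {-(3/4)..3/4} \<longleftrightarrow> \<bar>x\<bar> \<le> 3/4" for x :: real by (simp add: abs_le_iff) linarith
    then show ?thesis unfolding K_def prod.case mem_Collect_eq by (simp only:)
  qed
  have "\<exists>z\<in>topspace Y. \<forall>i\<in>?I. z \<in> K i"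
  proof (rule compact_space_indexed_fip[OF flowD(1)[OF fl]])
    fix i assume "i \<in> ?I"
    then obtain f n p k k' where i: "i = (f, n, p, k, k')" "continuous_map Y euclideanreal f" "boolean_iso k" "boolean_iso k'"
      by auto
    have "continuous_map Y euclideanreal (\<lambda>y. f (\<psi> (inv_into UNIV l) y))" if "boolean_iso l" for l
      using continuous_map_compose[OF continuous_map_translate[OF fl, of "inv_into UNIV l"] i(2)] boolean_iso_inv[OF that]
      by (simp add: o_def)
    then have "continuous_map Y euclideanreal (\<lambda>y. f (\<psi> (inv_into UNIV k) y) - f (\<psi> (inv_into UNIV k') y))"
      using i(3,4) by (intro continuous_map_diff) auto
    then show "closedin Y (K i)"
      unfolding i(1) K_def prod.case by (rule closedin_continuous_map_preimage) (simp add: closed_closedin[symmetric])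
  next
    fix J assume J: "finite J" "J \<subseteq> ?I"
    obtain y0 where y0: "y0 \<in> topspace Y" using ne by blast
    let ?f = "fst" and ?n = "\<lambda>i. fst (snd i)" and ?p = "\<lambda>i. fst (snd (snd i))"
      and ?k = "\<lambda>i. fst (snd (snd (snd i)))" and ?k' = "\<lambda>i. snd (snd (snd (snd i)))"
    have I: "(\<forall>y\<in>topspace Y. 0 \<le> ?f i y \<and> ?f i y \<le> 1)" "small_on_stabilizer Y \<psi> (?f i) (?n i) (?p i)"
      "boolean_iso (?k i)" "decreasing_partition (pullback (?k i) R) (?n i) (?p i)"
      "boolean_iso (?k' i)" "decreasing_partition (pullback (?k' i) R) (?n i) (?p i)" if "i \<in> J" for i
      using subsetD[OF J(2) that] by (cases i; simp)+
    have "\<exists>y\<in>topspace Y. \<forall>i\<in>J. \<bar>?f i (\<psi> (inv_into UNIV (?k i)) y) - ?f i (\<psi> (inv_into UNIV (?k' i)) y)\<bar> \<le> 3/4"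
    proof (rule ex_homogeneous_translate[OF fl y0 R J(1), where n = ?n and p = ?p])
      fix i y assume "i \<in> J" "y \<in> topspace Y"
      then show "0 \<le> ?f i y \<and> ?f i y \<le> 1" using I(1) by blast
    next
      fix i g y
      assume i: "i \<in> J" and "boolean_iso g" "\<And>j. j < ?n i \<Longrightarrow> g (cls (?p i) {j}) = cls (?p i) {j}" "y \<in> topspace Y"
      then show "\<bar>?f i (\<psi> g y) - ?f i y\<bar> < 1/4" using I(2)[OF i] unfolding small_on_stabilizer_def by blast
    qed (use I in auto)
    then obtain y where y: "y \<in> topspace Y"
      "\<And>i. i \<in> J \<Longrightarrow> \<bar>?f i (\<psi> (inv_into UNIV (?k i)) y) - ?f i (\<psi> (inv_into UNIV (?k' i)) y)\<bar> \<le> 3/4" by blast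
    have "y \<in> K i" if "i \<in> J" for i
      using y(2)[OF that] y(1) by (cases i) (simp add: Kmem)
    then show "\<exists>y\<in>topspace Y. \<forall>i\<in>J. y \<in> K i" using y(1) by blast
  qed
  then obtain z where z: "z \<in> topspace Y" "\<And>i. i \<in> ?I \<Longrightarrow> z \<in> K i" by blast
  have "follows_ordering Y \<psi> R z"
    unfolding follows_ordering_def
  proof (intro allI impI)
    fix f n p k k'
    assume "continuous_map Y euclideanreal f" "\<forall>y\<in>topspace Y. 0 \<le> f y \<and> f y \<le> 1"
      "small_on_stabilizer Y \<psi> f n p" "boolean_iso k" "decreasing_partition (pullback k R) n p"
      "boolean_iso k'" "decreasing_partition (pullback k' R) n p"
    then have "(f, n, p, k, k') \<in> ?I" by simp
    then show "\<bar>f (\<psi> (inv_into UNIV k) z) - f (\<psi> (inv_into UNIV k') z)\<bar> \<le> 3/4"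
      using z(2) Kmem by blast
  qed
  then show ?thesis using z(1) by blast
qed

section \<open>The factor map\<close>

text \<open>If the closure \<open>Z\<close> of the orbit of \<open>(R, z)\<close> contained \<open>(S, a)\<close> and \<open>(S, b)\<close> with \<open>a \<noteq> b\<close>, then a function \<open>f\<close> with
\<open>f a = 0\<close> and \<open>f b = 1\<close> would distinguish two translates of \<open>z\<close> whose orderings agree with \<open>S\<close> on
an arbitrarily large finite subalgebra, contrary to the choice of \<open>z\<close>.\<close>

lemma NO_universal:
  fixes \<psi> :: "(omega1 pfin \<Rightarrow> omega1 pfin) \<Rightarrow> 'y \<Rightarrow> 'y"
  assumes min: "minimal_flow aut_group (pointwise_topology (carrier aut_group)) Y \<psi>"
  shows "\<exists>F. factor_map aut_group (pointwise_topology (NO countable_classes)) (NO_action countable_classes) Y \<psi> F"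
proof -
  let ?N = "NO (countable_classes :: omega1 pfin set)" and ?A = "NO_action (countable_classes :: omega1 pfin set)"
  let ?X = "pointwise_topology ?N" and ?G = "aut_group :: (omega1 pfin \<Rightarrow> omega1 pfin) monoid"
  let ?P = "prod_topology ?X Y"
  have fl: "flow ?G (pointwise_topology (carrier aut_group)) Y \<psi>" and ne: "topspace Y \<noteq> {}"
    using min by (auto simp: minimal_flow_def)
  have flN: "flow ?G (pointwise_topology (carrier aut_group)) ?X ?A" by (rule NO_flow)
  note YD = flowD[OF fl]
  obtain R where RN: "R \<in> ?N" using NO_nonempty by blast
  then have R: "antilexicographic countable_classes R" by (simp only: NO_iff_antilexicographic)
  from ex_order_following_point[OF fl ne R]
  obtain z where z: "z \<in> topspace Y" and follow: "follows_ordering Y \<psi> R z" by (elim bexE)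
  have kN: "pullback k R \<in> ?N" if "boolean_iso k" for k by (rule pullback_in_NO[OF that RN])
  define Q where "Q = {(pullback k R, \<psi> (inv_into UNIV k) z) | k. boolean_iso k}"
  have Q: "Q \<subseteq> topspace ?P" using kN YD(6) z boolean_iso_inv by (auto simp: Q_def)
  define Z where "Z = ?P closure_of Q"
  have Zc: "closedin ?P Z" by (simp add: Z_def)
  have QZ: "Q \<subseteq> Z" unfolding Z_def by (rule closure_of_subset[OF Q])
  have Zsub: "Z \<subseteq> ?N \<times> topspace Y" using closedin_subset[OF Zc] by simp

  have single: "a = b" if ab: "(S, a) \<in> Z" "(S, b) \<in> Z" for S a b
  proof (rule ccontr)
    assume "a \<noteq> b"
    have SN: "S \<in> ?N" and aY: "a \<in> topspace Y" and bY: "b \<in> topspace Y" using ab Zsub by auto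
    have S: "antilexicographic countable_classes S" using SN by (simp only: NO_iff_antilexicographic)
    have "normal_space Y" using YD(1,2) compact_Hausdorff_or_regular_imp_normal_space by blast
    moreover have "closedin Y {a}" "closedin Y {b}" using YD(2) aY bY by (simp_all add: closedin_Hausdorff_singleton)
    moreover have "disjnt {a} {b}" using \<open>a \<noteq> b\<close> by simp
    ultimately obtain f :: "'y \<Rightarrow> real" where f: "continuous_map Y (top_of_set {0..1}) f" "f ` {a} \<subseteq> {0}" "f ` {b} \<subseteq> {1}"
      using Urysohn_lemma[of Y "{a}" "{b}" 0 1] by (metis zero_le_one)
    have fc: "continuous_map Y euclideanreal f" and f01: "\<forall>y\<in>topspace Y. 0 \<le> f y \<and> f y \<le> 1"
      using f(1) by (auto simp: continuous_map_in_subtopology Pi_iff)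
    have "\<exists>E. finite E \<and> (\<forall>g. boolean_iso g \<longrightarrow> (\<forall>a\<in>E. g a = a) \<longrightarrow> (\<forall>y\<in>topspace Y. \<bar>f (\<psi> g y) - f y\<bar> < 1/4))"
      by (rule uniformly_small_displacement[OF fl fc]) simp
    then obtain E where E: "finite E" "\<And>g y. boolean_iso g \<Longrightarrow> \<forall>a\<in>E. g a = a \<Longrightarrow> y \<in> topspace Y \<Longrightarrow> \<bar>f (\<psi> g y) - f y\<bar> < 1/4"
      by blast
    from finite_subset_of_subalgebra[OF E(1)] obtain B where B: "finite_subalgebra B" "E \<subseteq> B" by (elim exE conjE)
    from decreasing_partition_of_subalgebra[OF infinite_omega1 B(1) antilexicographic_linear[OF S]]
    obtain n p where p: "decreasing_partition S n p" "B = partition_algebra n p" by (elim exE conjE)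
    have pf: "partition_fun n p" using p(1) by (simp add: decreasing_partition_def)
    have small: "small_on_stabilizer Y \<psi> f n p"
      unfolding small_on_stabilizer_def
    proof (intro allI impI ballI)
      fix g y assume g: "boolean_iso g" "\<forall>j<n. g (cls p {j}) = cls p {j}" and y: "y \<in> topspace Y"
      have "g a = a" if "a \<in> E" for a
        by (rule fixes_partition_algebra[OF g(1) pf]) (use g(2) that B(2) p(2) in auto)
      then show "\<bar>f (\<psi> g y) - f y\<bar> < 1/4" using E(2)[OF g(1) _ y] by blast
    qed
    have BB: "finite (B \<times> B)" using B(1) by (simp add: finite_subalgebra_def)
    let ?U = "{S' \<in> ?N. \<forall>i\<in>B \<times> B. S' i = S i}"
    have approx: "\<exists>k. boolean_iso k \<and> decreasing_partition (pullback k R) n p \<and> f (\<psi> (inv_into UNIV k) z) \<in> V"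
      if y: "(S, y) \<in> Z" and V: "open V" "f y \<in> V" for y V
    proof -
      have "openin Y {y \<in> topspace Y. f y \<in> V}"
        by (rule openin_continuous_map_preimage[OF fc]) (simp add: open_openin[symmetric] V(1))
      then have W: "openin ?P (?U \<times> {y \<in> topspace Y. f y \<in> V})"
        unfolding openin_prod_Times_iff by (intro disjI2 conjI openin_finite_agreement[OF BB])
      have "y \<in> topspace Y" using y Zsub by blast
      then have mem: "(S, y) \<in> ?U \<times> {y \<in> topspace Y. f y \<in> V}" using SN V(2) by simp
      have "\<forall>T. (S, y) \<in> T \<and> openin ?P T \<longrightarrow> (\<exists>q. q \<in> Q \<and> q \<in> T)"
        using y unfolding Z_def in_closure_of by (rule conjunct2)
      from this[rule_format, OF conjI[OF mem W]]
      obtain q where q: "q \<in> Q" "q \<in> ?U \<times> {y \<in> topspace Y. f y \<in> V}" by (elim exE conjE)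
      then obtain k where k: "boolean_iso k" "q = (pullback k R, \<psi> (inv_into UNIV k) z)" by (auto simp: Q_def)
      have agree: "\<forall>i\<in>B \<times> B. pullback k R i = S i" using q(2) unfolding k(2) mem_Sigma_iff mem_Collect_eq by blast
      have "pullback k R (cls p {j}, cls p {i})" if ij: "i < j" "j < n" for i j
      proof -
        have "(cls p {j}, cls p {i}) \<in> B \<times> B" using partition_algebra_mem[OF pf] p(2) by simp
        then have "pullback k R (cls p {j}, cls p {i}) = S (cls p {j}, cls p {i})" using agree by blast
        then show ?thesis using p(1) ij by (simp add: decreasing_partition_def)
      qed
      then have "decreasing_partition (pullback k R) n p" using pf unfolding decreasing_partition_def by blast
      moreover have "f (\<psi> (inv_into UNIV k) z) \<in> V" using q(2) k(2) by simp
      ultimately show ?thesis using k(1) by blast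
    qed
    have "f a \<in> {..<1/8}" "f b \<in> {7/8<..}" using f(2,3) by auto
    from approx[OF ab(1) open_lessThan this(1)] approx[OF ab(2) open_greaterThan this(2)]
    obtain k k' where k: "boolean_iso k" "decreasing_partition (pullback k R) n p" "f (\<psi> (inv_into UNIV k) z) < 1/8"
      and k': "boolean_iso k'" "decreasing_partition (pullback k' R) n p" "7/8 < f (\<psi> (inv_into UNIV k') z)"
      by auto
    have "\<bar>f (\<psi> (inv_into UNIV k) z) - f (\<psi> (inv_into UNIV k') z)\<bar> \<le> 3/4"
      by (rule follow[unfolded follows_ordering_def, rule_format, OF fc _ small k(1,2) k'(1,2)]) (use f01 in blast)
    then show False using k(3) k'(3) by linarith
  qed

  have "fst ` Z = ?N"
  proof (rule orbit_dense[OF RN])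
    show "closedin ?X (fst ` Z)" using closed_map_fst[OF YD(1), of ?X] Zc unfolding closed_map_def by blast
    show "pullback k R \<in> fst ` Z" if "boolean_iso k" for k
    proof -
      have "(pullback k R, \<psi> (inv_into UNIV k) z) \<in> Z" using QZ that by (auto simp: Q_def)
      then show ?thesis by force
    qed
  qed
  define F where "F S = (THE y. (S, y) \<in> Z)" for S
  have unique: "y = F S" if "(S, y) \<in> Z" for S y
    unfolding F_def using that single by (intro the_equality[symmetric]) auto
  have graph: "(S, F S) \<in> Z" if "S \<in> ?N" for S
  proof -
    have "S \<in> fst ` Z" using that \<open>fst ` Z = ?N\<close> by simp
    then obtain y where "(S, y) \<in> Z" by force
    then show ?thesis using unique by metis
  qed
  have cont: "continuous_map ?X Y F"
    by (rule continuous_map_closed_graph[OF YD(1) Zc]) (use graph unique in auto)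

  have equivariant: "F (?A g S) = \<psi> g (F S)" if g: "g \<in> carrier ?G" and S: "S \<in> ?N" for g S
  proof -
    let ?t = "\<lambda>(S, y). (?A g S, \<psi> g y)"
    have gi: "boolean_iso g" using g by simp
    have t: "continuous_map ?P ?P ?t"
    proof -
      have "continuous_map ?P ?X (?A g \<circ> fst)"
        by (rule continuous_map_compose[OF continuous_map_fst continuous_map_translate[OF flN g]])
      moreover have "continuous_map ?P Y (\<psi> g \<circ> snd)"
        by (rule continuous_map_compose[OF continuous_map_snd continuous_map_translate[OF fl g]])
      ultimately show ?thesis unfolding continuous_map_pairwise by (simp add: o_def case_prod_beta)
    qed
    have "?t ` Q \<subseteq> Q"
    proof (rule image_subsetI)
      fix q assume "q \<in> Q"
      then obtain k where k: "boolean_iso k" "q = (pullback k R, \<psi> (inv_into UNIV k) z)" by (auto simp: Q_def)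
      let ?k = "k \<circ> inv_into UNIV g"
      have kg: "boolean_iso ?k" by (rule boolean_iso_comp[OF k(1) boolean_iso_inv[OF gi]])
      have "?A g (pullback k R) = pullback ?k R"
        by (simp add: NO_action_eq[OF kN[OF k(1)]] pullback_comp)
      moreover have "\<psi> g (\<psi> (inv_into UNIV k) z) = \<psi> (inv_into UNIV ?k) z"
      proof -
        have "inv_into UNIV ?k = g \<circ> inv_into UNIV k"
          by (simp add: inv_into_comp[OF k(1) boolean_iso_inv[OF gi]] inv_into_inv[OF gi])
        then show ?thesis using YD(8)[OF g, of "inv_into UNIV k" z] boolean_iso_inv[OF k(1)] z by simp
      qed
      ultimately show "?t q \<in> Q" using k(2) kg by (auto simp: Q_def)
    qed
    then have "?t ` Z \<subseteq> Z"
      unfolding Z_def using continuous_map_image_closure_subset[OF t, of Q] closure_of_mono by blast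
    then have "(?A g S, \<psi> g (F S)) \<in> Z" using graph[OF S] by auto
    then show ?thesis using unique by simp
  qed
  have "F ` ?N = topspace Y"
  proof -
    have "compactin ?X ?N" using compact_NO by (simp add: compact_space_def)
    then have "compactin Y (F ` ?N)" by (rule image_compactin[OF _ cont])
    then have "closedin Y (F ` ?N)" by (rule compactin_imp_closedin[OF YD(2)])
    moreover have "F ` ?N \<noteq> {}" using RN by blast
    moreover have "\<psi> g ` F ` ?N \<subseteq> F ` ?N" if g: "g \<in> carrier ?G" for g
    proof (rule image_subsetI)
      fix y assume "y \<in> F ` ?N"
      then obtain S where S: "S \<in> ?N" "y = F S" by blast
      have "?A g S \<in> ?N" using flowD(6)[OF flN g, of S] S(1) by simp
      then show "\<psi> g y \<in> F ` ?N" using equivariant[OF g S(1)] S(2) by (metis imageI)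
    qed
    ultimately have inv: "closedin Y (F ` ?N) \<and> F ` ?N \<noteq> {} \<and> (\<forall>g\<in>carrier ?G. \<psi> g ` F ` ?N \<subseteq> F ` ?N)"
      by (intro conjI ballI)
    have minC: "\<forall>C. closedin Y C \<and> C \<noteq> {} \<and> (\<forall>g\<in>carrier ?G. \<psi> g ` C \<subseteq> C) \<longrightarrow> C = topspace Y"
      using min unfolding minimal_flow_def by (elim conjE)
    show ?thesis by (rule mp[OF spec[OF minC, of "F ` ?N"] inv])
  qed
  then have "factor_map ?G ?X ?A Y \<psi> F"
    unfolding factor_map_def topspace_pointwise by (intro conjI ballI cont equivariant)
  then show ?thesis by (rule exI[of _ F])
qed

end

theorem corollary1:
  assumes "\<nexists>f :: nat pfin \<Rightarrow> omega1 pfin. boolean_iso f"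
  shows "universal_minimal_flow TYPE('y)
    (aut_group :: (omega1 pfin \<Rightarrow> omega1 pfin) monoid)
    (pointwise_topology (carrier aut_group))
    (pointwise_topology (NO countable_classes))
    (NO_action countable_classes)"
  unfolding universal_minimal_flow_def
  by (intro conjI allI impI NO_minimal_flow[OF assms] NO_universal[OF assms])

end
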